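(* Let $n\ge2$, let $m_1,\dots,m_n>0$, and let $c>0$. Counted up to the action of $S^1=SO(2)$, there are exactly $n!/2$ geodesic ordinary central configurations in $S^-_c$, one for each ordering of the masses along $\mathbb{H}^1$ (an ordering and its reverse being identified by the rotation by $\pi$). At each of them, the Hessian of the function induced by $U_{-1}$ on the quotient manifold $S^-_c/S^1$ has inertia $(n_0,n_+,n_-)=(0,n,n-2)$.
   Context: $\mathbb{H}^2=\{(x,y,w)\in\mathbb{R}^3: x^2+y^2-w^2=-1,\ w\ge1\}$, with the Riemannian metric induced from the form $\mathbf q_1\cdot\mathbf q_2=x_1x_2+y_1y_2-w_1w_2$; the distance $d_{ij}$ between $\mathbf q_i,\mathbf q_j$ is given by $\cosh d_{ij}=-\mathbf q_i\cdot\mathbf q_j$. $\mathbb{H}^1=\{(x,y,w)\in\mathbb{H}^2:y=0\}$, a geodesic. Configurations are $\mathbf q=(\mathbf q_1,\dots,\mathbf q_n)\in(\mathbb{H}^2)^n$, $\mathbf q_i=(x_i,y_i,w_i)$; $\Delta_-=\bigcup_{i<j}\{\mathbf q:\mathbf q_i=\mathbf q_j\}$; $U_{-1}(\mathbf q)=\sum_{i<j}m_im_j\coth d_{ij}$ on $(\mathbb{H}^2)^n\setminus\Delta_-$; $I_{-1}(\mathbf q)=\sum_i m_i(x_i^2+y_i^2)$; and $S^-_c=\{\mathbf q\in(\mathbb{H}^2)^n\setminus\Delta_-: I_{-1}(\mathbf q)=c\}$. The group $S^1=SO(2)$ acts on configurations by rotating all $(x_i,y_i)$ simultaneously; it preserves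 $U_{-1}$ and $I_{-1}$, and $S^-_c/S^1$ is a smooth $(2n-2)$-dimensional manifold. An ordinary central configuration is a critical point of $U_{-1}-\lambda I_{-1}$ for some $\lambda\in\mathbb{R}$ (those in $S^-_c$ are the critical points of $U_{-1}|_{S^-_c}$); it is geodesic if all particles lie on one geodesic of $\mathbb{H}^2$; every geodesic ordinary central configuration is $S^1$-equivalent to one on $\mathbb{H}^1$. The inertia $(n_0,n_+,n_-)$ of a quadratic form is the triple of its nullity, positive index and negative index. *)

theory Defs
  imports "HOL-Analysis.Analysis" "HOL-Combinatorics.Multiset_Permutations"
begin

section \<open>The hyperbolic plane\<close>

text \<open>The components 1, 2, 3 of a point are its coordinates x, y, w.\<close>

definition mink :: "real^3 \<Rightarrow> real^3 \<Rightarrow> real" where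
  "mink p q = p$1 * q$1 + p$2 * q$2 - p$3 * q$3"

definition hyp2 :: "(real^3) set" where
  "hyp2 = {p. mink p p = -1 \<and> p$3 \<ge> 1}"

definition hyp1 :: "(real^3) set" where
  "hyp1 = {p \<in> hyp2. p$2 = 0}"

definition hdist :: "real^3 \<Rightarrow> real^3 \<Rightarrow> real" where
  "hdist p q = arcosh (- mink p q)"

text \<open>In the hyperbolic plane the complete Riemannian geodesics are exactly the images of the
  distance-preserving maps from the real line.\<close>

definition hgeodesic :: "(real^3) set \<Rightarrow> bool" where
  "hgeodesic L \<longleftrightarrow> (\<exists>g :: real \<Rightarrow> real^3. (\<forall>t. g t \<in> hyp2) \<and>
     (\<forall>s t. hdist (g s) (g t) = \<bar>s - t\<bar>) \<and> L = range g)"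

lemma cosh_hdist:
  assumes "p \<in> hyp2" "q \<in> hyp2"
  shows "cosh (hdist p q) = - mink p q"
proof -
  have p: "(p$3)\<^sup>2 = 1 + (p$1)\<^sup>2 + (p$2)\<^sup>2" and q: "(q$3)\<^sup>2 = 1 + (q$1)\<^sup>2 + (q$2)\<^sup>2"
    and pos: "p$3 \<ge> 1" "q$3 \<ge> 1"
    using assms by (auto simp: hyp2_def mink_def power2_eq_square)
  let ?a = "p$1 * q$1 + p$2 * q$2"
  have "(p$3 * q$3)\<^sup>2 - (1 + ?a)\<^sup>2
      = (p$1 - q$1)\<^sup>2 + (p$2 - q$2)\<^sup>2 + (p$1 * q$2 - p$2 * q$1)\<^sup>2"
    unfolding power_mult_distrib p q by (simp add: power2_eq_square algebra_simps)
  then have "(1 + ?a)\<^sup>2 \<le> (p$3 * q$3)\<^sup>2"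
    by (smt (verit) zero_le_power2)
  then have "1 + ?a \<le> p$3 * q$3"
    by (rule power2_le_imp_le) (use pos in simp)
  then show ?thesis
    by (simp add: hdist_def mink_def cosh_arcosh_real)
qed

lemma hgeodesic_hyp1: "hgeodesic hyp1"
proof -
  define g :: "real \<Rightarrow> real^3" where "g t = vector [sinh t, 0, cosh t]" for t
  have m: "- mink (g s) (g t) = cosh (s - t)" for s t
    by (simp add: mink_def g_def cosh_diff)
  have g: "g t \<in> hyp2" for t
    using m[of t t] by (simp add: hyp2_def g_def cosh_real_ge_1)
  have "p \<in> range g" if "p \<in> hyp1" for p
  proof -
    have p: "p$2 = 0" "p$3 \<ge> 1" "(p$3)\<^sup>2 = 1 + (p$1)\<^sup>2"
      using that by (auto simp: hyp1_def hyp2_def mink_def power2_eq_square)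
    have "cosh (arsinh (p$1)) = p$3"
      using p cosh_square_eq[of "arsinh (p$1)"]
      by (smt (verit) cosh_real_nonneg power2_eq_imp_eq sinh_arsinh_real)
    then have "p = g (arsinh (p$1))"
      by (simp add: g_def vec_eq_iff forall_3 p)
    then show ?thesis by blast
  qed
  moreover have "g t \<in> hyp1" for t
    using g[of t] by (simp add: hyp1_def g_def)
  moreover have "hdist (g s) (g t) = \<bar>s - t\<bar>" for s t
  proof -
    have "cosh \<bar>s - t\<bar> = cosh (s - t)"
      using cosh_minus[of "s - t"] by (cases "s - t \<ge> 0") (simp_all only: abs_of_nonneg abs_of_neg not_le)
    then show ?thesis
      unfolding hdist_def m by (metis abs_ge_zero arcosh_cosh_real)
  qed
  ultimately show ?thesis
    unfolding hgeodesic_def using g by (intro exI[of _ g]) blast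
qed


section \<open>Configurations, potential and moment of inertia\<close>

text \<open>The linearly ordered finite type \<^typ>\<open>'n\<close> plays the role of the index set {1..n}.\<close>

type_synonym 'n config = "real^3^'n"

definition collisions :: "'n::{finite,linorder} config set" where
  "collisions = (\<Union>i. \<Union>j\<in>{i<..}. {q. q$i = q$j})"

definition config_space :: "'n::{finite,linorder} config set" where
  "config_space = {q. \<forall>i. q$i \<in> hyp2} - collisions"

definition coth :: "real \<Rightarrow> real" where
  "coth x = cosh x / sinh x"

definition potential :: "('n::{finite,linorder} \<Rightarrow> real) \<Rightarrow> 'n config \<Rightarrow> real" where
  "potential m q = (\<Sum>(i,j)\<in>{(i,j). i < j}. m i * m j * coth (hdist (q$i) (q$j)))"

definition inertia_moment :: "('n::finite \<Rightarrow> real) \<Rightarrow> 'n config \<Rightarrow> real" where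
  "inertia_moment m q = (\<Sum>i\<in>UNIV. m i * ((q$i$1)\<^sup>2 + (q$i$2)\<^sup>2))"

definition level_set :: "('n::{finite,linorder} \<Rightarrow> real) \<Rightarrow> real \<Rightarrow> 'n config set" where
  "level_set m c = {q \<in> config_space. inertia_moment m q = c}"


section \<open>The rotation action and the quotient\<close>

definition rotate_config :: "real \<Rightarrow> 'n::finite config \<Rightarrow> 'n config" where
  "rotate_config \<theta> q = (\<chi> i. vector [cos \<theta> * q$i$1 - sin \<theta> * q$i$2,
                                      sin \<theta> * q$i$1 + cos \<theta> * q$i$2, q$i$3])"

definition S1_rel :: "('n::finite config \<times> 'n config) set" where
  "S1_rel = {(p, q). \<exists>\<theta>. q = rotate_config \<theta> p}"

definition orbit :: "'n::finite config \<Rightarrow> 'n config set" where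
  "orbit q = S1_rel `` {q}"

definition induced_fun :: "('n::finite config \<Rightarrow> real) \<Rightarrow> 'n config set \<Rightarrow> real" where
  "induced_fun f C = the_elem (f ` C)"

lemma rotate_config_0: "rotate_config 0 q = q"
  by (simp add: rotate_config_def vec_eq_iff forall_3)

lemma rotate_config_add: "rotate_config a (rotate_config b q) = rotate_config (a + b) q"
  by (simp add: rotate_config_def vec_eq_iff forall_3 cos_add sin_add algebra_simps)

lemma equiv_S1_rel: "equiv UNIV (S1_rel :: ('n::finite config \<times> _) set)"
proof (rule equivI)
  show "refl (S1_rel :: ('n config \<times> _) set)"
  proof (rule refl_onI)
    fix q :: "'n config"
    have "q = rotate_config 0 q" by (simp only: rotate_config_0)
    then show "(q, q) \<in> S1_rel" unfolding S1_rel_def by blast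
  qed
  show "sym (S1_rel :: ('n config \<times> _) set)"
  proof (rule symI)
    fix p q :: "'n config" assume "(p, q) \<in> S1_rel"
    then obtain a where "q = rotate_config a p" by (auto simp: S1_rel_def)
    then have "p = rotate_config (-a) q" by (simp add: rotate_config_add rotate_config_0)
    then show "(q, p) \<in> S1_rel" by (auto simp: S1_rel_def)
  qed
  show "trans (S1_rel :: ('n config \<times> _) set)"
    by (rule transI) (auto simp: S1_rel_def rotate_config_add)
qed auto

lemma mink_rotate: "mink (rotate_config \<theta> q $ i) (rotate_config \<theta> q $ j) = mink (q$i) (q$j)"
proof -
  have "mink (rotate_config \<theta> q $ i) (rotate_config \<theta> q $ j)
      = ((sin \<theta>)\<^sup>2 + (cos \<theta>)\<^sup>2) * (q$i$1 * q$j$1 + q$i$2 * q$j$2) - q$i$3 * q$j$3"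
    by (simp add: mink_def rotate_config_def power2_eq_square algebra_simps
        del: sin_cos_squared_add sin_cos_squared_add2 sin_cos_squared_add3)
  then show ?thesis by (simp add: mink_def)
qed

lemma induced_potential: "induced_fun (potential m) (orbit q) = potential m q"
proof -
  have "potential m ` orbit q = {potential m q}"
    using rotate_config_0[of q]
    by (force simp: orbit_def S1_rel_def potential_def hdist_def mink_rotate intro: exI[of _ 0])
  then show ?thesis by (simp add: induced_fun_def)
qed


section \<open>Central configurations\<close>

text \<open>On an embedded submanifold M, the differential of the restriction of f to M vanishes at q
  iff f has derivative zero at q within M.\<close>

definition critical_point_on ::
  "'a::real_normed_vector set \<Rightarrow> ('a \<Rightarrow> real) \<Rightarrow> 'a \<Rightarrow> bool" where
  "critical_point_on M f q \<longleftrightarrow> q \<in> M \<and> (f has_derivative (\<lambda>_. 0)) (at q within M)"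

definition ordinary_cc :: "('n::{finite,linorder} \<Rightarrow> real) \<Rightarrow> 'n config \<Rightarrow> bool" where
  "ordinary_cc m q \<longleftrightarrow>
     (\<exists>\<mu>. critical_point_on config_space (\<lambda>p. potential m p - \<mu> * inertia_moment m p) q)"

definition geodesic_config :: "'n::finite config \<Rightarrow> bool" where
  "geodesic_config q \<longleftrightarrow> (\<exists>L. hgeodesic L \<and> (\<forall>i. q$i \<in> L))"

definition geodesic_cc_classes ::
  "('n::{finite,linorder} \<Rightarrow> real) \<Rightarrow> real \<Rightarrow> 'n config set set" where
  "geodesic_cc_classes m c =
     {q \<in> level_set m c. ordinary_cc m q \<and> geodesic_config q} // S1_rel"

text \<open>An ordering of the masses is a list in which every index occurs exactly once, i.e. an
  element of \<^term>\<open>permutations_of_set UNIV\<close>.\<close>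

definition ordered_on_hyp1 :: "'n list \<Rightarrow> 'n::finite config \<Rightarrow> bool" where
  "ordered_on_hyp1 \<sigma> q \<longleftrightarrow> (\<forall>i. q$i \<in> hyp1) \<and> sorted_wrt (\<lambda>i j. q$i$1 < q$j$1) \<sigma>"

definition has_ordering :: "'n::finite config set \<Rightarrow> 'n list \<Rightarrow> bool" where
  "has_ordering C \<sigma> \<longleftrightarrow> (\<exists>q\<in>C. ordered_on_hyp1 \<sigma> q)"


section \<open>Inertia of a symmetric bilinear form\<close>

definition inertia ::
  "'a::euclidean_space set \<Rightarrow> ('a \<Rightarrow> 'a \<Rightarrow> real) \<Rightarrow> nat \<times> nat \<times> nat" where
  "inertia E B =
     (dim {v\<in>E. \<forall>w\<in>E. B v w = 0},
      Max (dim ` {W. subspace W \<and> W \<subseteq> E \<and> (\<forall>w\<in>W - {0}. B w w > 0)}),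
      Max (dim ` {W. subspace W \<and> W \<subseteq> E \<and> (\<forall>w\<in>W - {0}. B w w < 0)}))"


section \<open>The Hessian on the quotient manifold\<close>

primrec Ck_on :: "nat \<Rightarrow> ('a::real_normed_vector \<Rightarrow> 'b::real_normed_vector) \<Rightarrow> 'a set \<Rightarrow> bool" where
  "Ck_on 0 f S \<longleftrightarrow> continuous_on S f"
| "Ck_on (Suc k) f S \<longleftrightarrow>
     (\<exists>f'. (\<forall>x\<in>S. (f has_derivative f' x) (at x)) \<and> (\<forall>v. Ck_on k (\<lambda>x. f' x v) S))"

definition smooth_on :: "('a::real_normed_vector \<Rightarrow> 'b::real_normed_vector) \<Rightarrow> 'a set \<Rightarrow> bool" where
  "smooth_on f S \<longleftrightarrow> (\<forall>k. Ck_on k f S)"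

text \<open>Local parametrizations (inverse charts) of the quotient manifold. The model space is any
  linear subspace E of dimension 2n - 2 (taken inside the configuration type, because there is no
  type expression of that dimension), and the parametrization is \<open>\<lambda>u. orbit (\<phi> u)\<close> on the
  relatively open subset \<open>V \<inter> E\<close> of E, given through a smooth lift \<open>\<phi>\<close> to the level set. Since
  the projection to the quotient is a submersion whose kernel is the tangent line of the orbit, the
  last condition says that \<open>\<lambda>u. orbit (\<phi> u)\<close> has injective differential; by equality of dimensions
  and injectivity it is a diffeomorphism onto an open subset of the quotient.\<close>

definition quotient_param ::
  "('n::{finite,linorder} \<Rightarrow> real) \<Rightarrow> real \<Rightarrow> 'n config set \<Rightarrow> 'n config set \<Rightarrow>
   ('n config \<Rightarrow> 'n config) \<Rightarrow> bool" where
  "quotient_param m c E V \<phi> \<longleftrightarrow>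
     subspace E \<and> dim E = 2 * CARD('n) - 2 \<and> open V \<and> smooth_on \<phi> V \<and>
     \<phi> ` (V \<inter> E) \<subseteq> level_set m c \<and>
     inj_on (\<lambda>u. orbit (\<phi> u)) (V \<inter> E) \<and>
     (\<forall>u\<in>V \<inter> E. \<forall>v\<in>E.
        frechet_derivative \<phi> (at u) v
          \<in> span {vector_derivative (\<lambda>\<theta>. rotate_config \<theta> (\<phi> u)) (at 0)} \<longrightarrow> v = 0)"

text \<open>Second derivative of g at u as a bilinear form, by mixed directional derivatives.\<close>

definition hessian_form :: "('a::real_vector \<Rightarrow> real) \<Rightarrow> 'a \<Rightarrow> 'a \<Rightarrow> 'a \<Rightarrow> real" where
  "hessian_form g u v w = deriv (\<lambda>s. deriv (\<lambda>t. g (u + s *\<^sub>R v + t *\<^sub>R w)) 0) 0"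

text \<open>The inertia of the Hessian of a function F on the quotient manifold at the point C, computed
  in local coordinates: coordinates at C exist and all of them give the inertia \<open>\<iota>\<close>. This notion is
  meant for critical points C of F only, where the Hessian does not depend on the coordinates.\<close>

definition quotient_hessian_inertia ::
  "('n::{finite,linorder} \<Rightarrow> real) \<Rightarrow> real \<Rightarrow> ('n config set \<Rightarrow> real) \<Rightarrow> 'n config set \<Rightarrow>
   nat \<times> nat \<times> nat \<Rightarrow> bool" where
  "quotient_hessian_inertia m c F C \<iota> \<longleftrightarrow>
     (\<exists>E V \<phi>. quotient_param m c E V \<phi> \<and> (\<exists>u\<in>V \<inter> E. orbit (\<phi> u) = C)) \<and>
     (\<forall>E V \<phi>. \<forall>u\<in>V \<inter> E. quotient_param m c E V \<phi> \<longrightarrow> orbit (\<phi> u) = C \<longrightarrow>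
        inertia E (hessian_form (\<lambda>x. F (orbit (\<phi> x))) u) = \<iota>)"

end

theory Submission
  imports Defs
begin

text \<open>
  Write \<open>z = - mink p q\<close> for the hyperbolic cosine of a distance. Each pair contributes
  \<open>z / sqrt (z\<^sup>2 - 1)\<close> to the potential, which makes the potential smooth on an open set of the
  ambient linear space. A configuration is central iff the force on every particle is a combination
  of its planar part and its position (\<open>cc_equations\<close>, \<open>ordinary_cc_iff\<close>), the multiplier being
  common to all particles. Two test fields give all the geometry that is needed. The field pointing
  away from the apex expands all distances, so the multiplier is negative
  (\<open>cc_multiplier_negative\<close>). The normal to a geodesic that carries the particles does no work, and
  with a nonzero multiplier this forces the geodesic through the apex (\<open>geodesic_cc_through_apex\<close>).
  A rotation then puts the configuration on the geodesic \<open>y = 0\<close>.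

  On that geodesic, with arclength parameters \<open>\<theta>\<close> of the particles, the hyperbolic cotangent of a
  distance and \<open>sinh\<^sup>2\<close> are convex. As the multiplier \<open>\<mu>\<close> is negative, the function
  \<open>potential - \<mu> * inertia_moment\<close> is strictly convex on the configurations of a given order and a
  central configuration is its only minimum. Two central configurations of the same order and size
  would then each have the smaller potential, whence uniqueness (\<open>hyp1_cc_unique\<close>). Existence
  (\<open>exists_hyp1_cc\<close>) comes from minimising the potential over the ordered points of the ellipsoid
  \<open>\<Sum> m x\<^sup>2 = c\<close>, the potential being infinite at collisions. Only rotations by multiples of \<open>\<pi>\<close>
  preserve the geodesic, so exactly an ordering and its reverse give the same class.

  For the Hessian, subtract from the potential multiples of the constraints so that the resulting
  Lagrangian has vanishing derivative in the ambient space. In any coordinates the Hessian is then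
  the second variation of the Lagrangian pulled back along the derivative of the coordinates
  (\<open>hessian_form_lagrange\<close>), and no second derivative of the coordinates enters. At a configuration
  on the line the second variation splits (\<open>lagrange_form_line\<close>). Along the line it is positive
  definite, by convexity. For displacements \<open>b\<close> across the line put \<open>b = \<beta> * cosh \<theta>\<close>; the form
  becomes a positive multiple of a weighted square norm of \<open>\<beta>\<close> minus the Dirichlet form of a
  weighted complete graph. It is positive on constants, it vanishes on \<open>\<beta> = tanh \<theta>\<close>, which is the
  direction of the rotation, and it is negative on the remaining \<open>n - 2\<close> dimensions, because
  \<open>tanh \<theta>\<close> belongs to the lowest nonzero eigenvalue of the graph and that eigenvalue is simple.
  This last fact is \<open>spectral_gap\<close>: an eigenvector of a lower or equal eigenvalue, added to a
  suitable multiple of \<open>tanh \<theta>\<close>, gives a monotone vector with a coincidence, and the graph operator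
  pulls such coincidences apart. On the tangent space of the level set, of dimension
  \<open>2 * n - 1\<close>, the indices are therefore \<open>n - 1\<close> plus \<open>1\<close> positive, \<open>n - 2\<close> negative and \<open>1\<close>
  null. The derivative of a coordinate map has its range transversal to the null direction, so the
  quotient sees the inertia \<open>(0, n, n - 2)\<close>.
\<close>

section \<open>Inertia of a form pulled back along a transversal map\<close>

text \<open>The image of \<open>E\<close> has codimension at most one in \<open>T\<close>, so intersecting it with \<open>P\<close> costs at most
  one dimension.\<close>

lemma dim_preimage_ge:
  fixes A :: "'a::euclidean_space \<Rightarrow> 'b::euclidean_space"
  assumes E: "subspace E" and A: "linear A" and inj: "inj_on A E"
    and P: "subspace P" and T: "A ` E \<subseteq> T" "P \<subseteq> T" "subspace T" "dim T \<le> dim E + 1"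
  shows "subspace {v\<in>E. A v \<in> P} \<and> dim P \<le> dim {v\<in>E. A v \<in> P} + 1"
proof
  have "{v\<in>E. A v \<in> P} = E \<inter> A -` P" by auto
  then show sub: "subspace {v\<in>E. A v \<in> P}"
    using subspace_inter[OF E linear_subspace_vimage[OF A P]] by simp
  have im: "A ` {v\<in>E. A v \<in> P} = A ` E \<inter> P" by auto
  have inj': "inj_on A (span {v\<in>E. A v \<in> P})"
    using inj sub by (metis (no_types, lifting) inj_on_subset mem_Collect_eq span_eq_iff subsetI)
  have 1: "dim (A ` E \<inter> P) = dim {v\<in>E. A v \<in> P}"
    using dim_image_eq[OF A inj'] im by simp
  have 2: "dim (A ` E) = dim E"
    using dim_image_eq[OF A] inj E by (simp add: span_eq_iff[THEN iffD2])
  have AE: "subspace (A ` E)" using linear_subspace_image[OF A E] .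
  have "{x + y |x y. x \<in> A ` E \<and> y \<in> P} \<subseteq> T"
    using T subspace_add by blast
  then have "dim {x + y |x y. x \<in> A ` E \<and> y \<in> P} \<le> dim E + 1"
    by (rule order.trans[OF dim_subset T(4)])
  then show "dim P \<le> dim {v\<in>E. A v \<in> P} + 1"
    using dim_sums_Int[OF AE P] 1 2 by linarith
qed

lemma dim_disjoint_le:
  fixes W :: "'a::euclidean_space set"
  assumes "subspace W" "subspace V" "subspace E" "W \<subseteq> E" "V \<subseteq> E" "W \<inter> V \<subseteq> {0}"
  shows "dim W + dim V \<le> dim E"
proof -
  have "{x + y |x y. x \<in> W \<and> y \<in> V} \<subseteq> E"
    using assms subspace_add by blast
  then have "dim {x + y |x y. x \<in> W \<and> y \<in> V} \<le> dim E" by (rule dim_subset)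
  moreover have "dim (W \<inter> V) = 0" using assms(6) by simp
  ultimately show ?thesis using dim_sums_Int[OF assms(1,2)] by linarith
qed

text \<open>A positive definite subspace meets \<open>N\<close> only in \<open>0\<close> and hence has at most the dimension of \<open>P\<close>;
  likewise for negative definite ones. For a null vector \<open>x + y\<close> with \<open>x\<close> in \<open>P\<close> and \<open>y\<close> in \<open>N\<close>,
  pairing with \<open>x\<close> and with \<open>y\<close> shows that the values at \<open>x\<close> and \<open>y\<close> agree, so both vanish.\<close>

lemma inertia_of_splitting:
  fixes E :: "'a::euclidean_space set"
  assumes E: "subspace E"
    and sym: "\<And>v w. v \<in> E \<Longrightarrow> w \<in> E \<Longrightarrow> H v w = H w v"
    and add: "\<And>u v w. u \<in> E \<Longrightarrow> v \<in> E \<Longrightarrow> w \<in> E \<Longrightarrow> H (u + v) w = H u w + H v w"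
    and P: "subspace P" "P \<subseteq> E" "\<And>v. v \<in> P \<Longrightarrow> v \<noteq> 0 \<Longrightarrow> H v v > 0"
    and N: "subspace N" "N \<subseteq> E" "\<And>v. v \<in> N \<Longrightarrow> v \<noteq> 0 \<Longrightarrow> H v v < 0"
    and dimE: "dim E \<le> dim P + dim N"
  shows "inertia E H = (0, dim P, dim N)"
proof -
  have PN: "P \<inter> N \<subseteq> {0}" using P(3) N(3) by fastforce
  have 1: "dim P + dim N \<le> dim E" by (rule dim_disjoint_le) (use P N E PN in auto)
  have sums: "{x + y |x y. x \<in> P \<and> y \<in> N} = E"
  proof (rule subspace_dim_equal)
    show "subspace {x + y |x y. x \<in> P \<and> y \<in> N}" using subspace_sums P(1) N(1) by blast
    show "{x + y |x y. x \<in> P \<and> y \<in> N} \<subseteq> E" using P(2) N(2) E subspace_add by blast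
    have "dim (P \<inter> N) = 0" using PN by simp
    then show "dim E \<le> dim {x + y |x y. x \<in> P \<and> y \<in> N}"
      using dim_sums_Int[OF P(1) N(1)] dimE by linarith
  qed (rule E)
  have null: "v = 0" if v: "v \<in> E" "\<forall>w\<in>E. H v w = 0" for v
  proof -
    obtain x y where xy: "x \<in> P" "y \<in> N" "v = x + y" using sums v(1) by blast
    then have xE: "x \<in> E" "y \<in> E" using P(2) N(2) by auto
    have "H x x + H y x = 0" "H x y + H y y = 0"
      using v(2) xE add xy(3) by metis+
    then have "H x x = H y y" using sym[OF xE] by simp
    moreover have "x = 0 \<or> H x x > 0" "y = 0 \<or> H y y < 0" using P(3) N(3) xy by auto
    moreover have "H 0 0 = 0" using add[of 0 0 0] subspace_0[OF E] by simp
    ultimately show ?thesis using xy(3) by force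
  qed
  have "0 \<in> E" by (rule subspace_0[OF E])
  moreover have "H 0 w = 0" if "w \<in> E" for w using add[of 0 0 w] subspace_0[OF E] that by simp
  ultimately have "{v\<in>E. \<forall>w\<in>E. H v w = 0} = {0}" using null by auto
  then have n0: "dim {v\<in>E. \<forall>w\<in>E. H v w = 0} = 0" by simp
  have fin: "finite (dim ` S)" if "S \<subseteq> {W. W \<subseteq> E}" for S
    by (rule finite_subset[of _ "{..dim E}"]) (use that in \<open>auto intro!: dim_subset\<close>)
  have np: "Max (dim ` {W. subspace W \<and> W \<subseteq> E \<and> (\<forall>w\<in>W - {0}. H w w > 0)}) = dim P"
  proof (rule Max_eqI)
    fix d assume "d \<in> dim ` {W. subspace W \<and> W \<subseteq> E \<and> (\<forall>w\<in>W - {0}. H w w > 0)}"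
    then obtain W where W: "d = dim W" "subspace W" "W \<subseteq> E" "\<forall>w\<in>W - {0}. H w w > 0" by blast
    have "x = 0" if "x \<in> W" "x \<in> N" for x
    proof (rule ccontr)
      assume "x \<noteq> 0"
      then have "H x x > 0" "H x x < 0" using W(4) N(3) that by blast+
      then show False by simp
    qed
    then have "W \<inter> N \<subseteq> {0}" by blast
    then have "dim W + dim N \<le> dim E" using dim_disjoint_le W N E by blast
    then show "d \<le> dim P" using dimE W(1) by linarith
  qed (use P in \<open>auto intro!: fin imageI\<close>)
  have nn: "Max (dim ` {W. subspace W \<and> W \<subseteq> E \<and> (\<forall>w\<in>W - {0}. H w w < 0)}) = dim N"
  proof (rule Max_eqI)
    fix d assume "d \<in> dim ` {W. subspace W \<and> W \<subseteq> E \<and> (\<forall>w\<in>W - {0}. H w w < 0)}"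
    then obtain W where W: "d = dim W" "subspace W" "W \<subseteq> E" "\<forall>w\<in>W - {0}. H w w < 0" by blast
    have "x = 0" if "x \<in> W" "x \<in> P" for x
    proof (rule ccontr)
      assume "x \<noteq> 0"
      then have "H x x < 0" "H x x > 0" using W(4) P(3) that by blast+
      then show False by simp
    qed
    then have "W \<inter> P \<subseteq> {0}" by blast
    then have "dim W + dim P \<le> dim E" using dim_disjoint_le W P E by blast
    then show "d \<le> dim N" using dimE W(1) by linarith
  qed (use N in \<open>auto intro!: fin imageI\<close>)
  show ?thesis unfolding inertia_def n0 np nn ..
qed

text \<open>This is the passage from the tangent space \<open>T\<close> of a level set to the tangent space of its
  quotient by a group: \<open>R\<close> is the direction of the orbit, on which the form vanishes, and the
  linear map \<open>A\<close> embeds \<open>E\<close> as a complement of it. The semidefinite spaces \<open>P\<close> and \<open>N\<close> both may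
  contain \<open>R\<close>, so each loses one dimension when it is pulled back to \<open>E\<close>, where it becomes
  definite.\<close>

lemma inertia_of_transversal:
  fixes A :: "'a::euclidean_space \<Rightarrow> 'b::euclidean_space"
  assumes E: "subspace E" and A: "linear A"
    and bil: "bilinear B" and sym: "\<And>x y. B x y = B y x"
    and H: "\<And>v w. v \<in> E \<Longrightarrow> w \<in> E \<Longrightarrow> H v w = B (A v) (A w)"
    and T: "subspace T" "dim T \<le> dim E + 1" "A ` E \<subseteq> T"
    and R: "0 \<in> R" "\<And>v. v \<in> E \<Longrightarrow> A v \<in> R \<Longrightarrow> v = 0"
    and P: "subspace P" "P \<subseteq> T" "\<And>x. x \<in> P \<Longrightarrow> B x x \<ge> 0 \<and> (B x x = 0 \<longrightarrow> x \<in> R)"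
    and N: "subspace N" "N \<subseteq> T" "\<And>x. x \<in> N \<Longrightarrow> B x x \<le> 0 \<and> (B x x = 0 \<longrightarrow> x \<in> R)"
    and dims: "p + 1 \<le> dim P" "n + 1 \<le> dim N" "dim E = p + n"
  shows "inertia E H = (0, p, n)"
proof -
  have inj: "inj_on A E"
  proof (rule inj_onI)
    fix x y assume xy: "x \<in> E" "y \<in> E" "A x = A y"
    then have "A (x - y) = 0" by (simp add: linear_diff[OF A])
    then show "x = y" using R subspace_diff[OF E xy(1,2)] by (metis eq_iff_diff_eq_0)
  qed
  let ?P = "{v\<in>E. A v \<in> P}" and ?N = "{v\<in>E. A v \<in> N}"
  have dP: "subspace ?P" "dim P \<le> dim ?P + 1"
    using dim_preimage_ge[OF E A inj P(1) T(3) P(2) T(1,2)] by auto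
  have dN: "subspace ?N" "dim N \<le> dim ?N + 1"
    using dim_preimage_ge[OF E A inj N(1) T(3) N(2) T(1,2)] by auto
  have pos: "H v v > 0" if "v \<in> ?P" "v \<noteq> 0" for v
    using that P(3)[of "A v"] R(2)[of v] H[of v v] by fastforce
  have neg: "H v v < 0" if "v \<in> ?N" "v \<noteq> 0" for v
    using that N(3)[of "A v"] R(2)[of v] H[of v v] by fastforce
  have "?P \<inter> ?N \<subseteq> {0}" using pos neg by fastforce
  then have "dim ?P + dim ?N \<le> dim E" by (intro dim_disjoint_le dP dN E) auto
  then have eq: "dim ?P = p" "dim ?N = n" using dP(2) dN(2) dims by linarith+
  have "inertia E H = (0, dim ?P, dim ?N)"
  proof (rule inertia_of_splitting[OF E])
    show "H v w = H w v" if "v \<in> E" "w \<in> E" for v w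
      using H that sym by metis
    show "H (u + v) w = H u w + H v w" if "u \<in> E" "v \<in> E" "w \<in> E" for u v w
      using that by (simp add: H subspace_add[OF E] linear_add[OF A] bilinear_ladd[OF bil])
    show "dim E \<le> dim ?P + dim ?N" using eq dims(3) by simp
  qed (use dP(1) dN(1) pos neg in \<open>blast+\<close>)
  then show ?thesis using eq by simp
qed

section \<open>Closure properties of continuously differentiable functions\<close>

lemma Ck_on_const: "Ck_on k (\<lambda>x. a) S"
proof (induction k arbitrary: a)
  case (Suc k)
  show ?case unfolding Ck_on.simps
    by (rule exI[of _ "\<lambda>_ _. 0"]) (use Suc in simp)
qed simp

lemma Ck_on_linear:
  assumes "bounded_linear L" shows "Ck_on k L S"
proof (cases k)
  case 0 then show ?thesis using assms by (simp add: linear_continuous_on)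
next
  case (Suc k)
  show ?thesis unfolding Suc Ck_on.simps
    by (rule exI[of _ "\<lambda>_. L"]) (use assms Ck_on_const in \<open>auto intro: bounded_linear_imp_has_derivative\<close>)
qed

lemma Ck_on_SucI:
  assumes "\<And>x. x \<in> S \<Longrightarrow> (f has_derivative f' x) (at x)" "\<And>v. Ck_on k (\<lambda>x. f' x v) S"
  shows "Ck_on (Suc k) f S"
  unfolding Ck_on.simps using assms by blast

text \<open>The products and quotients in the derivative of a product, an inverse or a square root mix the
  function with its derivative, so the inductions below need the function itself at the lower
  level of smoothness.\<close>

lemma Ck_on_Suc_imp: "Ck_on (Suc k) f S \<Longrightarrow> Ck_on k f S"
proof (induction k arbitrary: f)
  case 0
  then obtain f' where "\<forall>x\<in>S. (f has_derivative f' x) (at x)" by auto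
  then have "\<forall>x\<in>S. isCont f x" using has_derivative_continuous by blast
  then show ?case by (simp add: continuous_at_imp_continuous_on)
next
  case (Suc k)
  from Suc.prems obtain f' where "\<forall>x\<in>S. (f has_derivative f' x) (at x)"
    "\<forall>v. Ck_on (Suc k) (\<lambda>x. f' x v) S"
    unfolding Ck_on.simps(2)[of "Suc k"] by blast
  then show ?case using Suc.IH by (intro Ck_on_SucI[of S f f']) blast+
qed

lemma Ck_on_compose_linear:
  assumes L: "bounded_linear L" shows "Ck_on k f S \<Longrightarrow> Ck_on k (\<lambda>x. L (f x)) S"
proof (induction k arbitrary: f)
  case 0
  then show ?case using bounded_linear.continuous_on[OF L] by simp
next
  case (Suc k)
  then obtain f' where "\<forall>x\<in>S. (f has_derivative f' x) (at x)" "\<forall>v. Ck_on k (\<lambda>x. f' x v) S"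
    by auto
  then show ?case using Suc.IH
    by (intro Ck_on_SucI[of S "\<lambda>x. L (f x)" "\<lambda>x v. L (f' x v)"] bounded_linear.has_derivative[OF L]) blast+
qed

lemma Ck_on_add: "Ck_on k f S \<Longrightarrow> Ck_on k g S \<Longrightarrow> Ck_on k (\<lambda>x. f x + g x) S"
proof (induction k arbitrary: f g)
  case 0 then show ?case by (simp add: continuous_on_add)
next
  case (Suc k)
  then obtain f' g' where "\<forall>x\<in>S. (f has_derivative f' x) (at x)" "\<forall>v. Ck_on k (\<lambda>x. f' x v) S"
    "\<forall>x\<in>S. (g has_derivative g' x) (at x)" "\<forall>v. Ck_on k (\<lambda>x. g' x v) S"
    by auto
  moreover from this have "((\<lambda>x. f x + g x) has_derivative (\<lambda>v. f' x v + g' x v)) (at x)"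
    if "x \<in> S" for x
    using that by (intro has_derivative_add) auto
  ultimately show ?case using Suc.IH
    by (intro Ck_on_SucI[of S "\<lambda>x. f x + g x" "\<lambda>x v. f' x v + g' x v"]) blast+
qed

lemma Ck_on_sum:
  assumes "finite I" "\<And>i. i \<in> I \<Longrightarrow> Ck_on k (f i) S"
  shows "Ck_on k (\<lambda>x. \<Sum>i\<in>I. f i x) S"
  using assms by (induction I rule: finite_induct) (auto intro: Ck_on_const Ck_on_add)

lemma Ck_on_mult:
  fixes f g :: "'a::real_normed_vector \<Rightarrow> real"
  shows "Ck_on k f S \<Longrightarrow> Ck_on k g S \<Longrightarrow> Ck_on k (\<lambda>x. f x * g x) S"
proof (induction k arbitrary: f g)
  case 0 then show ?case by (simp add: continuous_on_mult)
next
  case (Suc k)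
  then obtain f' g' where *: "\<forall>x\<in>S. (f has_derivative f' x) (at x)" "\<forall>v. Ck_on k (\<lambda>x. f' x v) S"
    "\<forall>x\<in>S. (g has_derivative g' x) (at x)" "\<forall>v. Ck_on k (\<lambda>x. g' x v) S"
    by auto
  have "Ck_on k f S" "Ck_on k g S" using Suc.prems Ck_on_Suc_imp by blast+
  then have "\<forall>v. Ck_on k (\<lambda>x. f x * g' x v + f' x v * g x) S"
    using * Suc.IH by (auto intro!: Ck_on_add)
  moreover have "((\<lambda>x. f x * g x) has_derivative (\<lambda>v. f x * g' x v + f' x v * g x)) (at x)"
    if "x \<in> S" for x
    using * that by (intro has_derivative_mult) auto
  ultimately show ?case
    by (intro Ck_on_SucI[of S "\<lambda>x. f x * g x" "\<lambda>x v. f x * g' x v + f' x v * g x"]) blast+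
qed

lemma Ck_on_inverse:
  fixes f :: "'a::real_normed_vector \<Rightarrow> real"
  assumes nz: "\<And>x. x \<in> S \<Longrightarrow> f x \<noteq> 0"
  shows "Ck_on k f S \<Longrightarrow> Ck_on k (\<lambda>x. inverse (f x)) S"
proof (induction k)
  case 0 then show ?case using nz by (simp add: continuous_on_inverse)
next
  case (Suc k)
  then obtain f' where *: "\<forall>x\<in>S. (f has_derivative f' x) (at x)" "\<forall>v. Ck_on k (\<lambda>x. f' x v) S"
    by auto
  have i: "Ck_on k (\<lambda>x. inverse (f x)) S" using Suc Ck_on_Suc_imp by blast
  have "Ck_on k (\<lambda>x. - (inverse (f x) * f' x v * inverse (f x))) S" for v
    by (rule Ck_on_compose_linear[OF bounded_linear_minus[OF bounded_linear_ident]])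
      (intro Ck_on_mult i, use * in blast)
  moreover have "((\<lambda>x. inverse (f x)) has_derivative (\<lambda>v. - (inverse (f x) * f' x v * inverse (f x)))) (at x)"
    if "x \<in> S" for x
    using * nz that by (intro Deriv.has_derivative_inverse) auto
  ultimately show ?case
    by (intro Ck_on_SucI[of S "\<lambda>x. inverse (f x)" "\<lambda>x v. - (inverse (f x) * f' x v * inverse (f x))"]) blast+
qed

lemma Ck_on_sqrt:
  fixes f :: "'a::real_normed_vector \<Rightarrow> real"
  assumes pos: "\<And>x. x \<in> S \<Longrightarrow> f x > 0"
  shows "Ck_on k f S \<Longrightarrow> Ck_on k (\<lambda>x. sqrt (f x)) S"
proof (induction k)
  case 0 then show ?case by (simp add: continuous_on_real_sqrt)
next
  case (Suc k)
  then obtain f' where *: "\<forall>x\<in>S. (f has_derivative f' x) (at x)" "\<forall>v. Ck_on k (\<lambda>x. f' x v) S"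
    by auto
  have "Ck_on k (\<lambda>x. sqrt (f x)) S" using Suc Ck_on_Suc_imp by blast
  then have i: "Ck_on k (\<lambda>x. inverse (2 * sqrt (f x))) S"
    by (intro Ck_on_inverse Ck_on_mult Ck_on_const) (use pos in \<open>auto simp: less_imp_neq[symmetric]\<close>)
  have "Ck_on k (\<lambda>x. f' x v * inverse (2 * sqrt (f x))) S" for v
    by (intro Ck_on_mult i) (use * in blast)
  moreover have "((\<lambda>x. sqrt (f x)) has_derivative (\<lambda>v. f' x v * inverse (2 * sqrt (f x)))) (at x)"
    if "x \<in> S" for x
  proof -
    have "(f has_derivative f' x) (at x)" using *(1) that by blast
    moreover have "DERIV sqrt (f x) :> inverse (2 * sqrt (f x))"
      using DERIV_real_sqrt[OF pos[OF that]] by simp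
    ultimately show ?thesis by (rule DERIV_compose_FDERIV[rotated])
  qed
  ultimately show ?case by (intro Ck_on_SucI[of S "\<lambda>x. sqrt (f x)" "\<lambda>x v. f' x v * inverse (2 * sqrt (f x))"]) blast+
qed

section \<open>A spectral gap for weighted graphs on the line\<close>

text \<open>Summation by parts on a graph: exchanging the two indices turns a sum against \<open>w i\<close> into one
  against the differences.\<close>

lemma sum_antisymmetric:
  fixes A :: "'n::finite \<Rightarrow> 'n \<Rightarrow> real"
  assumes "\<And>i j. A j i = - A i j"
  shows "(\<Sum>i\<in>UNIV. \<Sum>j\<in>UNIV. A i j * (w i - w j)) = 2 * (\<Sum>i\<in>UNIV. \<Sum>j\<in>UNIV. A i j * w i)"
proof -
  have "(\<Sum>i\<in>UNIV. \<Sum>j\<in>UNIV. A i j * w j) = (\<Sum>i\<in>UNIV. \<Sum>j\<in>UNIV. A j i * w i)"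
    by (rule sum.swap)
  also have "\<dots> = - (\<Sum>i\<in>UNIV. \<Sum>j\<in>UNIV. A i j * w i)"
    by (subst assms) (simp add: sum_negf)
  finally show ?thesis by (simp add: right_diff_distrib sum_subtractf)
qed

lemma quadratic_nonpos_imp_linear_zero:
  fixes a b :: real
  assumes "\<And>t. t * a + t\<^sup>2 * b \<le> 0"
  shows "a = 0"
proof (rule ccontr)
  assume a: "a \<noteq> 0"
  \<comment> \<open>For this denominator the quadratic term is smaller than the linear one.\<close>
  define D where "D = 1 + \<bar>b\<bar>"
  define t where "t = a / D"
  have D: "D > 0" "D + b > 0" by (simp_all add: D_def)
  have "t * a + t\<^sup>2 * b = a\<^sup>2 / D * (1 + b / D)"
    by (simp add: t_def power2_eq_square distrib_left)
  moreover have "a\<^sup>2 / D > 0" using a D by simp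
  moreover have "1 + b / D > 0" using D by (simp add: field_simps)
  ultimately have "t * a + t\<^sup>2 * b > 0" by (metis mult_pos_pos)
  then show False using assms[of t] by simp
qed

lemma exists_distinct:
  assumes "CARD('n) \<ge> 2"
  obtains a b :: 'n where "a \<noteq> b"
  using assms by (metis card_2_iff' ex_card UNIV_I subset_UNIV)

text \<open>Consider \<open>\<gamma> = r * \<tau> + \<beta>\<close> with \<open>r\<close> the largest downward slope of \<open>\<beta>\<close> against \<open>\<tau>\<close>. It is
  monotone in \<open>\<tau>\<close> and takes the same value at the two points \<open>i\<close>, \<open>j\<close> where the slope is
  attained. The difference of the graph operator at these two points is computed in two ways. The
  eigenvalue equations give it the sign of \<open>\<nu> - \<omega>\<close>. Computed from the rates, it is a sum of terms
  of the opposite sign, because the rates towards a point decrease with the distance in \<open>\<tau>\<close>.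
  All terms vanish, which makes \<open>\<gamma>\<close> constant. This is the discrete form of a flow that preserves
  the cone of monotone vectors.\<close>

lemma low_eigenvector_affine_of_descent:
  fixes \<tau> \<beta> :: "'n::finite \<Rightarrow> real" and G :: "'n \<Rightarrow> 'n \<Rightarrow> real"
  assumes right: "\<And>i j l. \<tau> i < \<tau> j \<Longrightarrow> \<tau> j < \<tau> l \<Longrightarrow> G i l < G j l"
    and left: "\<And>i j l. \<tau> l < \<tau> i \<Longrightarrow> \<tau> i < \<tau> j \<Longrightarrow> G j l < G i l"
    and inj: "inj \<tau>"
    and eig_\<tau>: "\<And>i. (\<Sum>l\<in>UNIV. G i l * (\<tau> i - \<tau> l)) = \<omega> * \<tau> i"
    and eig_\<beta>: "\<And>i. (\<Sum>l\<in>UNIV. G i l * (\<beta> i - \<beta> l)) = \<nu> * \<beta> i"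
    and le: "\<nu> \<le> \<omega>"
    and ex: "\<tau> i0 < \<tau> j0" "\<beta> j0 \<le> \<beta> i0"
  shows "\<exists>a r. \<forall>i. \<beta> i = a + r * \<tau> i"
proof -
  define D where "D = {(i,j). \<tau> i < \<tau> j}"
  define \<rho> where "\<rho> = (\<lambda>(i,j). (\<beta> i - \<beta> j) / (\<tau> j - \<tau> i))"
  define r where "r = Max (\<rho> ` D)"
  have D0: "(i0, j0) \<in> D" using ex by (simp add: D_def)
  have fin: "finite D" by (rule finite_subset[of _ UNIV]) auto
  have rmax: "(\<beta> i - \<beta> j) / (\<tau> j - \<tau> i) \<le> r" if "\<tau> i < \<tau> j" for i j
  proof -
    have "\<rho> (i,j) \<le> r" unfolding r_def using fin that by (intro Max_ge) (auto simp: D_def)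
    then show ?thesis by (simp add: \<rho>_def)
  qed
  have "r \<in> \<rho> ` D" unfolding r_def using fin D0 by (intro Max_in) auto
  then obtain i j where ij: "\<tau> i < \<tau> j" "r = (\<beta> i - \<beta> j) / (\<tau> j - \<tau> i)"
    by (auto simp: D_def \<rho>_def)
  have "(\<beta> i0 - \<beta> j0) / (\<tau> j0 - \<tau> i0) \<ge> 0" using ex by simp
  then have r0: "r \<ge> 0" using rmax[OF ex(1)] by linarith
  define \<gamma> where "\<gamma> k = r * \<tau> k + \<beta> k" for k
  have mono: "\<gamma> k \<le> \<gamma> l" if "\<tau> k \<le> \<tau> l" for k l
  proof (cases "\<tau> k = \<tau> l")
    case True then show ?thesis using inj by (simp add: inj_eq)
  next
    case False
    then have "\<tau> k < \<tau> l" using that by simp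
    then have "\<beta> k - \<beta> l \<le> r * (\<tau> l - \<tau> k)" using rmax[of k l] by (simp add: divide_le_eq)
    then show ?thesis by (simp add: \<gamma>_def algebra_simps)
  qed
  have slope: "\<beta> i - \<beta> j = r * (\<tau> j - \<tau> i)" using ij by (simp add: field_simps)
  then have eq: "\<gamma> i = \<gamma> j" by (simp add: \<gamma>_def algebra_simps)
  have lin: "(\<Sum>l\<in>UNIV. G k l * (\<gamma> k - \<gamma> l)) = r * (\<omega> * \<tau> k) + \<nu> * \<beta> k" for k
    unfolding eig_\<tau>[symmetric] eig_\<beta>[symmetric]
    by (simp add: \<gamma>_def sum.distrib[symmetric] sum_distrib_left algebra_simps)
  \<comment> \<open>The contribution of the point \<open>l\<close> to the difference of the operator at \<open>j\<close> and \<open>i\<close>.\<close>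
  define T where "T l = (G j l - G i l) * (\<gamma> l - \<gamma> i)" for l
  have "(\<Sum>l\<in>UNIV. T l)
      = (\<Sum>l\<in>UNIV. G i l * (\<gamma> i - \<gamma> l)) - (\<Sum>l\<in>UNIV. G j l * (\<gamma> j - \<gamma> l))"
    unfolding sum_subtractf[symmetric] T_def eq by (rule sum.cong) (auto simp: algebra_simps)
  also have "\<dots> = r * \<omega> * (\<tau> i - \<tau> j) + \<nu> * (\<beta> i - \<beta> j)"
    unfolding lin by (simp add: algebra_simps)
  also have "\<dots> = - (r * (\<omega> - \<nu>) * (\<tau> j - \<tau> i))" unfolding slope by (simp add: algebra_simps)
  also have "\<dots> \<le> 0" using r0 le ij(1) by simp
  finally have sum_le: "(\<Sum>l\<in>UNIV. T l) \<le> 0" .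
  have Tpos: "T l \<ge> 0" for l
  proof -
    consider "\<tau> j < \<tau> l" | "\<tau> l < \<tau> i" | "\<tau> i \<le> \<tau> l" "\<tau> l \<le> \<tau> j" by linarith
    then show ?thesis
    proof cases
      case 1
      then have "\<gamma> l - \<gamma> i \<ge> 0" using mono[of j l] eq by simp
      moreover have "G j l - G i l \<ge> 0" using right[OF ij(1) 1] by simp
      ultimately show ?thesis unfolding T_def by simp
    next
      case 2
      then have "\<gamma> l - \<gamma> i \<le> 0" using mono[of l i] eq by simp
      moreover have "G j l - G i l \<le> 0" using left[OF 2 ij(1)] by simp
      ultimately show ?thesis unfolding T_def by (rule mult_nonpos_nonpos[rotated])
    next
      case 3
      then have "\<gamma> l = \<gamma> i" using mono[of i l] mono[of l j] eq by simp
      then show ?thesis by (simp add: T_def)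
    qed
  qed
  have "T l = 0" for l
    using sum_nonneg_0[of UNIV T l] Tpos sum_le by (metis UNIV_I finite sum_nonneg antisym)
  then have const: "\<gamma> l = \<gamma> i" for l
  proof -
    have T0: "(G j l - G i l) * (\<gamma> l - \<gamma> i) = 0" using \<open>T l = 0\<close> by (simp add: T_def)
    consider "\<tau> j < \<tau> l" | "\<tau> l < \<tau> i" | "\<tau> i \<le> \<tau> l" "\<tau> l \<le> \<tau> j" by linarith
    then show ?thesis
    proof cases
      case 1 then show ?thesis using T0 right[OF ij(1) 1] by simp
    next
      case 2 then show ?thesis using T0 left[OF 2 ij(1)] by simp
    next
      case 3 then show ?thesis using mono[of i l] mono[of l j] eq by simp
    qed
  qed
  have "\<beta> l = \<gamma> i + (- r) * \<tau> l" for l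
    using const[of l] by (simp add: \<gamma>_def algebra_simps)
  then show ?thesis by blast
qed

text \<open>Either \<open>\<beta>\<close> or \<open>- \<beta>\<close> descends between two points at which \<open>\<tau>\<close> ascends, and both satisfy the same
  eigenvalue equation.\<close>

lemma low_eigenvector_affine:
  fixes \<tau> \<beta> :: "'n::finite \<Rightarrow> real" and G :: "'n \<Rightarrow> 'n \<Rightarrow> real"
  assumes right: "\<And>i j l. \<tau> i < \<tau> j \<Longrightarrow> \<tau> j < \<tau> l \<Longrightarrow> G i l < G j l"
    and left: "\<And>i j l. \<tau> l < \<tau> i \<Longrightarrow> \<tau> i < \<tau> j \<Longrightarrow> G j l < G i l"
    and inj: "inj \<tau>"
    and eig_\<tau>: "\<And>i. (\<Sum>l\<in>UNIV. G i l * (\<tau> i - \<tau> l)) = \<omega> * \<tau> i"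
    and eig_\<beta>: "\<And>i. (\<Sum>l\<in>UNIV. G i l * (\<beta> i - \<beta> l)) = \<nu> * \<beta> i"
    and le: "\<nu> \<le> \<omega>"
    and card: "CARD('n) \<ge> 2"
  shows "\<exists>a r. \<forall>i. \<beta> i = a + r * \<tau> i"
proof -
  obtain i j :: 'n where "i \<noteq> j" by (rule exists_distinct[OF card])
  then have "\<tau> i \<noteq> \<tau> j" using inj by (simp add: inj_eq)
  then obtain i0 j0 where ij: "\<tau> i0 < \<tau> j0" by (meson linorder_neqE)
  show ?thesis
  proof (cases "\<beta> j0 \<le> \<beta> i0")
    case True
    show ?thesis by (rule low_eigenvector_affine_of_descent[OF right left inj eig_\<tau> eig_\<beta> le ij True])
  next
    case False
    have eig: "(\<Sum>l\<in>UNIV. G i l * (- \<beta> i - - \<beta> l)) = \<nu> * - \<beta> i" for i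
    proof -
      have "(\<Sum>l\<in>UNIV. G i l * (- \<beta> i - - \<beta> l)) = - (\<Sum>l\<in>UNIV. G i l * (\<beta> i - \<beta> l))"
        unfolding sum_negf[symmetric] by (rule sum.cong) (auto simp: algebra_simps)
      then show ?thesis unfolding eig_\<beta> by simp
    qed
    have "\<exists>a r. \<forall>i. - \<beta> i = a + r * \<tau> i"
      by (rule low_eigenvector_affine_of_descent[OF right left inj eig_\<tau> eig le ij]) (use False in auto)
    then obtain a r where "\<And>i. - \<beta> i = a + r * \<tau> i" by blast
    then have "\<beta> i = (- a) + (- r) * \<tau> i" for i by (metis add.inverse_distrib_swap add.commute minus_minus mult_minus_left)
    then show ?thesis by blast
  qed
qed

text \<open>Each coordinate is bounded because its square is at most \<open>c / \<mu> i\<close>.\<close>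

lemma bounded_weighted_sphere:
  fixes \<mu> :: "'n::finite \<Rightarrow> real"
  assumes \<mu>: "\<And>i. \<mu> i > 0"
  shows "bounded {x :: real^'n. (\<Sum>i\<in>UNIV. \<mu> i * (x$i)\<^sup>2) = c}"
proof -
  have "norm x \<le> (\<Sum>i\<in>UNIV. 1 + c / \<mu> i)" if x: "(\<Sum>i\<in>UNIV. \<mu> i * (x$i)\<^sup>2) = c" for x :: "real^'n"
  proof -
    have "\<bar>x$i\<bar> \<le> 1 + c / \<mu> i" for i
    proof -
      have "\<mu> i * (x$i)\<^sup>2 \<le> (\<Sum>i\<in>UNIV. \<mu> i * (x$i)\<^sup>2)"
        by (rule member_le_sum) (use \<mu> in \<open>auto simp: less_imp_le\<close>)
      then have 1: "(x$i)\<^sup>2 \<le> c / \<mu> i" using \<mu>[of i] x by (simp add: field_simps)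
      have "\<bar>x$i\<bar> \<le> 1 + (x$i)\<^sup>2"
      proof (cases "\<bar>x$i\<bar> \<le> 1")
        case False
        then have "\<bar>x$i\<bar> * 1 \<le> \<bar>x$i\<bar> * \<bar>x$i\<bar>" by (intro mult_left_mono) auto
        then show ?thesis by (simp add: power2_eq_square)
      next
        case True
        then show ?thesis using zero_le_power2[of "x$i"] by linarith
      qed
      then show ?thesis using 1 by simp
    qed
    then show ?thesis using norm_le_l1_cart[of x] by (meson order.trans sum_mono)
  qed
  then show ?thesis by (auto intro: boundedI)
qed

text \<open>The form \<open>Q\<close> is \<open>\<omega>\<close> times the weighted square norm minus the Dirichlet form of the graph with
  weights \<open>K\<close>, and \<open>\<tau>\<close> is an eigenvector for \<open>\<omega>\<close>. If \<open>Q\<close> took a positive value on the vectors of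
  weighted mean zero, then its maximum on the unit sphere would be attained at an eigenvector for
  an eigenvalue below \<open>\<omega>\<close>. Such a vector is affine in \<open>\<tau>\<close>, hence a multiple of \<open>\<tau>\<close> by the mean
  zero condition, and \<open>Q\<close> vanishes there. Once \<open>Q\<close> is nonpositive, each of its zeros is a maximiser
  and the same argument applies to it.\<close>

lemma spectral_gap:
  fixes \<tau> \<beta> \<mu> :: "'n::finite \<Rightarrow> real" and K :: "'n \<Rightarrow> 'n \<Rightarrow> real"
  assumes right: "\<And>i j l. \<tau> i < \<tau> j \<Longrightarrow> \<tau> j < \<tau> l \<Longrightarrow> K i l / \<mu> i < K j l / \<mu> j"
    and left: "\<And>i j l. \<tau> l < \<tau> i \<Longrightarrow> \<tau> i < \<tau> j \<Longrightarrow> K j l / \<mu> j < K i l / \<mu> i"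
    and inj: "inj \<tau>" and card: "CARD('n) \<ge> 2"
    and \<mu>: "\<And>i. \<mu> i > 0" and sym: "\<And>i j. K i j = K j i"
    and \<omega>: "\<omega> > 0"
    and eig_\<tau>: "\<And>i. (\<Sum>l\<in>UNIV. K i l * (\<tau> i - \<tau> l)) = \<omega> * \<mu> i * \<tau> i"
    and orth: "(\<Sum>i\<in>UNIV. \<mu> i * \<beta> i) = 0"
  defines "Q \<equiv> \<lambda>\<beta>. \<Sum>i\<in>UNIV. \<beta> i * (\<omega> * \<mu> i * \<beta> i - (\<Sum>l\<in>UNIV. K i l * (\<beta> i - \<beta> l)))"
  shows "Q \<beta> \<le> 0 \<and> (Q \<beta> = 0 \<longrightarrow> (\<exists>r. \<forall>i. \<beta> i = r * \<tau> i))"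
proof -
  define L where "L \<beta> i = \<omega> * \<mu> i * \<beta> i - (\<Sum>l\<in>UNIV. K i l * (\<beta> i - \<beta> l))" for \<beta> i
  define b where "b \<beta> w = (\<Sum>i\<in>UNIV. w i * L \<beta> i)" for \<beta> w
  define nn where "nn \<beta> w = (\<Sum>i\<in>UNIV. \<mu> i * \<beta> i * w i)" for \<beta> w :: "'n \<Rightarrow> real"
  have Qb: "Q \<beta> = b \<beta> \<beta>" for \<beta> by (simp add: Q_def b_def L_def)
  have L_lin: "L (\<lambda>i. \<beta> i + t * w i) i = L \<beta> i + t * L w i" for \<beta> w t i
  proof -
    have "(\<Sum>l\<in>UNIV. K i l * (\<beta> i + t * w i - (\<beta> l + t * w l)))
        = (\<Sum>l\<in>UNIV. K i l * (\<beta> i - \<beta> l)) + t * (\<Sum>l\<in>UNIV. K i l * (w i - w l))"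
      unfolding sum_distrib_left sum.distrib[symmetric] by (rule sum.cong) (auto simp: algebra_simps)
    then show ?thesis by (simp add: L_def algebra_simps)
  qed
  have b_alt: "b \<beta> w = (\<Sum>i\<in>UNIV. \<omega> * \<mu> i * \<beta> i * w i)
      - (\<Sum>i\<in>UNIV. \<Sum>j\<in>UNIV. K i j * (\<beta> i - \<beta> j) * (w i - w j)) / 2" for \<beta> w
  proof -
    have "(\<Sum>i\<in>UNIV. \<Sum>j\<in>UNIV. K i j * (\<beta> i - \<beta> j) * (w i - w j))
        = 2 * (\<Sum>i\<in>UNIV. \<Sum>j\<in>UNIV. K i j * (\<beta> i - \<beta> j) * w i)"
      by (rule sum_antisymmetric) (use sym in \<open>simp add: algebra_simps\<close>)
    moreover have "b \<beta> w = (\<Sum>i\<in>UNIV. \<omega> * \<mu> i * \<beta> i * w i)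
      - (\<Sum>i\<in>UNIV. \<Sum>j\<in>UNIV. K i j * (\<beta> i - \<beta> j) * w i)"
      unfolding b_def L_def sum_subtractf[symmetric]
      by (rule sum.cong) (auto simp: algebra_simps sum_distrib_left)
    ultimately show ?thesis by simp
  qed
  have b_sym: "b \<beta> w = b w \<beta>" for \<beta> w
    unfolding b_alt by (simp add: mult_ac)
  have b_add: "b \<beta> (\<lambda>i. v i + t * w i) = b \<beta> v + t * b \<beta> w" for \<beta> v w t
    unfolding b_def by (simp add: sum_distrib_left sum.distrib algebra_simps)
  have n_sym: "nn \<beta> w = nn w \<beta>" for \<beta> w
    unfolding nn_def by (simp add: mult_ac)
  have n_add: "nn \<beta> (\<lambda>i. v i + t * w i) = nn \<beta> v + t * nn \<beta> w" for \<beta> v w t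
    unfolding nn_def by (simp add: sum_distrib_left sum.distrib algebra_simps)
  have Q_exp: "b (\<lambda>i. \<beta> i + t * w i) (\<lambda>i. \<beta> i + t * w i) = b \<beta> \<beta> + 2 * t * b \<beta> w + t\<^sup>2 * b w w" for \<beta> w t
    unfolding b_add[of "\<lambda>i. \<beta> i + t * w i"] b_sym[of "\<lambda>i. \<beta> i + t * w i"] b_add
    by (simp add: b_sym[of w \<beta>] power2_eq_square algebra_simps)
  have n_exp: "nn (\<lambda>i. \<beta> i + t * w i) (\<lambda>i. \<beta> i + t * w i) = nn \<beta> \<beta> + 2 * t * nn \<beta> w + t\<^sup>2 * nn w w" for \<beta> w t
    unfolding n_add[of "\<lambda>i. \<beta> i + t * w i"] n_sym[of "\<lambda>i. \<beta> i + t * w i"] n_add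
    by (simp add: n_sym[of w \<beta>] power2_eq_square algebra_simps)
  define S where "S = {\<beta>. (\<Sum>i\<in>UNIV. \<mu> i * \<beta> i) = 0}"
  have L1: "b \<beta> (\<lambda>_. 1) = 0" if "\<beta> \<in> S" for \<beta>
  proof -
    have "(\<Sum>i\<in>UNIV. \<omega> * \<mu> i * \<beta> i) = \<omega> * (\<Sum>i\<in>UNIV. \<mu> i * \<beta> i)"
      by (simp add: sum_distrib_left mult.assoc)
    then show ?thesis using that unfolding b_alt S_def by simp
  qed
  have L\<tau>: "L \<tau> i = 0" for i by (simp add: L_def eig_\<tau>)
  have \<mu>\<tau>: "(\<Sum>i\<in>UNIV. \<mu> i * \<tau> i) = 0"
  proof -
    have "b (\<lambda>_. 1) \<tau> = 0" unfolding b_sym[of "\<lambda>_. 1" \<tau>] by (simp add: b_def L\<tau>)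
    moreover have "b (\<lambda>_. 1) \<tau> = \<omega> * (\<Sum>i\<in>UNIV. \<mu> i * \<tau> i)"
      unfolding b_alt by (simp add: sum_distrib_left mult.assoc)
    ultimately show ?thesis using \<omega> by simp
  qed
  have \<mu>sum: "(\<Sum>i\<in>UNIV. \<mu> i) > 0" by (rule sum_pos) (use \<mu> in auto)
  \<comment> \<open>\<open>M\<close> is the maximum of the quotient of the two forms; the maximiser solves the eigenvalue
    equation for \<open>\<omega> - M\<close>.\<close>
  have maximiser: "\<exists>r. \<forall>i. \<beta> i = r * \<tau> i"
    if \<beta>S: "\<beta> \<in> S" and M: "M \<ge> 0" and max: "\<And>w. w \<in> S \<Longrightarrow> b w w \<le> M * nn w w"
      and eq: "b \<beta> \<beta> = M * nn \<beta> \<beta>" for M \<beta>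
  proof -
    have first: "b \<beta> w = M * nn \<beta> w" if w: "w \<in> S" for w
    proof -
      have "t * (2 * (b \<beta> w - M * nn \<beta> w)) + t\<^sup>2 * (b w w - M * nn w w) \<le> 0" for t
      proof -
        have "(\<lambda>i. \<beta> i + t * w i) \<in> S"
          using \<beta>S w unfolding S_def
          by (simp add: distrib_left sum.distrib mult.left_commute[of _ t] sum_distrib_left[symmetric])
        from max[OF this] show ?thesis
          unfolding Q_exp n_exp using eq by (simp add: algebra_simps)
      qed
      then have "2 * (b \<beta> w - M * nn \<beta> w) = 0" by (rule quadratic_nonpos_imp_linear_zero)
      then show ?thesis by simp
    qed
    have "L \<beta> i = M * \<mu> i * \<beta> i" for i
    proof -
      define e where "e k = (if k = i then 1 else 0 :: real)" for k
      \<comment> \<open>The constant that gives \<open>e + a\<close> the weighted mean zero. The equation tested on \<open>e + a\<close> also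
        holds for \<open>e\<close>, since both sides vanish on constants.\<close>
      define a where "a = - (\<mu> i / (\<Sum>i\<in>UNIV. \<mu> i))"
      have e: "(\<Sum>k\<in>UNIV. f k * e k) = f i" for f
        using sum.delta[of UNIV i f] by (simp add: e_def if_distrib[of "(*) (f _)"] cong: if_cong)
      have "(\<Sum>k\<in>UNIV. \<mu> k * (e k + a * 1)) = \<mu> i + a * (\<Sum>i\<in>UNIV. \<mu> i)"
        using e[of \<mu>] by (simp add: distrib_left sum.distrib sum_distrib_left mult_ac)
      then have "(\<lambda>k. e k + a * 1) \<in> S" using \<mu>sum by (simp add: S_def a_def)
      from first[OF this] have "b \<beta> e = M * nn \<beta> e + M * a * nn \<beta> (\<lambda>_. 1)"
        unfolding b_add n_add using L1[OF \<beta>S] by (simp add: algebra_simps)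
      moreover have "nn \<beta> (\<lambda>_. 1) = 0" using \<beta>S by (simp add: nn_def S_def)
      moreover have "b \<beta> e = L \<beta> i" using e[of "L \<beta>"] by (simp add: b_def mult.commute)
      moreover have "nn \<beta> e = \<mu> i * \<beta> i" using e[of "\<lambda>i. \<mu> i * \<beta> i"] by (simp add: nn_def)
      ultimately show ?thesis by simp
    qed
    then have eigK: "(\<Sum>l\<in>UNIV. K i l * (\<beta> i - \<beta> l)) = (\<omega> - M) * \<mu> i * \<beta> i" for i
      by (simp add: L_def algebra_simps)
    have div: "(\<Sum>l\<in>UNIV. K i l / \<mu> i * (f i - f l)) = (\<Sum>l\<in>UNIV. K i l * (f i - f l)) / \<mu> i" for f i
      by (simp add: sum_divide_distrib)
    have "\<exists>a r. \<forall>i. \<beta> i = a + r * \<tau> i"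
    proof (rule low_eigenvector_affine[OF right left inj _ _ _ card])
      show "(\<Sum>l\<in>UNIV. K i l / \<mu> i * (\<tau> i - \<tau> l)) = \<omega> * \<tau> i" for i
        unfolding div eig_\<tau> using \<mu>[of i] by simp
      show "(\<Sum>l\<in>UNIV. K i l / \<mu> i * (\<beta> i - \<beta> l)) = (\<omega> - M) * \<beta> i" for i
        unfolding div eigK using \<mu>[of i] by simp
      show "\<omega> - M \<le> \<omega>" using M by simp
    qed
    then obtain a r where ar: "\<And>i. \<beta> i = a + r * \<tau> i" by blast
    have "(\<Sum>i\<in>UNIV. \<mu> i * \<beta> i) = a * (\<Sum>i\<in>UNIV. \<mu> i) + r * (\<Sum>i\<in>UNIV. \<mu> i * \<tau> i)"
      unfolding ar by (simp add: distrib_left sum.distrib sum_distrib_left mult_ac)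
    then have "a = 0" using \<beta>S \<mu>sum \<mu>\<tau> by (simp add: S_def)
    then show ?thesis using ar by auto
  qed
  have nonpos: "b w w \<le> 0" if wS: "w \<in> S" for w
  proof (rule ccontr)
    assume "\<not> b w w \<le> 0"
    then have bw: "b w w > 0" by simp
    define C where "C = {x :: real^'n. (\<Sum>i\<in>UNIV. \<mu> i * x$i) = 0 \<and> nn (($) x) (($) x) = 1}"
    have cont: "continuous_on UNIV (\<lambda>x :: real^'n. b (($) x) (($) x))"
      unfolding b_def L_def by (intro continuous_intros)
    have n_pos: "nn v v > 0" if v: "v \<noteq> (\<lambda>_. 0)" for v
    proof -
      obtain i where "v i \<noteq> 0" using v by (auto simp: fun_eq_iff)
      then have "\<mu> i * v i * v i > 0" using \<mu>[of i] by (metis mult.assoc mult_pos_pos not_real_square_gt_zero)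
      moreover have "\<mu> j * v j * v j \<ge> 0" for j
        using \<mu>[of j] by (metis less_imp_le mult.assoc mult_nonneg_nonneg zero_le_square)
      ultimately show ?thesis unfolding nn_def by (intro sum_pos2[of UNIV i]) auto
    qed
    have "closed C" unfolding C_def nn_def
      by (intro closed_Collect_conj closed_Collect_eq continuous_intros)
    moreover have "bounded C"
      by (rule bounded_subset[OF bounded_weighted_sphere[of \<mu> 1, OF \<mu>]])
        (auto simp: C_def nn_def power2_eq_square mult.assoc)
    ultimately have "compact C" by (simp add: compact_eq_bounded_closed)
    have scale: "b (\<lambda>i. t * v i) (\<lambda>i. t * v i) = t\<^sup>2 * b v v" "nn (\<lambda>i. t * v i) (\<lambda>i. t * v i) = t\<^sup>2 * nn v v" for t v
      using Q_exp[of "\<lambda>_. 0" t v] n_exp[of "\<lambda>_. 0" t v] by (simp_all add: b_def L_def nn_def)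
    have norm1: "(\<chi> i. v i / sqrt (nn v v)) \<in> C" if "v \<in> S" "v \<noteq> (\<lambda>_. 0)" for v
    proof -
      have "(\<Sum>i\<in>UNIV. \<mu> i * (v i / sqrt (nn v v))) = (\<Sum>i\<in>UNIV. \<mu> i * v i) / sqrt (nn v v)"
        by (simp add: sum_divide_distrib)
      then have "(\<Sum>i\<in>UNIV. \<mu> i * (v i / sqrt (nn v v))) = 0" using that(1) by (simp add: S_def)
      moreover have "nn (\<lambda>i. 1 / sqrt (nn v v) * v i) (\<lambda>i. 1 / sqrt (nn v v) * v i) = 1"
        unfolding scale using n_pos[OF that(2)] by (simp add: power_divide)
      moreover have "($) (\<chi> i. v i / sqrt (nn v v)) = (\<lambda>i. 1 / sqrt (nn v v) * v i)" by auto
      ultimately show ?thesis by (simp only: C_def mem_Collect_eq vec_lambda_beta) simp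
    qed
    have w0: "w \<noteq> (\<lambda>_. 0)" using bw by (auto simp: b_def L_def)
    have ne: "C \<noteq> {}" using norm1[OF wS w0] by blast
    obtain x where x: "x \<in> C" "\<And>y. y \<in> C \<Longrightarrow> b (($) y) (($) y) \<le> b (($) x) (($) x)"
      using continuous_attains_sup[OF \<open>compact C\<close> ne continuous_on_subset[OF cont]] by blast
    define M where "M = b (($) x) (($) x)"
    have maxM: "b v v \<le> M * nn v v" if "v \<in> S" for v
    proof (cases "v = (\<lambda>_. 0)")
      case True then show ?thesis by (simp add: b_def nn_def L_def)
    next
      case False
      have "($) (\<chi> i. v i / sqrt (nn v v)) = (\<lambda>i. 1 / sqrt (nn v v) * v i)" by auto
      then have "b (\<lambda>i. 1 / sqrt (nn v v) * v i) (\<lambda>i. 1 / sqrt (nn v v) * v i) \<le> M"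
        using x(2)[OF norm1[OF that False]] by (simp only: M_def)
      then show ?thesis unfolding scale using n_pos[OF False]
        by (simp add: power_divide field_simps)
    qed
    have M0: "M > 0" using maxM[OF wS] bw n_pos[OF w0] by (smt (verit) mult_nonpos_nonneg)
    have xS: "($) x \<in> S" using x(1) by (simp add: C_def S_def)
    have eqM: "b (($) x) (($) x) = M * nn (($) x) (($) x)" using x(1) by (simp add: M_def C_def)
    have "\<exists>r. \<forall>i. x$i = r * \<tau> i"
      by (rule maximiser[OF xS less_imp_le[OF M0] maxM eqM])
    then obtain r where "\<And>i. x$i = r * \<tau> i" by blast
    then have "($) x = (\<lambda>i. r * \<tau> i)" by auto
    then have "b (($) x) (($) x) = r\<^sup>2 * b \<tau> \<tau>" using scale by simp
    also have "b \<tau> \<tau> = 0" by (simp add: b_def L\<tau>)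
    finally show False using M0 by (simp add: M_def)
  qed
  have \<beta>S: "\<beta> \<in> S" using orth by (simp add: S_def)
  have "\<exists>r. \<forall>i. \<beta> i = r * \<tau> i" if "b \<beta> \<beta> = 0"
    by (rule maximiser[OF \<beta>S order_refl]) (use nonpos that in auto)
  then show ?thesis unfolding Qb using nonpos[OF \<beta>S] by blast
qed

section \<open>The potential in the ambient space\<close>

lemma has_vector_derivative_vec:
  fixes f :: "real \<Rightarrow> 'a::euclidean_space^'n"
  assumes "\<And>i. ((\<lambda>t. f t $ i) has_vector_derivative f' $ i) (at x within S)"
  shows "(f has_vector_derivative f') (at x within S)"
  unfolding has_vector_derivative_def
proof (subst has_derivative_componentwise_within, intro ballI)
  fix b :: "'a^'n" assume "b \<in> Basis"
  then obtain i u where b: "b = axis i u" "u \<in> Basis" by (auto simp: Basis_vec_def)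
  have "((\<lambda>t. f t $ i) has_derivative (\<lambda>h. h *\<^sub>R f' $ i)) (at x within S)"
    using assms[of i] by (simp add: has_vector_derivative_def)
  from has_derivative_inner_left[OF this, of u]
  show "((\<lambda>t. f t \<bullet> b) has_derivative (\<lambda>h. (h *\<^sub>R f') \<bullet> b)) (at x within S)"
    by (simp add: b inner_axis)
qed

lemma has_vector_derivative_config:
  fixes f :: "real \<Rightarrow> 'n::finite config"
  assumes "\<And>i k. ((\<lambda>t. f t $ i $ k) has_real_derivative f' $ i $ k) (at x within S)"
  shows "(f has_vector_derivative f') (at x within S)"
  by (intro has_vector_derivative_vec)
    (use assms in \<open>simp add: has_real_derivative_iff_has_vector_derivative\<close>)

lemma bounded_bilinear_mink: "bounded_bilinear mink"
  unfolding bilinear_conv_bounded_bilinear[symmetric] bilinear_def mink_def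
  by (auto intro!: linearI simp: algebra_simps)

lemma mink_sym: "mink p q = mink q p"
  by (simp add: mink_def mult.commute)

lemma mink_add_left: "mink (p + q) r = mink p r + mink q r"
  and mink_add_right: "mink r (p + q) = mink r p + mink r q"
  and mink_diff_left: "mink (p - q) r = mink p r - mink q r"
  and mink_diff_right: "mink r (p - q) = mink r p - mink r q"
  and mink_scale_left: "mink (a *\<^sub>R p) r = a * mink p r"
  and mink_scale_right: "mink r (a *\<^sub>R p) = a * mink r p"
  and mink_zero_left [simp]: "mink 0 p = 0"
  and mink_zero_right [simp]: "mink p 0 = 0"
  by (simp_all add: mink_def algebra_simps)

lemma mink_sum_right: "mink r (\<Sum>i\<in>A. f i) = (\<Sum>i\<in>A. mink r (f i))"
  by (rule bounded_linear.linear[OF bounded_bilinear.bounded_linear_right[OF bounded_bilinear_mink],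
        THEN linear_sum])

lemmas mink_simps = mink_add_left mink_add_right mink_diff_left mink_diff_right
  mink_scale_left mink_scale_right mink_sum_right

lemma hyp2_w: "p \<in> hyp2 \<longleftrightarrow> p$3 \<ge> 1 \<and> (p$3)\<^sup>2 = 1 + (p$1)\<^sup>2 + (p$2)\<^sup>2"
  by (auto simp: hyp2_def mink_def power2_eq_square)

lemma hyp2_w_sqrt: "p \<in> hyp2 \<longleftrightarrow> p$3 = sqrt (1 + (p$1)\<^sup>2 + (p$2)\<^sup>2)"
proof
  assume "p \<in> hyp2"
  then show "p$3 = sqrt (1 + (p$1)\<^sup>2 + (p$2)\<^sup>2)"
    unfolding hyp2_w by (metis add_increasing2 real_sqrt_unique zero_le_one order.trans)
next
  assume *: "p$3 = sqrt (1 + (p$1)\<^sup>2 + (p$2)\<^sup>2)"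
  have "1 + (p$1)\<^sup>2 + (p$2)\<^sup>2 \<ge> 1" by simp
  then show "p \<in> hyp2" unfolding hyp2_w * by simp
qed

text \<open>Lagrange's identity writes the difference of the two squares as a sum of squares, which vanishes
  only at coinciding points.\<close>

lemma minus_mink_gt_1:
  assumes "p \<in> hyp2" "q \<in> hyp2" "p \<noteq> q"
  shows "- mink p q > 1"
proof -
  have p: "(p$3)\<^sup>2 = 1 + (p$1)\<^sup>2 + (p$2)\<^sup>2" and q: "(q$3)\<^sup>2 = 1 + (q$1)\<^sup>2 + (q$2)\<^sup>2"
    and pos: "p$3 \<ge> 1" "q$3 \<ge> 1"
    using assms by (auto simp: hyp2_w)
  let ?a = "p$1 * q$1 + p$2 * q$2"
  have *: "(p$3 * q$3)\<^sup>2 - (1 + ?a)\<^sup>2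
      = (p$1 - q$1)\<^sup>2 + (p$2 - q$2)\<^sup>2 + (p$1 * q$2 - p$2 * q$1)\<^sup>2"
    unfolding power_mult_distrib p q by (simp add: power2_eq_square algebra_simps)
  have "\<not> (p$1 = q$1 \<and> p$2 = q$2)"
  proof
    assume e: "p$1 = q$1 \<and> p$2 = q$2"
    then have "p$3 = q$3" using assms(1,2) by (simp add: hyp2_w_sqrt)
    with e have "p = q" by (simp add: vec_eq_iff forall_3)
    with assms(3) show False ..
  qed
  then have "(p$1 - q$1)\<^sup>2 + (p$2 - q$2)\<^sup>2 > 0"
    by (simp add: sum_power2_gt_zero_iff)
  then have "(1 + ?a)\<^sup>2 < (p$3 * q$3)\<^sup>2"
    using * by (smt (verit) zero_le_power2)
  then have "1 + ?a < p$3 * q$3"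
    by (rule power2_less_imp_less) (use pos in simp)
  then show ?thesis by (simp add: mink_def)
qed

text \<open>The hyperbolic cotangent of a distance as a function of its hyperbolic cosine. As a function of
  \<open>- mink p q\<close> it is smooth also off the hyperboloid.\<close>

definition hyp_coth :: "real \<Rightarrow> real" where
  "hyp_coth z = z / sqrt (z\<^sup>2 - 1)"

text \<open>The negative of the derivative of \<open>hyp_coth\<close>; at the hyperbolic cosine of \<open>d\<close> its value is
  \<open>1 / sinh d ^ 3\<close>.\<close>

definition hyp_grav :: "real \<Rightarrow> real" where
  "hyp_grav z = 1 / sqrt (z\<^sup>2 - 1) ^ 3"

lemma power2_gt_1: "(z::real) > 1 \<Longrightarrow> z\<^sup>2 - 1 > 0"
  by (simp add: one_less_power)

lemma hyp_grav_pos: "z > 1 \<Longrightarrow> hyp_grav z > 0"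
  using power2_gt_1[of z] by (simp add: hyp_grav_def)

lemma DERIV_sqrt_square_minus_1:
  assumes "z > 1"
  shows "((\<lambda>z. sqrt (z\<^sup>2 - 1)) has_real_derivative z / sqrt (z\<^sup>2 - 1)) (at z)"
  using power2_gt_1[OF assms]
  by (auto intro!: derivative_eq_intros simp: field_simps)

lemma DERIV_hyp_coth:
  assumes "z > 1"
  shows "(hyp_coth has_real_derivative - hyp_grav z) (at z)"
proof -
  let ?r = "sqrt (z\<^sup>2 - 1)"
  have r: "?r > 0" "?r * ?r = z\<^sup>2 - 1" using power2_gt_1[OF assms] by auto
  have "(hyp_coth has_real_derivative (1 * ?r - z * (z / ?r)) / (?r * ?r)) (at z)"
    unfolding hyp_coth_def[abs_def]
    by (rule DERIV_divide[OF DERIV_ident DERIV_sqrt_square_minus_1[OF assms]]) (use r in auto)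
  moreover have "(1 * ?r - z * (z / ?r)) / (?r * ?r) = - hyp_grav z"
  proof -
    have "1 * ?r - z * (z / ?r) = (?r * ?r - z\<^sup>2) / ?r" using r(1) by (simp add: field_simps power2_eq_square)
    also have "\<dots> = - 1 / ?r" unfolding r(2) by simp
    finally show ?thesis by (simp add: hyp_grav_def power3_eq_cube)
  qed
  ultimately show ?thesis by simp
qed

lemma DERIV_inverse_cube:
  fixes f :: "real \<Rightarrow> real"
  assumes "(f has_real_derivative d) (at z)" "f z > 0"
  shows "((\<lambda>z. 1 / f z ^ 3) has_real_derivative - (3 * d) / f z ^ 4) (at z)"
  using assms by (auto intro!: derivative_eq_intros simp: field_simps eval_nat_numeral)

lemma DERIV_hyp_grav:
  assumes "z > 1"
  shows "(hyp_grav has_real_derivative - (3 * z / sqrt (z\<^sup>2 - 1) ^ 5)) (at z)"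
proof -
  let ?r = "sqrt (z\<^sup>2 - 1)"
  have r: "?r > 0" using power2_gt_1[OF assms] by auto
  have "((\<lambda>z. 1 / sqrt (z\<^sup>2 - 1) ^ 3) has_real_derivative - (3 * (z / ?r)) / ?r ^ 4) (at z)"
    by (rule DERIV_inverse_cube[OF DERIV_sqrt_square_minus_1[OF assms] r])
  moreover have "3 * (z / ?r) / ?r ^ 4 = 3 * z / ?r ^ 5" by (simp add: eval_nat_numeral)
  ultimately show ?thesis unfolding hyp_grav_def[abs_def] by (metis minus_divide_left)
qed

definition pair_weight :: "('n::finite \<Rightarrow> real) \<Rightarrow> 'n config \<Rightarrow> 'n \<Rightarrow> 'n \<Rightarrow> real" where
  "pair_weight m q i j = (if i = j then 0 else m i * m j * hyp_grav (- mink (q$i) (q$j)))"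

text \<open>The gradient of the potential with respect to the position of one particle, for the Lorentzian
  form and in the ambient space. Its component normal to the hyperboloid depends on how the
  potential was extended.\<close>

definition force :: "('n::finite \<Rightarrow> real) \<Rightarrow> 'n config \<Rightarrow> 'n \<Rightarrow> real^3" where
  "force m q i = (\<Sum>j\<in>UNIV. pair_weight m q i j *\<^sub>R q$j)"

text \<open>Half the gradient of \<open>x\<^sup>2 + y\<^sup>2\<close> for the Lorentzian form.\<close>

definition planar :: "real^3 \<Rightarrow> real^3" where
  "planar p = vector [p$1, p$2, 0]"

definition ambient_potential :: "('n::finite \<Rightarrow> real) \<Rightarrow> 'n config \<Rightarrow> real" where
  "ambient_potential m q = (\<Sum>i\<in>UNIV. \<Sum>j\<in>UNIV.
     if i = j then 0 else m i * m j * hyp_coth (- mink (q$i) (q$j))) / 2"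

text \<open>An open part of the ambient space on which the extended potential is smooth.\<close>

definition separated :: "'n::finite config \<Rightarrow> bool" where
  "separated q \<longleftrightarrow> (\<forall>i j. i \<noteq> j \<longrightarrow> - mink (q$i) (q$j) > 1)"

lemma pair_weight_sym: "pair_weight m q i j = pair_weight m q j i"
  by (simp add: pair_weight_def mink_sym mult_ac)

lemma config_space_iff:
  "q \<in> config_space \<longleftrightarrow> (\<forall>i. q$i \<in> hyp2) \<and> (\<forall>i j. i \<noteq> j \<longrightarrow> q$i \<noteq> q$j)"
proof -
  have "q \<in> collisions \<longleftrightarrow> (\<exists>i j. i < j \<and> q$i = q$j)" by (auto simp: collisions_def)
  also have "\<dots> \<longleftrightarrow> (\<exists>i j. i \<noteq> j \<and> q$i = q$j)" by (metis linorder_neqE less_irrefl)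
  finally show ?thesis by (auto simp: config_space_def)
qed

lemma separated_config_space: "q \<in> config_space \<Longrightarrow> separated q"
  unfolding separated_def config_space_iff using minus_mink_gt_1 by blast

lemma potential_eq_ambient:
  assumes "q \<in> config_space"
  shows "potential m q = ambient_potential m q"
proof -
  define f where "f i j = m i * m j * hyp_coth (- mink (q$i) (q$j))" for i j
  have sym: "f i j = f j i" for i j by (simp add: f_def mink_sym mult_ac)
  have c: "coth (hdist (q$i) (q$j)) = hyp_coth (- mink (q$i) (q$j))" if "i < j" for i j
  proof -
    have z: "- mink (q$i) (q$j) > 1"
      using separated_config_space[OF assms] that by (simp add: separated_def)
    show ?thesis unfolding coth_def hdist_def hyp_coth_def
      using z cosh_arcosh_real sinh_arcosh_real by (metis less_imp_le)
  qed
  have "potential m q = (\<Sum>(i,j)\<in>{(i,j). i < j}. f i j)"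
    unfolding potential_def by (rule sum.cong) (auto simp: f_def c)
  also have "\<dots> = (\<Sum>i\<in>UNIV. \<Sum>j\<in>UNIV. if i < j then f i j else 0)" (is "_ = ?S")
  proof -
    have "(\<Sum>i\<in>UNIV. \<Sum>j\<in>UNIV. if i < j then f i j else 0)
        = (\<Sum>(i,j)\<in>UNIV \<times> UNIV. if i < j then f i j else 0)"
      by (rule sum.cartesian_product)
    also have "\<dots> = (\<Sum>(i,j)\<in>{(i,j). i < j}. f i j)"
      by (rule sum.mono_neutral_cong_right) (auto split: if_splits)
    finally show ?thesis ..
  qed
  finally have 1: "potential m q = ?S" .
  have "?S = (\<Sum>i\<in>UNIV. \<Sum>j\<in>UNIV. if j < i then f j i else 0)" by (rule sum.swap)
  then have "?S + ?S = (\<Sum>i\<in>UNIV. \<Sum>j\<in>UNIV. (if i < j then f i j else 0) + (if j < i then f i j else 0))"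
    by (simp add: sum.distrib sym cong: if_cong)
  also have "\<dots> = (\<Sum>i\<in>UNIV. \<Sum>j\<in>UNIV. if i = j then 0 else f i j)"
    by (intro sum.cong) auto
  finally show ?thesis unfolding 1 ambient_potential_def f_def by simp
qed

lemma has_derivative_mink_config:
  "((\<lambda>q::'n::finite config. mink (q$i) (q$j)) has_derivative
     (\<lambda>\<xi>. mink (q$i) (\<xi>$j) + mink (\<xi>$i) (q$j))) (at q within S)"
  by (intro bounded_bilinear.FDERIV[OF bounded_bilinear_mink]
      bounded_linear_imp_has_derivative bounded_linear_vec_nth)

lemma has_derivative_ambient_potential:
  assumes "separated q"
  shows "(ambient_potential m has_derivative (\<lambda>\<xi>. \<Sum>i\<in>UNIV. mink (\<xi>$i) (force m q i))) (at q within S)"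
proof -
  have trm: "((\<lambda>q. if i = j then 0 else m i * m j * hyp_coth (- mink (q$i) (q$j))) has_derivative
      (\<lambda>\<xi>. pair_weight m q i j * (mink (q$i) (\<xi>$j) + mink (\<xi>$i) (q$j)))) (at q within S)" for i j
  proof (cases "i = j")
    case False
    then have z: "- mink (q$i) (q$j) > 1" using assms by (simp add: separated_def)
    have "((\<lambda>q. hyp_coth (- mink (q$i) (q$j))) has_derivative
      (\<lambda>\<xi>. - (mink (q$i) (\<xi>$j) + mink (\<xi>$i) (q$j)) * - hyp_grav (- mink (q$i) (q$j)))) (at q within S)"
      by (rule DERIV_compose_FDERIV[OF DERIV_hyp_coth[OF z] has_derivative_minus[OF has_derivative_mink_config]])
    from has_derivative_mult_right[OF this, of "m i * m j"]
    have "((\<lambda>q. m i * m j * hyp_coth (- mink (q$i) (q$j))) has_derivative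
      (\<lambda>\<xi>. pair_weight m q i j * (mink (q$i) (\<xi>$j) + mink (\<xi>$i) (q$j)))) (at q within S)"
      by (rule has_derivative_eq_rhs) (use False in \<open>simp add: pair_weight_def fun_eq_iff algebra_simps\<close>)
    then show ?thesis using False by simp
  qed (simp add: pair_weight_def)
  have "(ambient_potential m has_derivative
      (\<lambda>\<xi>. (\<Sum>i\<in>UNIV. \<Sum>j\<in>UNIV. pair_weight m q i j * (mink (q$i) (\<xi>$j) + mink (\<xi>$i) (q$j))) / 2)) (at q within S)"
    unfolding ambient_potential_def[abs_def] divide_inverse
    by (intro has_derivative_mult_left has_derivative_sum trm)
  moreover have "(\<Sum>i\<in>UNIV. \<Sum>j\<in>UNIV. pair_weight m q i j * (mink (q$i) (\<xi>$j) + mink (\<xi>$i) (q$j))) / 2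
      = (\<Sum>i\<in>UNIV. mink (\<xi>$i) (force m q i))" for \<xi>
  proof -
    have "(\<Sum>i\<in>UNIV. \<Sum>j\<in>UNIV. pair_weight m q i j * mink (q$i) (\<xi>$j))
        = (\<Sum>i\<in>UNIV. \<Sum>j\<in>UNIV. pair_weight m q j i * mink (q$j) (\<xi>$i))"
      by (rule sum.swap)
    also have "\<dots> = (\<Sum>i\<in>UNIV. \<Sum>j\<in>UNIV. pair_weight m q i j * mink (\<xi>$i) (q$j))"
      by (simp add: pair_weight_sym mink_sym)
    finally show ?thesis
      by (simp add: distrib_left sum.distrib force_def mink_simps)
  qed
  ultimately show ?thesis by simp
qed

text \<open>The constraints are the size of the configuration and membership of each particle in the
  hyperboloid. On configurations the last sum vanishes.\<close>

definition lagrangian ::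
  "('n::finite \<Rightarrow> real) \<Rightarrow> real \<Rightarrow> ('n \<Rightarrow> real) \<Rightarrow> 'n config \<Rightarrow> real" where
  "lagrangian m \<mu> \<sigma> q = ambient_potential m q - \<mu> * inertia_moment m q
     - (\<Sum>i\<in>UNIV. \<sigma> i * (mink (q$i) (q$i) + 1))"

definition lagrange_residual ::
  "('n::finite \<Rightarrow> real) \<Rightarrow> real \<Rightarrow> ('n \<Rightarrow> real) \<Rightarrow> 'n config \<Rightarrow> 'n \<Rightarrow> real^3" where
  "lagrange_residual m \<mu> \<sigma> q i =
     force m q i - (2 * \<mu> * m i) *\<^sub>R planar (q$i) - (2 * \<sigma> i) *\<^sub>R q$i"

lemma lagrangian_on_config_space:
  "q \<in> config_space \<Longrightarrow> lagrangian m \<mu> \<sigma> q = potential m q - \<mu> * inertia_moment m q"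
  by (simp add: lagrangian_def potential_eq_ambient config_space_iff hyp2_def)

lemma planar_nth [simp]: "planar p $ 1 = p$1" "planar p $ 2 = p$2" "planar p $ 3 = 0"
  by (simp_all add: planar_def)

lemma mink_planar: "mink p (planar q) = p$1 * q$1 + p$2 * q$2"
  by (simp add: mink_def)

lemma inertia_moment_planar: "inertia_moment m q = (\<Sum>i\<in>UNIV. m i * mink (q$i) (planar (q$i)))"
  by (simp add: inertia_moment_def mink_planar power2_eq_square)

lemma bounded_linear_planar: "bounded_linear planar"
proof -
  have "linear planar" by (rule linearI) (simp_all add: vec_eq_iff forall_3)
  then show ?thesis by (rule linear_conv_bounded_linear[THEN iffD1])
qed

lemma has_derivative_inertia_moment:
  "(inertia_moment m has_derivative (\<lambda>\<xi>. \<Sum>i\<in>UNIV. mink (\<xi>$i) ((2 * m i) *\<^sub>R planar (q$i)))) (at q within S)"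
proof -
  have *: "((\<lambda>q. mink (q$i) (planar (q$i))) has_derivative
      (\<lambda>\<xi>. mink (q$i) (planar (\<xi>$i)) + mink (\<xi>$i) (planar (q$i)))) (at q within S)" for i
    by (intro bounded_bilinear.FDERIV[OF bounded_bilinear_mink]
        bounded_linear.has_derivative[OF bounded_linear_planar]
        bounded_linear_imp_has_derivative bounded_linear_vec_nth)
  have "(inertia_moment m has_derivative
      (\<lambda>\<xi>. \<Sum>i\<in>UNIV. m i * (mink (q$i) (planar (\<xi>$i)) + mink (\<xi>$i) (planar (q$i))))) (at q within S)"
    unfolding inertia_moment_planar[abs_def]
    by (intro has_derivative_sum has_derivative_mult_right *)
  moreover have "mink p (planar r) = mink r (planar p)" for p r by (simp add: mink_planar)
  ultimately show ?thesis by (simp add: mink_simps mult_ac)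
qed

lemma has_derivative_lagrangian:
  assumes "separated q"
  shows "(lagrangian m \<mu> \<sigma> has_derivative
     (\<lambda>\<xi>. \<Sum>i\<in>UNIV. mink (\<xi>$i) (lagrange_residual m \<mu> \<sigma> q i))) (at q within S)"
proof -
  have "(lagrangian m \<mu> \<sigma> has_derivative
     (\<lambda>\<xi>. (\<Sum>i\<in>UNIV. mink (\<xi>$i) (force m q i))
        - \<mu> * (\<Sum>i\<in>UNIV. mink (\<xi>$i) ((2 * m i) *\<^sub>R planar (q$i)))
        - (\<Sum>i\<in>UNIV. \<sigma> i * (mink (q$i) (\<xi>$i) + mink (\<xi>$i) (q$i) + 0)))) (at q within S)"
    unfolding lagrangian_def[abs_def]
    by (intro has_derivative_diff has_derivative_sum has_derivative_mult_right has_derivative_add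
        has_derivative_const has_derivative_mink_config has_derivative_inertia_moment
        has_derivative_ambient_potential[OF assms])
  moreover have "(\<Sum>i\<in>UNIV. mink (\<xi>$i) (force m q i))
        - \<mu> * (\<Sum>i\<in>UNIV. mink (\<xi>$i) ((2 * m i) *\<^sub>R planar (q$i)))
        - (\<Sum>i\<in>UNIV. \<sigma> i * (mink (q$i) (\<xi>$i) + mink (\<xi>$i) (q$i) + 0))
      = (\<Sum>i\<in>UNIV. mink (\<xi>$i) (lagrange_residual m \<mu> \<sigma> q i))" for \<xi>
    unfolding sum_distrib_left sum_subtractf[symmetric] lagrange_residual_def
    by (rule sum.cong) (auto simp: mink_simps mink_sym[of _ "\<xi>$_"])
  ultimately show ?thesis by simp
qed

section \<open>The equations of central configurations\<close>

text \<open>Stated with unspecified normal components, the equations are visibly invariant under rotations and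
  do not depend on the extension of the potential to the ambient space.\<close>

definition cc_equations :: "('n::finite \<Rightarrow> real) \<Rightarrow> real \<Rightarrow> 'n config \<Rightarrow> bool" where
  "cc_equations m \<mu> q \<longleftrightarrow> (\<forall>i. \<exists>s. force m q i = (2 * \<mu> * m i) *\<^sub>R planar (q$i) + s *\<^sub>R q$i)"

lemma cc_equations_multiplier:
  assumes "cc_equations m \<mu> q"
  obtains \<sigma> where "\<And>i. lagrange_residual m \<mu> \<sigma> q i = 0"
proof -
  obtain s where s: "\<And>i. force m q i = (2 * \<mu> * m i) *\<^sub>R planar (q$i) + s i *\<^sub>R q$i"
    using assms unfolding cc_equations_def by metis
  have "lagrange_residual m \<mu> (\<lambda>i. s i / 2) q i = 0" for i
    by (simp add: lagrange_residual_def s)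
  then show ?thesis by (rule that)
qed

lemma critical_if_cc_equations:
  assumes q: "q \<in> config_space" and cc: "cc_equations m \<mu> q"
  shows "critical_point_on config_space (\<lambda>p. potential m p - \<mu> * inertia_moment m p) q"
proof -
  obtain \<sigma> where \<sigma>: "\<And>i. lagrange_residual m \<mu> \<sigma> q i = 0"
    using cc_equations_multiplier[OF cc] by blast
  have "(lagrangian m \<mu> \<sigma> has_derivative (\<lambda>_. 0)) (at q within config_space)"
    using has_derivative_lagrangian[OF separated_config_space[OF q], of m \<mu> \<sigma>] by (simp add: \<sigma>)
  then have "((\<lambda>p. potential m p - \<mu> * inertia_moment m p) has_derivative (\<lambda>_. 0)) (at q within config_space)"
    by (rule has_derivative_transform[OF q, rotated]) (simp add: lagrangian_on_config_space)
  then show ?thesis using q by (simp add: critical_point_on_def)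
qed

text \<open>A curve in \<open>M\<close> only sees the derivative within \<open>M\<close>, which is zero, but the chain rule with the
  ambient derivative computes the same number.\<close>

lemma zero_derivative_along_curve:
  assumes F0: "(F has_derivative (\<lambda>_. 0)) (at (\<gamma> 0) within M)"
    and FD: "(F has_derivative D) (at (\<gamma> 0))"
    and \<gamma>: "(\<gamma> has_vector_derivative \<xi>) (at (0::real))"
    and M: "\<forall>\<^sub>F t in nhds 0. \<gamma> t \<in> M"
  shows "D \<xi> = (0::real)"
proof -
  define T where "T = {t. \<gamma> t \<in> M}"
  obtain U where U: "open U" "0 \<in> U" "\<And>t. t \<in> U \<Longrightarrow> \<gamma> t \<in> M"
    using M unfolding eventually_nhds by blast
  then have "0 \<in> interior T" unfolding T_def interior_def by blast
  then have at: "at 0 within T = at 0" by (rule at_within_interior)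
  have \<gamma>': "(\<gamma> has_derivative (\<lambda>h. h *\<^sub>R \<xi>)) (at 0)" using \<gamma> by (simp add: has_vector_derivative_def)
  have "((\<lambda>t. F (\<gamma> t)) has_derivative (\<lambda>_. 0)) (at 0 within T)"
    by (rule has_derivative_in_compose[OF has_derivative_at_withinI[OF \<gamma>'] has_derivative_subset[OF F0]])
      (auto simp: T_def)
  then have 1: "((\<lambda>t. F (\<gamma> t)) has_derivative (\<lambda>_. 0)) (at 0)" unfolding at .
  have 2: "((\<lambda>t. F (\<gamma> t)) has_derivative (\<lambda>h. D (h *\<^sub>R \<xi>))) (at 0)"
    by (rule has_derivative_compose[OF \<gamma>' FD])
  have "(\<lambda>h. D (h *\<^sub>R \<xi>)) = (\<lambda>_. 0)" by (rule has_derivative_unique[OF 2 1])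
  then show ?thesis by (metis scaleR_one)
qed

text \<open>The hyperboloid as a graph over the plane.\<close>

definition lift :: "real \<Rightarrow> real \<Rightarrow> real^3" where
  "lift x y = vector [x, y, sqrt (1 + x\<^sup>2 + y\<^sup>2)]"

lemma lift_nth [simp]: "lift x y $ 1 = x" "lift x y $ 2 = y" "lift x y $ 3 = sqrt (1 + x\<^sup>2 + y\<^sup>2)"
  by (simp_all add: lift_def)

lemma lift_hyp2: "lift x y \<in> hyp2"
  by (simp add: hyp2_w_sqrt)

lemma lift_eq: "p \<in> hyp2 \<Longrightarrow> lift (p$1) (p$2) = p"
  by (simp add: hyp2_w_sqrt vec_eq_iff forall_3)

lemma has_vector_derivative_lift:
  assumes X: "(X has_real_derivative X') (at t)" and Y: "(Y has_real_derivative Y') (at t)"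
  shows "((\<lambda>t. lift (X t) (Y t)) has_vector_derivative
     vector [X', Y', (X t * X' + Y t * Y') / (lift (X t) (Y t) $ 3)]) (at t)"
proof (rule has_vector_derivative_vec)
  fix k :: 3
  have pos: "1 + (X t)\<^sup>2 + (Y t)\<^sup>2 > 0" by (smt (verit) zero_le_power2)
  have "((\<lambda>t. 1 + (X t)\<^sup>2 + (Y t)\<^sup>2) has_real_derivative 2 * X t * X' + 2 * Y t * Y') (at t)"
    using X Y by (auto intro!: derivative_eq_intros)
  from DERIV_chain2[OF DERIV_real_sqrt[OF pos] this]
  have "((\<lambda>t. sqrt (1 + (X t)\<^sup>2 + (Y t)\<^sup>2)) has_real_derivative
      (X t * X' + Y t * Y') / sqrt (1 + (X t)\<^sup>2 + (Y t)\<^sup>2)) (at t)"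
    by (rule DERIV_cong) (use pos in \<open>simp add: field_simps\<close>)
  moreover have "k = 1 \<or> k = 2 \<or> k = 3" by (rule exhaust_3)
  ultimately show "((\<lambda>t. lift (X t) (Y t) $ k) has_vector_derivative
     vector [X', Y', (X t * X' + Y t * Y') / (lift (X t) (Y t) $ 3)] $ k) (at t)"
    using X Y by (auto simp: has_real_derivative_iff_has_vector_derivative)
qed

lemma open_noncollision: "open {q :: 'n::finite config. \<forall>i j. i \<noteq> j \<longrightarrow> q$i \<noteq> q$j}"
proof -
  have "{q :: 'n config. \<forall>i j. i \<noteq> j \<longrightarrow> q$i \<noteq> q$j}
      = (\<Inter>i. \<Inter>j\<in>{j. i \<noteq> j}. {q. q$i \<noteq> q$j})" by auto
  moreover have "open {q :: 'n config. q$i \<noteq> q$j}" for i j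
    by (intro open_Collect_neq continuous_intros)
  ultimately show ?thesis by (simp add: open_INT)
qed

lemma eventually_config_space:
  assumes "(\<gamma> has_vector_derivative \<xi>) (at (0::real))" "\<gamma> 0 \<in> config_space" "\<And>t i. \<gamma> t $ i \<in> hyp2"
  shows "\<forall>\<^sub>F t in nhds 0. \<gamma> t \<in> config_space"
proof -
  have "isCont \<gamma> 0" using assms(1) has_vector_derivative_continuous by blast
  then have "(\<gamma> \<longlongrightarrow> \<gamma> 0) (nhds 0)" by (simp add: tendsto_at_iff_tendsto_nhds isCont_def)
  moreover have "\<gamma> 0 \<in> {q. \<forall>i j. i \<noteq> j \<longrightarrow> q$i \<noteq> q$j}" using assms(2) by (simp add: config_space_iff)
  ultimately have "\<forall>\<^sub>F t in nhds 0. \<gamma> t \<in> {q. \<forall>i j. i \<noteq> j \<longrightarrow> q$i \<noteq> q$j}"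
    by (rule topological_tendstoD[OF _ open_noncollision])
  then show ?thesis using assms(3) by (simp add: config_space_iff)
qed

text \<open>The multipliers \<open>\<sigma>\<close> are chosen such that the third component of the residual vanishes. Moving one
  particle while keeping it on the hyperboloid changes its first two coordinates freely, so the
  other two components vanish as well.\<close>

lemma cc_equations_if_critical:
  fixes q :: "'n::{finite,linorder} config"
  assumes "critical_point_on config_space (\<lambda>p. potential m p - \<mu> * inertia_moment m p) q"
  shows "cc_equations m \<mu> q"
proof -
  have q: "q \<in> config_space" and qh: "\<And>i. q$i \<in> hyp2"
    and D0: "((\<lambda>p. potential m p - \<mu> * inertia_moment m p) has_derivative (\<lambda>_. 0)) (at q within config_space)"
    using assms by (auto simp: critical_point_on_def config_space_iff)
  define \<sigma> where "\<sigma> i = force m q i $ 3 / (2 * q$i$3)" for i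
  let ?G = "lagrange_residual m \<mu> \<sigma> q"
  have w: "q$i$3 \<ge> 1" for i using qh[of i] by (simp add: hyp2_w)
  have G3: "?G i $ 3 = 0" for i using w[of i] by (simp add: lagrange_residual_def \<sigma>_def)
  have L0: "(lagrangian m \<mu> \<sigma> has_derivative (\<lambda>_. 0)) (at q within config_space)"
    by (rule has_derivative_transform[OF q lagrangian_on_config_space D0])
  have G12: "a * ?G i $ 1 + b * ?G i $ 2 = 0" for i a b
  proof -
    define \<gamma> where "\<gamma> t = (\<chi> j. if j = i then lift (q$i$1 + t * a) (q$i$2 + t * b) else q$j)" for t
    define \<eta> :: "real^3" where "\<eta> = vector [a, b, ((q$i$1 + 0 * a) * a + (q$i$2 + 0 * b) * b)
        / (lift (q$i$1 + 0 * a) (q$i$2 + 0 * b) $ 3)]"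
    define \<xi> :: "'n config" where "\<xi> = (\<chi> j. if j = i then \<eta> else 0)"
    have \<gamma>0: "\<gamma> 0 = q" by (simp add: \<gamma>_def vec_eq_iff[of _ q] lift_eq[OF qh])
    have lin: "((\<lambda>t. c + t * a) has_real_derivative a) (at t)" for c a t :: real
      by (auto intro!: derivative_eq_intros)
    have "((\<lambda>t. lift (q$i$1 + t * a) (q$i$2 + t * b)) has_vector_derivative \<eta>) (at 0)"
      unfolding \<eta>_def by (rule has_vector_derivative_lift[OF lin lin])
    then have "((\<lambda>t. \<gamma> t $ j) has_vector_derivative \<xi> $ j) (at 0)" for j
      by (cases "j = i") (simp_all add: \<gamma>_def \<xi>_def)
    then have \<gamma>': "(\<gamma> has_vector_derivative \<xi>) (at 0)" by (rule has_vector_derivative_vec)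
    have "\<forall>\<^sub>F t in nhds 0. \<gamma> t \<in> config_space"
      by (rule eventually_config_space[OF \<gamma>']) (use q qh in \<open>auto simp: \<gamma>0\<close>, simp add: \<gamma>_def lift_hyp2 qh)
    from zero_derivative_along_curve[OF _ _ \<gamma>' this, unfolded \<gamma>0, OF L0 has_derivative_lagrangian[OF separated_config_space[OF q]]]
    have "(\<Sum>j\<in>UNIV. mink (\<xi>$j) (?G j)) = 0" .
    moreover have "(\<Sum>j\<in>UNIV. mink (\<xi>$j) (?G j)) = (\<Sum>j\<in>UNIV. if j = i then mink \<eta> (?G i) else 0)"
      by (rule sum.cong) (auto simp: \<xi>_def)
    ultimately have "mink \<eta> (?G i) = 0" by simp
    then show ?thesis using G3[of i] by (simp add: mink_def \<eta>_def)
  qed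
  have "?G i = 0" for i
    using G12[of 1 i 0] G12[of 0 i 1] G3[of i] by (simp add: vec_eq_iff forall_3)
  then have "force m q i = (2 * \<mu> * m i) *\<^sub>R planar (q$i) + (2 * \<sigma> i) *\<^sub>R q$i" for i
    unfolding lagrange_residual_def diff_diff_eq right_minus_eq by blast
  then show ?thesis unfolding cc_equations_def by blast
qed

lemma ordinary_cc_iff:
  "ordinary_cc m q \<longleftrightarrow> q \<in> config_space \<and> (\<exists>\<mu>. cc_equations m \<mu> q)"
  unfolding ordinary_cc_def
  using cc_equations_if_critical critical_if_cc_equations critical_point_on_def by blast

lemma pair_weight_pos:
  "q \<in> config_space \<Longrightarrow> (\<And>i. m i > 0) \<Longrightarrow> i \<noteq> j \<Longrightarrow> pair_weight m q i j > 0"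
  using separated_config_space[of q] hyp_grav_pos by (simp add: pair_weight_def separated_def)

text \<open>The test field \<open>v i\<close> is tangent to the hyperboloid and points away from the apex \<open>(0, 0, 1)\<close>. Along it
  the inertia moment does not decrease, while \<open>- mink (q$i) (q$j)\<close> grows at the rate
  \<open>(q$i$3 + q$j$3) * (- mink (q$i) (q$j) - 1)\<close>. So all distances grow and the potential decreases.\<close>

lemma cc_multiplier_negative:
  fixes q :: "'n::{finite,linorder} config"
  assumes q: "q \<in> config_space" and cc: "cc_equations m \<mu> q"
    and m: "\<And>i. m i > 0" and n: "CARD('n) \<ge> 2"
  shows "\<mu> < 0"
proof (rule ccontr)
  assume "\<not> \<mu> < 0"
  then have \<mu>: "\<mu> \<ge> 0" by simp
  obtain s where s: "\<And>i. force m q i = (2 * \<mu> * m i) *\<^sub>R planar (q$i) + s i *\<^sub>R q$i"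
    using cc unfolding cc_equations_def by metis
  have qh: "q$i \<in> hyp2" for i using q by (simp add: config_space_iff)
  have mqq: "mink (q$i) (q$i) = -1" for i using qh[of i] by (simp add: hyp2_def)
  define v where "v i = q$i$3 *\<^sub>R q$i - vector [0,0,1]" for i
  let ?k = "pair_weight m q"
  have e3: "mink (vector [0,0,1]) p = - p$3" for p by (simp add: mink_def)
  have vq: "mink (v i) (q$j) = q$i$3 * mink (q$i) (q$j) + q$j$3" for i j
    by (simp add: v_def mink_simps e3)
  have "mink (v i) (force m q i) \<ge> 0" for i
  proof -
    have "mink (v i) (planar (q$i)) = q$i$3 * ((q$i$1)\<^sup>2 + (q$i$2)\<^sup>2)"
      by (simp add: v_def mink_planar power2_eq_square algebra_simps)
    moreover have "q$i$3 \<ge> 0" using qh[of i] by (simp add: hyp2_w)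
    ultimately have "mink (v i) (planar (q$i)) \<ge> 0" by simp
    moreover have "mink (v i) (q$i) = 0" by (simp add: vq mqq)
    ultimately show ?thesis unfolding s using \<mu> m[of i] by (simp add: mink_simps)
  qed
  then have "(\<Sum>i\<in>UNIV. mink (v i) (force m q i)) \<ge> 0" by (simp add: sum_nonneg)
  also have "(\<Sum>i\<in>UNIV. mink (v i) (force m q i)) = (\<Sum>i\<in>UNIV. \<Sum>j\<in>UNIV. ?k i j * mink (v i) (q$j))"
    by (simp add: force_def mink_simps)
  finally have ge: "(\<Sum>i\<in>UNIV. \<Sum>j\<in>UNIV. ?k i j * mink (v i) (q$j)) \<ge> 0" .
  have "(\<Sum>i\<in>UNIV. \<Sum>j\<in>UNIV. ?k i j * mink (v i) (q$j)) = (\<Sum>i\<in>UNIV. \<Sum>j\<in>UNIV. ?k j i * mink (v j) (q$i))"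
    by (rule sum.swap)
  then have "2 * (\<Sum>i\<in>UNIV. \<Sum>j\<in>UNIV. ?k i j * mink (v i) (q$j))
      = (\<Sum>i\<in>UNIV. \<Sum>j\<in>UNIV. ?k i j * (mink (v i) (q$j) + mink (v j) (q$i)))"
    by (simp add: distrib_left sum.distrib pair_weight_sym)
  also have "\<dots> = (\<Sum>i\<in>UNIV. \<Sum>j\<in>UNIV. ?k i j * ((q$i$3 + q$j$3) * (1 + mink (q$i) (q$j))))"
    by (intro sum.cong refl) (simp add: vq mink_sym algebra_simps)
  also have "\<dots> < 0"
  proof -
    have neg: "?k i j * ((q$i$3 + q$j$3) * (1 + mink (q$i) (q$j))) < 0" if "i \<noteq> j" for i j
    proof -
      have "?k i j > 0" using pair_weight_pos[OF q m that] .
      moreover have "q$i$3 + q$j$3 > 0" using qh[of i] qh[of j] by (simp add: hyp2_w)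
      moreover have "1 + mink (q$i) (q$j) < 0"
        using separated_config_space[OF q] that by (force simp: separated_def)
      ultimately show ?thesis by (simp add: mult_pos_neg)
    qed
    have np: "?k i j * ((q$i$3 + q$j$3) * (1 + mink (q$i) (q$j))) \<le> 0" for i j
      using neg[of i j] by (cases "i = j") (auto simp: pair_weight_def less_imp_le)
    obtain a b :: 'n where ab: "a \<noteq> b" by (rule exists_distinct[OF n])
    have row: "(\<Sum>j\<in>UNIV. ?k i j * ((q$i$3 + q$j$3) * (1 + mink (q$i) (q$j)))) \<le> 0" for i
      by (simp add: np sum_nonpos)
    have rowa: "(\<Sum>j\<in>UNIV. ?k a j * ((q$a$3 + q$j$3) * (1 + mink (q$a) (q$j)))) < (\<Sum>j\<in>(UNIV::'n set). 0)"
      by (rule sum_strict_mono_ex1) (use np neg[OF ab] in auto)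
    have "(\<Sum>i\<in>UNIV. \<Sum>j\<in>UNIV. ?k i j * ((q$i$3 + q$j$3) * (1 + mink (q$i) (q$j)))) < (\<Sum>i\<in>(UNIV::'n set). 0)"
      by (rule sum_strict_mono_ex1) (use row rowa in auto)
    then show ?thesis by simp
  qed
  finally show False using ge by simp
qed

text \<open>Three points of a geodesic are linearly dependent: by additivity of the distances their Gram
  determinant for the Lorentzian form vanishes. So a geodesic lies in the plane through two of its
  points and the origin, and \<open>\<nu>\<close> is their cross product for the Lorentzian form.\<close>

lemma geodesic_normal:
  assumes "hgeodesic L"
  obtains \<nu> where "\<nu> \<noteq> 0" "\<And>p. p \<in> L \<Longrightarrow> mink \<nu> p = 0"
proof -
  obtain g :: "real \<Rightarrow> real^3" where g: "\<And>t. g t \<in> hyp2" "\<And>s t. hdist (g s) (g t) = \<bar>s - t\<bar>" "L = range g"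
    using assms unfolding hgeodesic_def by blast
  have m: "mink (g s) (g t) = - cosh (s - t)" for s t
  proof -
    have "cosh \<bar>s - t\<bar> = - mink (g s) (g t)"
      using cosh_hdist[OF g(1) g(1), of s t] g(2)[of s t] by simp
    moreover have "cosh \<bar>s - t\<bar> = cosh (s - t)" by (cases "s \<ge> t") (auto simp: cosh_minus[of "s - t", symmetric] simp del: cosh_minus)
    ultimately show ?thesis by simp
  qed
  define p q where "p = g 0" and "q = g 1"
  define \<nu> :: "real^3" where "\<nu> = vector [p$2 * q$3 - p$3 * q$2, p$3 * q$1 - p$1 * q$3, - (p$1 * q$2 - p$2 * q$1)]"
  have gram: "(mink \<nu> r)\<^sup>2 = - (mink p p * mink q q * mink r r + 2 * mink p q * mink q r * mink p r
      - mink p p * (mink q r)\<^sup>2 - mink q q * (mink p r)\<^sup>2 - mink r r * (mink p q)\<^sup>2)" for r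
    by (simp add: mink_def \<nu>_def power2_eq_square algebra_simps)
  have "mink \<nu> (g t) = 0" for t
  proof -
    have "(mink \<nu> (g t))\<^sup>2 = 1 + 2 * cosh 1 * cosh (1 - t) * cosh t - (cosh (1 - t))\<^sup>2 - (cosh t)\<^sup>2 - (cosh 1)\<^sup>2"
      unfolding gram p_def q_def m by simp
    also have "\<dots> = 0"
    proof -
      have s: "(sinh (x::real))\<^sup>2 = (cosh x)\<^sup>2 - 1" for x by (simp add: cosh_square_eq)
      have "cosh 1 * cosh t - cosh (1 - t) = sinh 1 * sinh t" by (simp add: cosh_diff)
      then have "(cosh 1 * cosh t - cosh (1 - t))\<^sup>2 = ((cosh 1)\<^sup>2 - 1) * ((cosh t)\<^sup>2 - 1)"
        by (simp add: power_mult_distrib s)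
      then show ?thesis by (simp add: power2_eq_square algebra_simps)
    qed
    finally show ?thesis by simp
  qed
  moreover have "\<nu> \<noteq> 0"
  proof
    assume 0: "\<nu> = 0"
    have "mink \<nu> \<nu> = (mink p q)\<^sup>2 - mink p p * mink q q"
      by (simp add: mink_def \<nu>_def power2_eq_square algebra_simps)
    then have "(cosh (1::real))\<^sup>2 = 1" unfolding p_def q_def m using 0 by simp
    then have "sinh (1::real) = 0" by (simp add: cosh_square_eq)
    then show False by simp
  qed
  ultimately show ?thesis using that g(3) by blast
qed

section \<open>Rotations, and geodesics through the apex\<close>

definition rot :: "real \<Rightarrow> real^3 \<Rightarrow> real^3" where
  "rot \<theta> p = vector [cos \<theta> * p$1 - sin \<theta> * p$2, sin \<theta> * p$1 + cos \<theta> * p$2, p$3]"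

lemma rot_nth [simp]: "rot \<theta> p $ 1 = cos \<theta> * p$1 - sin \<theta> * p$2"
  "rot \<theta> p $ 2 = sin \<theta> * p$1 + cos \<theta> * p$2" "rot \<theta> p $ 3 = p$3"
  by (simp_all add: rot_def)

lemma linear_rot: "linear (rot \<theta>)"
  by (rule linearI) (simp_all add: vec_eq_iff forall_3 algebra_simps)

lemma planar_rot: "planar (rot \<theta> p) = rot \<theta> (planar p)"
  by (simp add: vec_eq_iff forall_3)

lemma rotate_config_nth: "rotate_config \<theta> q $ i = rot \<theta> (q$i)"
  by (simp add: rotate_config_def rot_def)

lemma rotate_hyp2: "(\<forall>i. rotate_config \<theta> q $ i \<in> hyp2) \<longleftrightarrow> (\<forall>i. q$i \<in> hyp2)"
  by (simp add: hyp2_def mink_rotate) (simp add: rotate_config_nth)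

lemma rotate_inverse: "rotate_config (- \<theta>) (rotate_config \<theta> q) = q"
  by (simp add: rotate_config_add rotate_config_0)

lemma rotate_config_space: "rotate_config \<theta> q \<in> config_space \<longleftrightarrow> q \<in> config_space"
proof -
  have *: "rotate_config \<theta> q \<in> config_space" if q: "q \<in> config_space" for q :: "'a config" and \<theta>
  proof -
    have h: "\<forall>i. rotate_config \<theta> q $ i \<in> hyp2" using q by (simp add: rotate_hyp2 config_space_iff)
    have "rotate_config \<theta> q $ i \<noteq> rotate_config \<theta> q $ j" if "i \<noteq> j" for i j
    proof
      assume "rotate_config \<theta> q $ i = rotate_config \<theta> q $ j"
      then have "mink (rotate_config \<theta> q $ i) (rotate_config \<theta> q $ j) = -1" using h by (simp add: hyp2_def)
      moreover have "- mink (q$i) (q$j) > 1"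
        using separated_config_space[OF q] that unfolding separated_def by blast
      ultimately show False by (simp add: mink_rotate)
    qed
    then show ?thesis using h by (simp add: config_space_iff)
  qed
  show ?thesis using *[of q \<theta>] *[of "rotate_config \<theta> q" "- \<theta>"] by (auto simp: rotate_inverse)
qed

lemma rotate_inertia_moment: "inertia_moment m (rotate_config \<theta> q) = inertia_moment m q"
proof -
  have "(cos \<theta> * x - sin \<theta> * y)\<^sup>2 + (sin \<theta> * x + cos \<theta> * y)\<^sup>2 = x\<^sup>2 + y\<^sup>2" for x y :: real
  proof -
    have "(cos \<theta> * x - sin \<theta> * y)\<^sup>2 + (sin \<theta> * x + cos \<theta> * y)\<^sup>2 = ((sin \<theta>)\<^sup>2 + (cos \<theta>)\<^sup>2) * (x\<^sup>2 + y\<^sup>2)"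
      by (simp add: power2_eq_square algebra_simps
          del: sin_cos_squared_add sin_cos_squared_add2 sin_cos_squared_add3)
    then show ?thesis by simp
  qed
  then show ?thesis by (simp add: inertia_moment_def rotate_config_nth)
qed

lemma rotate_level_set: "rotate_config \<theta> q \<in> level_set m c \<longleftrightarrow> q \<in> level_set m c"
  by (simp add: level_set_def rotate_config_space rotate_inertia_moment)

lemma force_rotate: "force m (rotate_config \<theta> q) i = rot \<theta> (force m q i)"
proof -
  have "pair_weight m (rotate_config \<theta> q) i j = pair_weight m q i j" for j
    by (simp add: pair_weight_def mink_rotate)
  then show ?thesis
    by (simp add: force_def rotate_config_nth linear_sum[OF linear_rot] linear_cmul[OF linear_rot])
qed

lemma cc_equations_rotate:
  assumes "cc_equations m \<mu> q" shows "cc_equations m \<mu> (rotate_config \<theta> q)"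
  unfolding cc_equations_def
proof
  fix i
  obtain s where "force m q i = (2 * \<mu> * m i) *\<^sub>R planar (q$i) + s *\<^sub>R q$i"
    using assms by (auto simp: cc_equations_def)
  then have "force m (rotate_config \<theta> q) i
      = (2 * \<mu> * m i) *\<^sub>R planar (rotate_config \<theta> q $ i) + s *\<^sub>R rotate_config \<theta> q $ i"
    by (simp add: force_rotate rotate_config_nth planar_rot linear_add[OF linear_rot] linear_cmul[OF linear_rot])
  then show "\<exists>s. force m (rotate_config \<theta> q) i
      = (2 * \<mu> * m i) *\<^sub>R planar (rotate_config \<theta> q $ i) + s *\<^sub>R rotate_config \<theta> q $ i" ..
qed

text \<open>Pairing the force equation with the normal \<open>\<nu>\<close> of the geodesic kills the force and the position, and
  leaves the multiplier times the product of \<open>\<nu>$3\<close> and the third coordinate of a particle. As the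
  multiplier is not zero, \<open>\<nu>\<close> is horizontal and can be rotated to the \<open>y\<close>-axis.\<close>

lemma geodesic_cc_through_apex:
  fixes q :: "'n::{finite,linorder} config"
  assumes q: "q \<in> config_space" and geo: "geodesic_config q" and cc: "cc_equations m \<mu> q"
    and m: "\<And>i. m i > 0" and n: "CARD('n) \<ge> 2"
  obtains \<theta> where "\<And>i. rotate_config \<theta> q $ i \<in> hyp1"
proof -
  obtain \<nu> where \<nu>: "\<nu> \<noteq> 0" "\<And>i. mink \<nu> (q$i) = 0"
    using geo geodesic_normal unfolding geodesic_config_def by metis
  have qh: "q$i \<in> hyp2" for i using q by (simp add: config_space_iff)
  have "\<mu> < 0" by (rule cc_multiplier_negative[OF q cc m n])
  obtain i0 :: 'n where True by blast
  obtain s where "force m q i0 = (2 * \<mu> * m i0) *\<^sub>R planar (q$i0) + s *\<^sub>R q$i0"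
    using cc by (auto simp: cc_equations_def)
  moreover have "mink \<nu> (force m q i0) = 0" by (simp add: force_def mink_simps \<nu>(2))
  ultimately have "2 * \<mu> * m i0 * mink \<nu> (planar (q$i0)) = 0" by (simp add: mink_simps \<nu>(2))
  then have "\<nu>$1 * q$i0$1 + \<nu>$2 * q$i0$2 = 0" using \<open>\<mu> < 0\<close> m[of i0] by (simp add: mink_planar)
  then have "\<nu>$3 * q$i0$3 = 0" using \<nu>(2)[of i0] by (simp add: mink_def)
  then have \<nu>3: "\<nu>$3 = 0" using qh[of i0] by (auto simp: hyp2_w)
  have line: "\<nu>$1 * q$i$1 + \<nu>$2 * q$i$2 = 0" for i using \<nu>(2)[of i] \<nu>3 by (simp add: mink_def)
  define r where "r = sqrt ((\<nu>$1)\<^sup>2 + (\<nu>$2)\<^sup>2)"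
  have "\<nu>$1 \<noteq> 0 \<or> \<nu>$2 \<noteq> 0" using \<nu>(1) \<nu>3 by (auto simp: vec_eq_iff forall_3)
  then have r2: "(\<nu>$1)\<^sup>2 + (\<nu>$2)\<^sup>2 > 0" by (simp add: sum_power2_gt_zero_iff)
  then have r: "r > 0" "r\<^sup>2 = (\<nu>$1)\<^sup>2 + (\<nu>$2)\<^sup>2" by (auto simp: r_def)
  have "(\<nu>$2 / r)\<^sup>2 + (\<nu>$1 / r)\<^sup>2 = 1"
    unfolding power_divide add_divide_distrib[symmetric] r(2) using r2 by (metis add.commute divide_self less_irrefl)
  then obtain \<theta> where \<theta>: "\<nu>$2 / r = cos \<theta>" "\<nu>$1 / r = sin \<theta>"
    using sincos_total_2pi by metis
  have "rotate_config \<theta> q $ i \<in> hyp1" for i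
  proof -
    have "rotate_config \<theta> q $ i $ 2 = (\<nu>$1 * q$i$1 + \<nu>$2 * q$i$2) / r"
      by (simp add: rotate_config_nth \<theta>[symmetric] add_divide_distrib)
    then show ?thesis using rotate_hyp2[of \<theta> q] qh by (simp add: hyp1_def line)
  qed
  then show ?thesis by (rule that)
qed

definition hyp1_ccs :: "('n::{finite,linorder} \<Rightarrow> real) \<Rightarrow> real \<Rightarrow> 'n config set" where
  "hyp1_ccs m c = {q \<in> level_set m c. (\<forall>i. q$i \<in> hyp1) \<and> (\<exists>\<mu>. cc_equations m \<mu> q)}"

lemma mem_orbit: "p \<in> orbit q \<longleftrightarrow> (\<exists>\<theta>. p = rotate_config \<theta> q)"
  by (simp add: orbit_def S1_rel_def)

lemma self_mem_orbit: "q \<in> orbit q"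
  unfolding mem_orbit by (rule exI[of _ 0]) (simp add: rotate_config_0)

lemma orbit_rotate: "orbit (rotate_config \<theta> q) = orbit q"
proof -
  have "(q, rotate_config \<theta> q) \<in> S1_rel" by (auto simp: S1_rel_def)
  then show ?thesis unfolding orbit_def using equiv_class_eq[OF equiv_S1_rel] by metis
qed

lemma orbit_eq_iff: "orbit p = orbit q \<longleftrightarrow> (\<exists>\<theta>. p = rotate_config \<theta> q)"
  using self_mem_orbit[of p] orbit_rotate by (auto simp: mem_orbit)

lemma geodesic_cc_classes_eq:
  fixes m :: "'n::{finite,linorder} \<Rightarrow> real"
  assumes m: "\<And>i. m i > 0" and n: "CARD('n) \<ge> 2"
  shows "geodesic_cc_classes m c = orbit ` hyp1_ccs m c"
proof -
  have quot: "geodesic_cc_classes m c = orbit ` {q \<in> level_set m c. ordinary_cc m q \<and> geodesic_config q}"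
    by (auto simp: geodesic_cc_classes_def quotient_def orbit_def)
  show ?thesis
  proof
    show "geodesic_cc_classes m c \<subseteq> orbit ` hyp1_ccs m c"
    proof
      fix C assume "C \<in> geodesic_cc_classes m c"
      then obtain q \<mu> where q: "C = orbit q" "q \<in> level_set m c" "q \<in> config_space" "cc_equations m \<mu> q" "geodesic_config q"
        by (auto simp: quot ordinary_cc_iff)
      obtain \<theta> where \<theta>: "\<And>i. rotate_config \<theta> q $ i \<in> hyp1"
        using geodesic_cc_through_apex[OF q(3,5,4) m n] by blast
      then have "rotate_config \<theta> q \<in> hyp1_ccs m c"
        using q(2) cc_equations_rotate[OF q(4), of \<theta>] by (auto simp: hyp1_ccs_def rotate_level_set)
      then show "C \<in> orbit ` hyp1_ccs m c" using q(1) orbit_rotate by (metis image_eqI)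
    qed
    show "orbit ` hyp1_ccs m c \<subseteq> geodesic_cc_classes m c"
      unfolding quot
      by (rule image_mono)
        (auto simp: hyp1_ccs_def ordinary_cc_iff level_set_def geodesic_config_def intro: hgeodesic_hyp1)
  qed
qed

text \<open>Two distinct particles on the geodesic cannot both be at the apex; a particle away from it returns
  to the geodesic only when the sine of the angle is zero.\<close>

lemma hyp1_orbit:
  fixes q :: "'n::{finite,linorder} config"
  assumes q: "q \<in> config_space" "\<And>i. q$i \<in> hyp1" and r: "\<And>i. rotate_config \<theta> q $ i \<in> hyp1"
    and n: "CARD('n) \<ge> 2"
  shows "rotate_config \<theta> q = q \<or> rotate_config \<theta> q = rotate_config pi q"
proof -
  obtain a b :: 'n where ab: "a \<noteq> b" by (rule exists_distinct[OF n])
  have y: "q$i$2 = 0" for i using q(2)[of i] by (simp add: hyp1_def)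
  have "\<exists>i. q$i$1 \<noteq> 0"
  proof (rule ccontr)
    assume "\<nexists>i. q$i$1 \<noteq> 0"
    then have "lift (q$a$1) (q$a$2) = lift (q$b$1) (q$b$2)" using y by simp
    moreover have "lift (q$i$1) (q$i$2) = q$i" for i using q(2)[of i] by (intro lift_eq) (simp add: hyp1_def)
    ultimately have "q$a = q$b" by metis
    then show False using q(1) ab by (simp add: config_space_iff)
  qed
  then obtain i where i: "q$i$1 \<noteq> 0" by blast
  have "rotate_config \<theta> q $ i $ 2 = 0" using r[of i] by (simp add: hyp1_def)
  then have s: "sin \<theta> = 0" using i y[of i] by (simp add: rotate_config_nth)
  then have "cos \<theta> = 1 \<or> cos \<theta> = -1" using sin_cos_squared_add[of \<theta>] by (simp add: power2_eq_1_iff)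
  then show ?thesis
  proof
    assume "cos \<theta> = 1"
    then show ?thesis using s by (simp add: vec_eq_iff[of _ q] rotate_config_nth vec_eq_iff[of "rot \<theta> _"] forall_3)
  next
    assume "cos \<theta> = -1"
    then show ?thesis using s by (simp add: rotate_config_def)
  qed
qed

section \<open>Uniqueness on the line\<close>

lemma sqrt_cosh_square: "sqrt ((cosh (a::real))\<^sup>2 - 1) = \<bar>sinh a\<bar>"
  by (simp add: cosh_square_eq)

lemma hyp_grav_cosh: "hyp_grav (cosh a) = 1 / \<bar>sinh a\<bar> ^ 3"
  by (simp add: hyp_grav_def sqrt_cosh_square)

lemma DERIV_hyp_coth_cosh:
  assumes "a > 0"
  shows "((\<lambda>a. hyp_coth (cosh a)) has_real_derivative - (1 / (sinh a)\<^sup>2)) (at a)"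
proof -
  have z: "cosh a > 1" using assms cosh_real_strict_mono[of 0 a] by simp
  have "((\<lambda>a. hyp_coth (cosh a)) has_real_derivative - hyp_grav (cosh a) * sinh a) (at a)"
    by (rule DERIV_chain2[where f = hyp_coth and g = cosh, OF DERIV_hyp_coth[OF z]])
      (auto intro!: derivative_eq_intros)
  moreover have "- hyp_grav (cosh a) * sinh a = - (1 / (sinh a)\<^sup>2)"
    using assms by (simp add: hyp_grav_cosh power2_eq_square power3_eq_cube)
  ultimately show ?thesis by simp
qed

lemma hyp_coth_tangent_pos:
  assumes a: "a > 0" and b: "b > 0"
  shows "hyp_coth (cosh b) \<ge> hyp_coth (cosh a) - hyp_grav (cosh a) * sinh a * (b - a)"
proof -
  have "convex_on {0<..} (\<lambda>a. hyp_coth (cosh a))"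
  proof (rule convex_on_realI)
    fix x y :: real assume xy: "x \<in> {0<..}" "y \<in> {0<..}" "x \<le> y"
    then have "0 < sinh x" "sinh x \<le> sinh y" by auto
    then have "(sinh x)\<^sup>2 \<le> (sinh y)\<^sup>2" "(sinh x)\<^sup>2 > 0" by (auto intro: power_mono)
    then have "1 / (sinh y)\<^sup>2 \<le> 1 / (sinh x)\<^sup>2" by (intro divide_left_mono mult_pos_pos) auto
    then show "- (1 / (sinh x)\<^sup>2) \<le> - (1 / (sinh y)\<^sup>2)" by simp
  qed (auto intro: DERIV_hyp_coth_cosh)
  then have "hyp_coth (cosh b) - hyp_coth (cosh a) \<ge> - (1 / (sinh a)\<^sup>2) * (b - a)"
    by (rule convex_on_imp_above_tangent)
      (use a b in \<open>auto simp: interior_open intro: has_field_derivative_at_within DERIV_hyp_coth_cosh\<close>)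
  moreover have "hyp_grav (cosh a) * sinh a = 1 / (sinh a)\<^sup>2"
    using a by (simp add: hyp_grav_cosh power2_eq_square power3_eq_cube)
  ultimately show ?thesis by simp
qed

lemma hyp_coth_tangent:
  assumes "a > 0 \<and> b > 0 \<or> a < 0 \<and> b < 0"
  shows "hyp_coth (cosh b) \<ge> hyp_coth (cosh a) - hyp_grav (cosh a) * sinh a * (b - a)"
proof (cases "a > 0")
  case True then show ?thesis using assms hyp_coth_tangent_pos by auto
next
  case False
  then have "hyp_coth (cosh (- b)) \<ge> hyp_coth (cosh (- a)) - hyp_grav (cosh (- a)) * sinh (- a) * (- b - - a)"
    using assms by (intro hyp_coth_tangent_pos) auto
  then show ?thesis by (simp add: algebra_simps)
qed

text \<open>This gives the tangent inequality for \<open>sinh\<^sup>2\<close>, which is an affine function of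
  \<open>exp (2 * a) + exp (- 2 * a)\<close>.\<close>

lemma exp_gt_tangent:
  fixes a b :: real assumes "a \<noteq> b" shows "exp b > exp a + exp a * (b - a)"
proof -
  have "1 + (b - a) < exp (b - a)"
    using assms exp_ge_add_one_self[of "b - a"] exp_minus_greater[of "a - b"] by (smt (verit) diff_0_right)
  then have "exp a * (1 + (b - a)) < exp a * exp (b - a)" by simp
  then show ?thesis by (simp add: exp_add[symmetric] distrib_left)
qed

lemma sinh_square_tangent:
  fixes a b :: real assumes "a \<noteq> b"
  shows "(sinh b)\<^sup>2 > (sinh a)\<^sup>2 + 2 * sinh a * cosh a * (b - a)"
proof -
  have "exp (2*b) > exp (2*a) + exp (2*a) * (2*b - 2*a)" "exp (-2*b) > exp (-2*a) + exp (-2*a) * (-2*b - -2*a)"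
    by (rule exp_gt_tangent, use assms in simp)+
  then have "cosh (2*b) > cosh (2*a) + sinh (2*a) * (2*b - 2*a)"
    by (simp add: cosh_def sinh_def field_simps)
  moreover have "cosh (2 * x) = 1 + 2 * (sinh x)\<^sup>2" for x :: real
    by (simp add: cosh_double_cosh cosh_square_eq)
  ultimately show ?thesis unfolding sinh_double by (simp add: algebra_simps)
qed

text \<open>The parameter \<open>\<theta> i\<close> is the signed distance of the particle \<open>i\<close> from the apex.\<close>

definition line_config :: "('n::finite \<Rightarrow> real) \<Rightarrow> 'n config" where
  "line_config \<theta> = (\<chi> i. lift (sinh (\<theta> i)) 0)"

lemma line_nth [simp]:
  "line_config \<theta> $ i $ 1 = sinh (\<theta> i)" "line_config \<theta> $ i $ 2 = 0" "line_config \<theta> $ i $ 3 = cosh (\<theta> i)"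
  by (simp_all add: line_config_def add.commute[of 1] cosh_square_eq[symmetric])

lemma line_hyp1: "line_config \<theta> $ i \<in> hyp1"
  by (simp add: hyp1_def line_config_def lift_hyp2)

lemma hyp1_line:
  assumes "\<And>i. q$i \<in> hyp1" shows "q = line_config (\<lambda>i. arsinh (q$i$1))"
proof -
  have "q$i = lift (q$i$1) (q$i$2)" "q$i$2 = 0" for i
    using assms[of i] lift_eq[of "q$i"] by (auto simp: hyp1_def)
  then have "q$i = lift (q$i$1) 0" for i by metis
  then show ?thesis by (simp add: line_config_def vec_eq_iff[of q])
qed

lemma mink_line: "mink (line_config \<theta> $ i) (line_config \<theta> $ j) = - cosh (\<theta> i - \<theta> j)"
  by (simp add: mink_def cosh_diff)

lemma line_config_space: "line_config \<theta> \<in> config_space \<longleftrightarrow> inj \<theta>"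
proof -
  have "line_config \<theta> $ i = line_config \<theta> $ j \<longleftrightarrow> \<theta> i = \<theta> j" for i j
    by (metis line_nth(1) sinh_real_eq_iff line_config_def vec_lambda_beta)
  then show ?thesis using line_hyp1[of \<theta>] by (auto simp: config_space_iff inj_def hyp1_def)
qed

lemma pair_weight_line: "pair_weight m (line_config \<theta>) i j
    = (if i = j then 0 else m i * m j * hyp_grav (cosh (\<theta> i - \<theta> j)))"
  by (simp add: pair_weight_def mink_line)

text \<open>The force equation paired with the unit tangent vector \<open>(cosh \<theta>, 0, sinh \<theta>)\<close> of the geodesic.\<close>

lemma cc_equations_line:
  assumes "cc_equations m \<mu> (line_config \<theta>)"
  shows "(\<Sum>j\<in>UNIV. pair_weight m (line_config \<theta>) i j * sinh (\<theta> j - \<theta> i))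
     = 2 * \<mu> * m i * sinh (\<theta> i) * cosh (\<theta> i)"
proof -
  let ?q = "line_config \<theta>"
  define t :: "real^3" where "t = vector [cosh (\<theta> i), 0, sinh (\<theta> i)]"
  obtain s where s: "force m ?q i = (2 * \<mu> * m i) *\<^sub>R planar (?q$i) + s *\<^sub>R ?q$i"
    using assms by (auto simp: cc_equations_def)
  have tq: "mink t (?q$j) = sinh (\<theta> j - \<theta> i)" for j
    by (simp add: t_def mink_def sinh_diff mult.commute)
  have "mink t (force m ?q i) = (\<Sum>j\<in>UNIV. pair_weight m ?q i j * sinh (\<theta> j - \<theta> i))"
    by (simp add: force_def mink_simps tq)
  moreover have "mink t (planar (?q$i)) = sinh (\<theta> i) * cosh (\<theta> i)" by (simp add: mink_planar t_def)
  ultimately show ?thesis unfolding s by (simp add: mink_simps tq)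
qed

text \<open>The potential lies above its tangent because \<open>coth\<close> is convex on each side of a collision, and \<open>- \<mu>\<close>
  times the inertia moment lies strictly above its own because \<open>sinh\<^sup>2\<close> is strictly convex. By the
  equations of central configurations the linear terms of the two tangents cancel.\<close>

lemma line_cc_strict_minimum:
  fixes \<theta> \<phi> :: "'n::{finite,linorder} \<Rightarrow> real"
  assumes cc: "cc_equations m \<mu> (line_config \<theta>)" and \<mu>: "\<mu> < 0"
    and m: "\<And>i. m i > 0" and inj: "inj \<theta>" "inj \<phi>"
    and order: "\<And>i j. \<theta> i < \<theta> j \<longleftrightarrow> \<phi> i < \<phi> j" and ne: "\<theta> \<noteq> \<phi>"
  shows "potential m (line_config \<theta>) - \<mu> * inertia_moment m (line_config \<theta>)
       < potential m (line_config \<phi>) - \<mu> * inertia_moment m (line_config \<phi>)"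
proof -
  define \<delta> where "\<delta> i = \<phi> i - \<theta> i" for i
  let ?k = "pair_weight m (line_config \<theta>)"
  let ?f = "\<lambda>\<theta> i j. if i = j then 0 else m i * m j * hyp_coth (cosh (\<theta> i - \<theta> j))"
  have U: "2 * potential m (line_config \<psi>) = (\<Sum>i\<in>UNIV. \<Sum>j\<in>UNIV. ?f \<psi> i j)" if "inj \<psi>" for \<psi> :: "'n \<Rightarrow> real"
    using that by (simp add: potential_eq_ambient line_config_space ambient_potential_def mink_line cong: if_cong)
  have pair: "?f \<phi> i j \<ge> ?f \<theta> i j + ?k i j * sinh (\<theta> j - \<theta> i) * (\<delta> i - \<delta> j)" for i j
  proof (cases "i = j")
    case False
    then have "\<theta> i \<noteq> \<theta> j" using inj by (simp add: inj_eq)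
    then have "\<theta> i - \<theta> j > 0 \<and> \<phi> i - \<phi> j > 0 \<or> \<theta> i - \<theta> j < 0 \<and> \<phi> i - \<phi> j < 0"
      using order[of i j] order[of j i] by auto
    from hyp_coth_tangent[OF this]
    have "m i * m j * (hyp_coth (cosh (\<theta> i - \<theta> j))
          - hyp_grav (cosh (\<theta> i - \<theta> j)) * sinh (\<theta> i - \<theta> j) * (\<phi> i - \<phi> j - (\<theta> i - \<theta> j)))
        \<le> m i * m j * hyp_coth (cosh (\<phi> i - \<phi> j))"
      using m[of i] m[of j] by (intro mult_left_mono) auto
    moreover have "sinh (\<theta> j - \<theta> i) = - sinh (\<theta> i - \<theta> j)" by (metis minus_diff_eq sinh_minus)
    ultimately show ?thesis using False by (simp add: pair_weight_line \<delta>_def algebra_simps)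
  qed simp
  have "2 * potential m (line_config \<phi>) \<ge> (\<Sum>i\<in>UNIV. \<Sum>j\<in>UNIV. ?f \<theta> i j + ?k i j * sinh (\<theta> j - \<theta> i) * (\<delta> i - \<delta> j))"
    unfolding U[OF inj(2)] by (intro sum_mono pair)
  also have "(\<Sum>i\<in>UNIV. \<Sum>j\<in>UNIV. ?f \<theta> i j + ?k i j * sinh (\<theta> j - \<theta> i) * (\<delta> i - \<delta> j))
      = 2 * potential m (line_config \<theta>) + (\<Sum>i\<in>UNIV. \<Sum>j\<in>UNIV. ?k i j * sinh (\<theta> j - \<theta> i) * (\<delta> i - \<delta> j))"
    unfolding U[OF inj(1)] by (simp add: sum.distrib)
  also have "(\<Sum>i\<in>UNIV. \<Sum>j\<in>UNIV. ?k i j * sinh (\<theta> j - \<theta> i) * (\<delta> i - \<delta> j))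
      = 2 * (\<Sum>i\<in>UNIV. \<Sum>j\<in>UNIV. ?k i j * sinh (\<theta> j - \<theta> i) * \<delta> i)"
  proof (rule sum_antisymmetric)
    show "?k j i * sinh (\<theta> i - \<theta> j) = - (?k i j * sinh (\<theta> j - \<theta> i))" for i j
      using sinh_minus[of "\<theta> j - \<theta> i"] by (simp add: pair_weight_sym[of m _ j i])
  qed
  also have "(\<Sum>i\<in>UNIV. \<Sum>j\<in>UNIV. ?k i j * sinh (\<theta> j - \<theta> i) * \<delta> i)
      = (\<Sum>i\<in>UNIV. 2 * \<mu> * m i * sinh (\<theta> i) * cosh (\<theta> i) * \<delta> i)"
    by (simp add: sum_distrib_right[symmetric] cc_equations_line[OF cc])
  finally have 1: "potential m (line_config \<phi>)
      \<ge> potential m (line_config \<theta>) + (\<Sum>i\<in>UNIV. 2 * \<mu> * m i * sinh (\<theta> i) * cosh (\<theta> i) * \<delta> i)"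
    by simp
  obtain i0 where i0: "\<theta> i0 \<noteq> \<phi> i0" using ne by (auto simp: fun_eq_iff)
  have I: "inertia_moment m (line_config \<psi>) = (\<Sum>i\<in>UNIV. m i * (sinh (\<psi> i))\<^sup>2)" for \<psi>
    by (simp add: inertia_moment_def)
  have strict: "m i * (sinh (\<theta> i))\<^sup>2 + 2 * m i * sinh (\<theta> i) * cosh (\<theta> i) * \<delta> i < m i * (sinh (\<phi> i))\<^sup>2"
    if "\<theta> i \<noteq> \<phi> i" for i
  proof -
    have "m i * ((sinh (\<theta> i))\<^sup>2 + 2 * sinh (\<theta> i) * cosh (\<theta> i) * \<delta> i) < m i * (sinh (\<phi> i))\<^sup>2"
      using sinh_square_tangent[OF that] m[of i] by (simp add: \<delta>_def)
    then show ?thesis by (simp add: algebra_simps)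
  qed
  have weak: "m i * (sinh (\<theta> i))\<^sup>2 + 2 * m i * sinh (\<theta> i) * cosh (\<theta> i) * \<delta> i \<le> m i * (sinh (\<phi> i))\<^sup>2" for i
    using strict[of i] by (cases "\<theta> i = \<phi> i") (auto simp: \<delta>_def)
  have "(\<Sum>i\<in>UNIV. m i * (sinh (\<theta> i))\<^sup>2 + 2 * m i * sinh (\<theta> i) * cosh (\<theta> i) * \<delta> i)
      < inertia_moment m (line_config \<phi>)"
    unfolding I by (rule sum_strict_mono_ex1) (use weak strict[OF i0] in auto)
  then have "inertia_moment m (line_config \<theta>) + (\<Sum>i\<in>UNIV. 2 * m i * sinh (\<theta> i) * cosh (\<theta> i) * \<delta> i)
      < inertia_moment m (line_config \<phi>)"
    unfolding I by (simp add: sum.distrib)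
  then have "- \<mu> * (inertia_moment m (line_config \<theta>) + (\<Sum>i\<in>UNIV. 2 * m i * sinh (\<theta> i) * cosh (\<theta> i) * \<delta> i))
      < - \<mu> * inertia_moment m (line_config \<phi>)"
    using \<mu> by (intro mult_strict_left_mono) auto
  moreover have "(\<Sum>i\<in>UNIV. 2 * \<mu> * m i * sinh (\<theta> i) * cosh (\<theta> i) * \<delta> i)
      = \<mu> * (\<Sum>i\<in>UNIV. 2 * m i * sinh (\<theta> i) * cosh (\<theta> i) * \<delta> i)"
    by (simp add: sum_distrib_left mult_ac)
  ultimately show ?thesis using 1 by (simp add: algebra_simps)
qed

lemma hyp1_cc_unique:
  fixes q p :: "'n::{finite,linorder} config"
  assumes m: "\<And>i. m i > 0" and n: "CARD('n) \<ge> 2"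
    and q: "q \<in> hyp1_ccs m c" and p: "p \<in> hyp1_ccs m c"
    and order: "\<And>i j. q$i$1 < q$j$1 \<longleftrightarrow> p$i$1 < p$j$1"
  shows "q = p"
proof (rule ccontr)
  assume ne: "q \<noteq> p"
  define \<theta> \<phi> where "\<theta> i = arsinh (q$i$1)" and "\<phi> i = arsinh (p$i$1)" for i
  have qe: "q = line_config \<theta>" and pe: "p = line_config \<phi>"
    unfolding \<theta>_def \<phi>_def by (rule hyp1_line; use q p in \<open>simp add: hyp1_ccs_def\<close>)+
  obtain \<mu> \<nu> where cc: "cc_equations m \<mu> q" "cc_equations m \<nu> p"
    and cs: "q \<in> config_space" "p \<in> config_space"
    and I: "inertia_moment m q = c" "inertia_moment m p = c"
    using q p by (auto simp: hyp1_ccs_def level_set_def)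
  have neg: "\<mu> < 0" "\<nu> < 0" using cc_multiplier_negative[OF cs(1) cc(1) m n] cc_multiplier_negative[OF cs(2) cc(2) m n] by auto
  have inj: "inj \<theta>" "inj \<phi>" using cs unfolding qe pe line_config_space by auto
  have ord: "\<theta> i < \<theta> j \<longleftrightarrow> \<phi> i < \<phi> j" for i j using order[of i j] by (simp add: \<theta>_def \<phi>_def)
  have "\<theta> \<noteq> \<phi>" using ne qe pe by auto
  then have "potential m q < potential m p" "potential m p < potential m q"
    using line_cc_strict_minimum[OF cc(1)[unfolded qe] neg(1) m inj ord]
      line_cc_strict_minimum[OF cc(2)[unfolded pe] neg(2) m inj(2,1) ord[symmetric]]
      I unfolding qe pe by auto
  then show False by simp
qed

section \<open>Existence on the line\<close>

lemma potential_line: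
  assumes "inj \<theta>"
  shows "2 * potential m (line_config \<theta>)
    = (\<Sum>i\<in>UNIV. \<Sum>j\<in>UNIV. if i = j then 0 else m i * m j * hyp_coth (cosh (\<theta> i - \<theta> j)))"
  using assms by (simp add: potential_eq_ambient line_config_space ambient_potential_def mink_line cong: if_cong)

text \<open>A bound on the potential bounds every \<open>sinh (\<theta> j - \<theta> i)\<close> from below. This describes sublevel sets
  by closed conditions.\<close>

lemma potential_line_ge_pair:
  assumes inj: "inj \<theta>" and m: "\<And>i. m i > 0" and ij: "\<theta> i < \<theta> j"
  shows "m i * m j \<le> potential m (line_config \<theta>) * sinh (\<theta> j - \<theta> i)"
proof -
  define f where "f i j = (if i = j then 0 else m i * m j * hyp_coth (cosh (\<theta> i - \<theta> j)))" for i j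
  have f0: "f i j \<ge> 0" for i j
  proof -
    have "hyp_coth (cosh (\<theta> i - \<theta> j)) \<ge> 0" by (simp add: hyp_coth_def sqrt_cosh_square)
    then show ?thesis using m[of i] m[of j] by (simp add: f_def)
  qed
  have ne: "i \<noteq> j" using ij by auto
  have "f i j + f j i \<le> (\<Sum>b\<in>UNIV. f i b) + (\<Sum>b\<in>UNIV. f j b)"
    by (intro add_mono member_le_sum) (auto simp: f0)
  also have "\<dots> = (\<Sum>a\<in>{i,j}. \<Sum>b\<in>UNIV. f a b)" using ne by simp
  also have "\<dots> \<le> (\<Sum>a\<in>UNIV. \<Sum>b\<in>UNIV. f a b)"
    by (rule sum_mono2) (auto simp: f0 sum_nonneg)
  also have "\<dots> = 2 * potential m (line_config \<theta>)"
    unfolding potential_line[OF inj] f_def by simp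
  finally have 1: "f i j + f j i \<le> 2 * potential m (line_config \<theta>)" .
  have "cosh (\<theta> j - \<theta> i) = cosh (\<theta> i - \<theta> j)" by (metis cosh_minus minus_diff_eq)
  then have "f j i = f i j" by (simp only: f_def eq_commute[of j i] mult.commute[of "m j"])
  then have "f i j \<le> potential m (line_config \<theta>)" using 1 by simp
  moreover have "f i j * sinh (\<theta> j - \<theta> i) = m i * m j * cosh (\<theta> i - \<theta> j)"
  proof -
    have "sinh (\<theta> j - \<theta> i) > 0" using ij by simp
    moreover have "sinh (\<theta> j - \<theta> i) = - sinh (\<theta> i - \<theta> j)" by (metis sinh_minus minus_diff_eq)
    ultimately show ?thesis using ne by (simp add: f_def hyp_coth_def sqrt_cosh_square)
  qed
  ultimately have "m i * m j * cosh (\<theta> i - \<theta> j) \<le> potential m (line_config \<theta>) * sinh (\<theta> j - \<theta> i)"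
    using ij by (metis less_eq_real_def mult_right_mono sinh_real_nonneg_iff diff_ge_0_iff_ge)
  moreover have "m i * m j * 1 \<le> m i * m j * cosh (\<theta> i - \<theta> j)"
    using m[of i] m[of j] by (intro mult_left_mono cosh_real_ge_1) auto
  ultimately show ?thesis by simp
qed

lemma lift_axis: "lift x y = x *\<^sub>R axis 1 1 + y *\<^sub>R axis 2 1 + sqrt (1 + x\<^sup>2 + y\<^sup>2) *\<^sub>R axis 3 1"
  by (simp add: vec_eq_iff forall_3 axis_def)

text \<open>The prescribed order is encoded by the ranks \<open>\<rho>\<close>. The coordinates are the \<open>x\<close>-coordinates, because
  they turn the level set into an ellipsoid and the great circles \<open>cos t * x + sin t * v\<close> into
  curves inside it. The set \<open>K\<close> is compact, contains the sublevel set of some ordered point \<open>x0\<close>, and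
  consists of ordered points. At a minimum the derivative along all these great circles
  vanishes, so the gradient is a multiple of \<open>m * x\<close>.\<close>

lemma exists_hyp1_cc:
  fixes m :: "'n::{finite,linorder} \<Rightarrow> real" and \<rho> :: "'n \<Rightarrow> nat"
  assumes m: "\<And>i. m i > 0" and c: "c > 0" and \<rho>: "inj \<rho>"
  shows "\<exists>q\<in>hyp1_ccs m c. \<forall>i j. \<rho> i < \<rho> j \<longrightarrow> q$i$1 < q$j$1"
proof -
  define Q where "Q x = line_config (\<lambda>i. arsinh (x$i))" for x :: "(real, 'n) vec"
  define N where "N x = (\<Sum>i\<in>UNIV. m i * (x$i)\<^sup>2)" for x :: "(real, 'n) vec"
  have Q_lift: "Q x = (\<chi> i. lift (x$i) 0)" for x by (simp add: Q_def line_config_def)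
  have I: "inertia_moment m (Q x) = N x" for x by (simp add: Q_lift inertia_moment_def N_def)
  define X where "X = {x. (\<forall>i j. \<rho> i < \<rho> j \<longrightarrow> x$i < x$j) \<and> N x = c}"
  have X_inj: "inj (\<lambda>i. arsinh (x$i))" if "x \<in> X" for x
  proof (rule injI)
    fix i j assume "arsinh (x$i) = arsinh (x$j)"
    then have "x$i = x$j" by (metis sinh_arsinh_real)
    then have "\<not> \<rho> i < \<rho> j" "\<not> \<rho> j < \<rho> i" using that by (force simp: X_def)+
    then show "i = j" using \<rho> by (simp add: inj_eq)
  qed
  then have X_cs: "Q x \<in> config_space" if "x \<in> X" for x using that by (simp add: Q_def line_config_space)
  define R where "R = (\<Sum>i\<in>UNIV. m i * (real (\<rho> i) + 1)\<^sup>2)"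
  have R: "R > 0" unfolding R_def by (intro sum_pos mult_pos_pos m) auto
  define x0 :: "(real, 'n) vec" where "x0 = (\<chi> i. sqrt (c / R) * (real (\<rho> i) + 1))"
  have "N x0 = (\<Sum>i\<in>UNIV. c / R * (m i * (real (\<rho> i) + 1)\<^sup>2))"
    unfolding N_def x0_def using R c by (intro sum.cong) (auto simp: power_mult_distrib)
  also have "\<dots> = c / R * R" unfolding sum_distrib_left[symmetric] R_def ..
  finally have "N x0 = c" using R by simp
  then have x0: "x0 \<in> X" using R c by (auto simp: X_def x0_def)
  define U where "U x = potential m (Q x)" for x
  define M where "M = U x0"
  define K where "K = {x. (\<forall>i j. \<rho> i < \<rho> j \<longrightarrow> m i * m j \<le> M * sinh (arsinh (x$j) - arsinh (x$i))) \<and> N x = c}"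
  have sublevel: "x \<in> K" if x: "x \<in> X" "U x \<le> M" for x
  proof -
    have "m i * m j \<le> M * sinh (arsinh (x$j) - arsinh (x$i))" if "\<rho> i < \<rho> j" for i j
    proof -
      have lt: "arsinh (x$i) < arsinh (x$j)" using x(1) that by (simp add: X_def)
      have "m i * m j \<le> U x * sinh (arsinh (x$j) - arsinh (x$i))"
        unfolding U_def Q_def by (rule potential_line_ge_pair[OF X_inj[OF x(1)] m lt])
      also have "\<dots> \<le> M * sinh (arsinh (x$j) - arsinh (x$i))"
        using x(2) less_imp_le[OF lt]
        by (intro mult_right_mono) (simp_all only: sinh_real_nonneg_iff diff_ge_0_iff_ge)
      finally show ?thesis .
    qed
    then show ?thesis using x(1) by (simp add: K_def X_def)
  qed
  have KX: "x \<in> X" if x: "x \<in> K" for x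
  proof -
    have "x$i < x$j" if ij: "\<rho> i < \<rho> j" for i j
    proof -
      have lt: "arsinh (x0$i) < arsinh (x0$j)" using x0 ij by (simp add: X_def)
      have "0 < m i * m j" using m by simp
      also have "\<dots> \<le> M * sinh (arsinh (x0$j) - arsinh (x0$i))"
        unfolding M_def U_def Q_def by (rule potential_line_ge_pair[OF X_inj[OF x0] m lt])
      finally have "M > 0" using lt by (simp add: zero_less_mult_iff)
      moreover have "0 < M * sinh (arsinh (x$j) - arsinh (x$i))"
        using x ij m[of i] m[of j] by (smt (verit) K_def mem_Collect_eq mult_pos_pos)
      ultimately have "sinh (arsinh (x$j) - arsinh (x$i)) > 0" by (simp add: zero_less_mult_iff)
      then show ?thesis by simp
    qed
    then show ?thesis using x by (simp add: K_def X_def)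
  qed
  have "closed K"
  proof -
    have "closed {x. \<rho> i < \<rho> j \<longrightarrow> m i * m j \<le> M * sinh (arsinh (x$j) - arsinh (x$i))}" for i j
      by (cases "\<rho> i < \<rho> j")
        (auto intro!: closed_Collect_le continuous_intros continuous_on_compose2[OF continuous_on_arsinh[of UNIV]])
    moreover have "closed {x. N x = c}"
      unfolding N_def by (intro closed_Collect_eq continuous_intros)
    ultimately show ?thesis unfolding K_def by (intro closed_Collect_conj closed_Collect_all) auto
  qed
  moreover have "bounded K"
    by (rule bounded_subset[OF bounded_weighted_sphere[of m c, OF m]]) (auto simp: K_def N_def)
  ultimately have "compact K" by (simp add: compact_eq_bounded_closed)
  moreover have "x0 \<in> K" by (rule sublevel[OF x0]) (simp add: M_def)
  then have "K \<noteq> {}" by blast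
  moreover have "continuous_on K U"
  proof -
    have "continuous_on UNIV Q"
      unfolding Q_lift[abs_def] lift_axis by (intro continuous_on_vec_lambda continuous_intros)
    then have Qc: "isCont Q x" for x by (simp add: continuous_on_eq_continuous_at)
    have "isCont (\<lambda>x. ambient_potential m (Q x)) x" if "x \<in> K" for x
      by (rule isCont_o2[OF Qc has_derivative_continuous[OF has_derivative_ambient_potential]])
        (rule separated_config_space[OF X_cs[OF KX[OF that]]])
    then have "continuous_on K (\<lambda>x. ambient_potential m (Q x))" by (simp add: continuous_at_imp_continuous_on)
    then show ?thesis
      by (rule continuous_on_eq) (simp add: U_def potential_eq_ambient X_cs KX)
  qed
  ultimately obtain x where x: "x \<in> K" "\<And>y. y \<in> K \<Longrightarrow> U x \<le> U y"
    using continuous_attains_inf by metis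
  have xX: "x \<in> X" by (rule KX[OF x(1)])
  have min: "U x \<le> U y" if "y \<in> X" for y
    using x(2)[OF \<open>x0 \<in> K\<close>] x(2)[OF sublevel[OF that]] by (cases "U y \<le> M") (auto simp: M_def)
  \<comment> \<open>The derivative of the potential with respect to \<open>x i\<close>, when the third coordinate of the particle
    follows the hyperboloid.\<close>
  define g where "g i = force m (Q x) i $ 1 - x$i * force m (Q x) i $ 3 / Q x $ i $ 3" for i
  have crit: "(\<Sum>i\<in>UNIV. v$i * g i) = 0"
    if v: "(\<Sum>i\<in>UNIV. m i * x$i * v$i) = 0" "N v = c" for v
  proof -
    define Y where "Y t i = cos t * x$i + sin t * v$i" for t i
    define \<gamma> where "\<gamma> t = (\<chi> i. lift (Y t i) 0)" for t
    define \<xi> :: "'n config" where "\<xi> = (\<chi> i. vector [v$i, 0, (Y 0 i * v$i + 0 * 0) / lift (Y 0 i) 0 $ 3])"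
    have Y': "((\<lambda>t. Y t i) has_real_derivative v$i) (at 0)" for i
      unfolding Y_def by (auto intro!: derivative_eq_intros)
    have Y0: "Y 0 i = x$i" for i by (simp add: Y_def)
    have "(\<gamma> has_vector_derivative \<xi>) (at 0)"
    proof (rule has_vector_derivative_vec)
      show "((\<lambda>t. \<gamma> t $ i) has_vector_derivative \<xi> $ i) (at 0)" for i
        unfolding \<gamma>_def \<xi>_def vec_lambda_beta by (rule has_vector_derivative_lift[OF Y' DERIV_const])
    qed
    then have \<gamma>': "(\<gamma> has_derivative (\<lambda>h. h *\<^sub>R \<xi>)) (at 0)" by (simp add: has_vector_derivative_def)
    have \<gamma>0: "\<gamma> 0 = Q x" by (simp add: \<gamma>_def Q_lift Y0)
    have "((\<lambda>t. ambient_potential m (\<gamma> t)) has_derivative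
        (\<lambda>h. \<Sum>i\<in>UNIV. mink ((h *\<^sub>R \<xi>)$i) (force m (\<gamma> 0) i))) (at 0)"
      by (rule has_derivative_compose[OF \<gamma>' has_derivative_ambient_potential])
        (unfold \<gamma>0, rule separated_config_space[OF X_cs[OF xX]])
    then have D: "((\<lambda>t. ambient_potential m (\<gamma> t)) has_real_derivative
        (\<Sum>i\<in>UNIV. mink (\<xi>$i) (force m (Q x) i))) (at 0)"
      unfolding has_field_derivative_def \<gamma>0
      by (rule has_derivative_eq_rhs) (simp add: fun_eq_iff mink_scale_left sum_distrib_left mult.commute)
    have "\<forall>\<^sub>F t in nhds 0. \<forall>i j. \<rho> i < \<rho> j \<longrightarrow> Y t i < Y t j"
    proof (intro eventually_all_finite)
      fix i j
      show "\<forall>\<^sub>F t in nhds 0. \<rho> i < \<rho> j \<longrightarrow> Y t i < Y t j"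
      proof (cases "\<rho> i < \<rho> j")
        case True
        have "isCont (\<lambda>t. Y t j - Y t i) 0" unfolding Y_def by (intro continuous_intros)
        then have "((\<lambda>t. Y t j - Y t i) \<longlongrightarrow> Y 0 j - Y 0 i) (nhds 0)"
          unfolding isCont_def by (rule tendsto_at_iff_tendsto_nhds[THEN iffD1])
        moreover have "0 < Y 0 j - Y 0 i" using xX True by (simp add: Y0 X_def)
        ultimately have "\<forall>\<^sub>F t in nhds 0. 0 < Y t j - Y t i" by (rule order_tendstoD(1))
        then show ?thesis by (rule eventually_mono) simp
      qed simp
    qed
    then obtain d where d: "d > 0" "\<And>t. \<bar>t\<bar> < d \<Longrightarrow> \<forall>i j. \<rho> i < \<rho> j \<longrightarrow> Y t i < Y t j"
      unfolding eventually_nhds_metric by (auto simp: dist_real_def)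
    have "ambient_potential m (\<gamma> 0) \<le> ambient_potential m (\<gamma> t)" if t: "\<bar>0 - t\<bar> < d" for t
    proof -
      define y :: "(real, 'n) vec" where "y = (\<chi> i. Y t i)"
      have "N y = (cos t)\<^sup>2 * N x + (sin t)\<^sup>2 * N v + 2 * cos t * sin t * (\<Sum>i\<in>UNIV. m i * x$i * v$i)"
        unfolding N_def y_def Y_def sum_distrib_left sum.distrib[symmetric]
        by (rule sum.cong) (auto simp: power2_eq_square algebra_simps)
      also have "\<dots> = ((sin t)\<^sup>2 + (cos t)\<^sup>2) * c"
        using v xX by (simp add: X_def algebra_simps del: sin_cos_squared_add sin_cos_squared_add2 sin_cos_squared_add3)
      finally have "N y = c" by simp
      then have yX: "y \<in> X" using d(2)[of t] t by (simp add: X_def y_def)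
      have "\<gamma> t = Q y" by (simp add: \<gamma>_def Q_lift y_def)
      then show ?thesis using min[OF yX] X_cs[OF xX] X_cs[OF yX] by (simp add: \<gamma>0 U_def potential_eq_ambient)
    qed
    then have "(\<Sum>i\<in>UNIV. mink (\<xi>$i) (force m (Q x) i)) = 0"
      using DERIV_local_min[OF D d(1)] by blast
    moreover have "mink (\<xi>$i) (force m (Q x) i) = v$i * g i" for i
      by (simp add: mink_def \<xi>_def g_def Y0 Q_lift algebra_simps)
    ultimately show ?thesis by simp
  qed
  define \<kappa> where "\<kappa> = (\<Sum>i\<in>UNIV. x$i * g i) / c"
  \<comment> \<open>The component of the gradient for the weighted inner product that is tangent to the ellipsoid;
    testing the gradient on it gives its own weighted square norm.\<close>
  define v :: "(real, 'n) vec" where "v = (\<chi> i. g i / m i - \<kappa> * x$i)"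
  have Nx: "N x = c" using xX by (simp add: X_def)
  have vx: "(\<Sum>i\<in>UNIV. m i * x$i * v$i) = 0"
  proof -
    have "(\<Sum>i\<in>UNIV. m i * x$i * v$i) = (\<Sum>i\<in>UNIV. x$i * g i - \<kappa> * (m i * (x$i)\<^sup>2))"
      using m by (intro sum.cong) (auto simp: v_def field_simps power2_eq_square less_imp_neq[symmetric])
    also have "\<dots> = (\<Sum>i\<in>UNIV. x$i * g i) - \<kappa> * N x"
      by (simp add: sum_subtractf sum_distrib_left N_def)
    finally show ?thesis using c by (simp add: Nx \<kappa>_def)
  qed
  have "v = 0"
  proof (rule ccontr)
    assume "v \<noteq> 0"
    then obtain i where "v$i \<noteq> 0" by (auto simp: vec_eq_iff)
    then have "m i * (v$i)\<^sup>2 > 0" using m[of i] by simp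
    moreover have "m i * (v$i)\<^sup>2 \<le> N v" unfolding N_def
      by (rule member_le_sum) (use m in \<open>auto simp: less_imp_le\<close>)
    ultimately have Nv: "N v > 0" by linarith
    define a where "a = sqrt (c / N v)"
    have a: "a > 0" "a\<^sup>2 * N v = c" using c Nv by (auto simp: a_def)
    have Na: "N (a *\<^sub>R v) = a\<^sup>2 * N v" by (simp add: N_def power_mult_distrib sum_distrib_left mult_ac)
    have xa: "(\<Sum>i\<in>UNIV. m i * x$i * (a *\<^sub>R v)$i) = a * (\<Sum>i\<in>UNIV. m i * x$i * v$i)"
      by (simp add: sum_distrib_left mult_ac)
    have "(\<Sum>i\<in>UNIV. (a *\<^sub>R v)$i * g i) = 0"
      by (rule crit) (simp_all only: xa vx Na a mult_zero_right)
    then have "a * (\<Sum>i\<in>UNIV. v$i * g i) = 0" by (simp add: sum_distrib_left mult_ac)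
    then have "(\<Sum>i\<in>UNIV. v$i * g i) = 0" using a by simp
    moreover have "(\<Sum>i\<in>UNIV. v$i * g i) = N v + \<kappa> * (\<Sum>i\<in>UNIV. m i * x$i * v$i)"
      unfolding N_def sum_distrib_left sum.distrib[symmetric]
      using m by (intro sum.cong) (auto simp: v_def field_simps power2_eq_square less_imp_neq[symmetric])
    ultimately show False using vx Nv by simp
  qed
  then have gk: "g i = \<kappa> * m i * x$i" for i
  proof -
    have "v$i = 0" using \<open>v = 0\<close> by simp
    then show ?thesis using m[of i] by (simp add: v_def field_simps)
  qed
  have "cc_equations m (\<kappa> / 2) (Q x)"
    unfolding cc_equations_def
  proof
    fix i
    let ?F = "force m (Q x) i"
    have w: "Q x $ i $ 3 \<noteq> 0" by (simp add: Q_def)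
    have x1: "Q x $ i $ 1 = x$i" "Q x $ i $ 2 = 0" by (simp_all add: Q_lift)
    have F2: "?F $ 2 = 0" by (simp add: force_def Q_lift)
    have F1: "?F $ 1 = \<kappa> * m i * x$i + ?F $ 3 / Q x $ i $ 3 * x$i" using gk[of i] by (simp add: g_def algebra_simps)
    have "?F = (2 * (\<kappa> / 2) * m i) *\<^sub>R planar (Q x $ i) + (?F $ 3 / Q x $ i $ 3) *\<^sub>R Q x $ i"
      using w F1 F2 by (simp add: vec_eq_iff[of ?F] forall_3 x1)
    then show "\<exists>s. ?F = (2 * (\<kappa> / 2) * m i) *\<^sub>R planar (Q x $ i) + s *\<^sub>R Q x $ i" ..
  qed
  moreover have "Q x $ i \<in> hyp1" for i by (simp add: Q_def line_hyp1)
  ultimately have "Q x \<in> hyp1_ccs m c"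
    using X_cs[OF xX] Nx by (auto simp: hyp1_ccs_def level_set_def I)
  moreover have "\<forall>i j. \<rho> i < \<rho> j \<longrightarrow> Q x $ i $ 1 < Q x $ j $ 1"
    using xX by (simp add: X_def Q_lift)
  ultimately show ?thesis by blast
qed

section \<open>The Hessian as second variation of the Lagrangian\<close>

text \<open>The derivative of \<open>pair_weight\<close> with respect to \<open>mink (q$i) (q$j)\<close>.\<close>

definition weight_slope :: "('n::finite \<Rightarrow> real) \<Rightarrow> 'n config \<Rightarrow> 'n \<Rightarrow> 'n \<Rightarrow> real" where
  "weight_slope m q i j = (if i = j then 0 else m i * m j *
     (3 * (- mink (q$i) (q$j)) / sqrt ((- mink (q$i) (q$j))\<^sup>2 - 1) ^ 5))"

definition residual_deriv ::
  "('n::finite \<Rightarrow> real) \<Rightarrow> real \<Rightarrow> ('n \<Rightarrow> real) \<Rightarrow> 'n config \<Rightarrow> 'n config \<Rightarrow> 'n \<Rightarrow> real^3" where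
  "residual_deriv m \<mu> \<sigma> q \<xi> i =
     (\<Sum>j\<in>UNIV. pair_weight m q i j *\<^sub>R \<xi>$j
        + (weight_slope m q i j * (mink (q$i) (\<xi>$j) + mink (\<xi>$i) (q$j))) *\<^sub>R q$j)
     - (2 * \<mu> * m i) *\<^sub>R planar (\<xi>$i) - (2 * \<sigma> i) *\<^sub>R \<xi>$i"

definition lagrange_form ::
  "('n::finite \<Rightarrow> real) \<Rightarrow> real \<Rightarrow> ('n \<Rightarrow> real) \<Rightarrow> 'n config \<Rightarrow> 'n config \<Rightarrow> 'n config \<Rightarrow> real" where
  "lagrange_form m \<mu> \<sigma> q \<xi> \<eta> = (\<Sum>i\<in>UNIV. mink (\<eta>$i) (residual_deriv m \<mu> \<sigma> q \<xi> i))"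

lemma weight_slope_sym: "weight_slope m q i j = weight_slope m q j i"
  by (simp add: weight_slope_def mink_sym mult_ac)

lemma linear_planar: "linear planar"
  using bounded_linear_planar by (simp add: linear_conv_bounded_linear)

lemma linear_residual_deriv: "linear (\<lambda>\<xi>. residual_deriv m \<mu> \<sigma> q \<xi> i)"
proof -
  have 1: "linear (\<lambda>\<xi>. pair_weight m q i j *\<^sub>R \<xi>$j
        + (weight_slope m q i j * (mink (q$i) (\<xi>$j) + mink (\<xi>$i) (q$j))) *\<^sub>R q$j)" for j
    by (rule linearI) (simp_all add: mink_simps algebra_simps)
  have 2: "linear (\<lambda>\<xi>. (2 * \<mu> * m i) *\<^sub>R planar (\<xi>$i))"
    by (rule linearI) (simp_all add: linear_add[OF linear_planar] linear_cmul[OF linear_planar] algebra_simps)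
  have 3: "linear (\<lambda>\<xi>. (2 * \<sigma> i) *\<^sub>R \<xi>$i)"
    by (rule linearI) (simp_all add: algebra_simps)
  show ?thesis unfolding residual_deriv_def
    by (intro linear_compose_sub linear_compose_sum ballI 1 2 3)
qed

lemma bilinear_lagrange_form: "bilinear (lagrange_form m \<mu> \<sigma> q)"
  unfolding bilinear_def
proof (intro conjI allI)
  show "linear (\<lambda>\<eta>. lagrange_form m \<mu> \<sigma> q \<xi> \<eta>)" for \<xi>
    unfolding lagrange_form_def
    by (intro linear_compose_sum ballI) (rule linearI, simp_all add: mink_simps)
  show "linear (\<lambda>\<xi>. lagrange_form m \<mu> \<sigma> q \<xi> \<eta>)" for \<eta>
    unfolding lagrange_form_def
    by (intro linear_compose_sum ballI)
      (rule linearI, simp_all add: mink_simps linear_add[OF linear_residual_deriv] linear_cmul[OF linear_residual_deriv])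
qed

lemma lagrange_form_sym: "lagrange_form m \<mu> \<sigma> q \<xi> \<eta> = lagrange_form m \<mu> \<sigma> q \<eta> \<xi>"
proof -
  let ?k = "pair_weight m q" and ?k' = "weight_slope m q"
  define a where "a \<xi> i j = mink (q$i) (\<xi>$j) + mink (\<xi>$i) (q$j)" for \<xi> :: "'a config" and i j
  have a_sym: "a \<xi> i j = a \<xi> j i" for \<xi> i j by (simp add: a_def mink_sym add.commute)
  have form: "lagrange_form m \<mu> \<sigma> q \<xi> \<eta> = (\<Sum>i\<in>UNIV. \<Sum>j\<in>UNIV. ?k i j * mink (\<eta>$i) (\<xi>$j))
      + (\<Sum>i\<in>UNIV. \<Sum>j\<in>UNIV. ?k' i j * a \<xi> i j * a \<eta> i j) / 2
      - (\<Sum>i\<in>UNIV. 2 * \<mu> * m i * mink (\<eta>$i) (planar (\<xi>$i)) + 2 * \<sigma> i * mink (\<eta>$i) (\<xi>$i))" for \<xi> \<eta>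
  proof -
    have "(\<Sum>i\<in>UNIV. \<Sum>j\<in>UNIV. ?k' i j * a \<xi> i j * mink (q$i) (\<eta>$j))
        = (\<Sum>i\<in>UNIV. \<Sum>j\<in>UNIV. ?k' j i * a \<xi> j i * mink (q$j) (\<eta>$i))" by (rule sum.swap)
    also have "\<dots> = (\<Sum>i\<in>UNIV. \<Sum>j\<in>UNIV. ?k' i j * a \<xi> i j * mink (\<eta>$i) (q$j))"
      by (intro sum.cong refl) (simp only: weight_slope_sym[of m q] a_sym mink_sym)
    finally have "(\<Sum>i\<in>UNIV. \<Sum>j\<in>UNIV. ?k' i j * a \<xi> i j * a \<eta> i j)
        = 2 * (\<Sum>i\<in>UNIV. \<Sum>j\<in>UNIV. ?k' i j * a \<xi> i j * mink (\<eta>$i) (q$j))"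
      unfolding a_def[of \<eta>] by (simp only: distrib_left sum.distrib)
    moreover have "lagrange_form m \<mu> \<sigma> q \<xi> \<eta> = (\<Sum>i\<in>UNIV. \<Sum>j\<in>UNIV. ?k i j * mink (\<eta>$i) (\<xi>$j))
      + (\<Sum>i\<in>UNIV. \<Sum>j\<in>UNIV. ?k' i j * a \<xi> i j * mink (\<eta>$i) (q$j))
      - (\<Sum>i\<in>UNIV. 2 * \<mu> * m i * mink (\<eta>$i) (planar (\<xi>$i)) + 2 * \<sigma> i * mink (\<eta>$i) (\<xi>$i))"
      unfolding lagrange_form_def residual_deriv_def a_def[symmetric] sum.distrib[symmetric] sum_subtractf[symmetric]
      by (intro sum.cong refl) (simp add: mink_simps sum.distrib)
    ultimately show ?thesis by simp
  qed
  have "(\<Sum>i\<in>UNIV. \<Sum>j\<in>UNIV. ?k i j * mink (\<eta>$i) (\<xi>$j)) = (\<Sum>i\<in>UNIV. \<Sum>j\<in>UNIV. ?k j i * mink (\<eta>$j) (\<xi>$i))"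
    by (rule sum.swap)
  also have "\<dots> = (\<Sum>i\<in>UNIV. \<Sum>j\<in>UNIV. ?k i j * mink (\<xi>$i) (\<eta>$j))"
    by (intro sum.cong refl) (simp only: pair_weight_sym[of m q] mink_sym)
  finally have 1: "(\<Sum>i\<in>UNIV. \<Sum>j\<in>UNIV. ?k i j * mink (\<eta>$i) (\<xi>$j)) = (\<Sum>i\<in>UNIV. \<Sum>j\<in>UNIV. ?k i j * mink (\<xi>$i) (\<eta>$j))" .
  have 2: "mink (\<eta>$i) (planar (\<xi>$i)) = mink (\<xi>$i) (planar (\<eta>$i))" for i by (simp add: mink_planar)
  show ?thesis unfolding form 1 2
    by (simp add: mink_sym[of "\<eta>$_" "\<xi>$_"] mult.assoc mult.left_commute[of "a \<xi> _ _"] mult.commute[of "a \<xi> _ _"])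
qed

lemma residual_along_curve:
  assumes \<gamma>: "(\<gamma> has_vector_derivative \<xi>) (at (0::real))" and sep: "separated (\<gamma> 0)"
  shows "((\<lambda>s. lagrange_residual m \<mu> \<sigma> (\<gamma> s) i) has_vector_derivative residual_deriv m \<mu> \<sigma> (\<gamma> 0) \<xi> i) (at 0)"
proof -
  have nth: "((\<lambda>s. \<gamma> s $ j) has_vector_derivative \<xi>$j) (at 0)" for j
    by (rule bounded_linear.has_vector_derivative[OF bounded_linear_vec_nth \<gamma>])
  have w: "((\<lambda>s. pair_weight m (\<gamma> s) i j) has_real_derivative
      weight_slope m (\<gamma> 0) i j * (mink (\<gamma> 0 $ i) (\<xi>$j) + mink (\<xi>$i) (\<gamma> 0 $ j))) (at 0)" for j
  proof (cases "i = j")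
    case False
    then have z: "- mink (\<gamma> 0 $ i) (\<gamma> 0 $ j) > 1" using sep by (simp add: separated_def)
    have "((\<lambda>s. mink (\<gamma> s $ i) (\<gamma> s $ j)) has_vector_derivative mink (\<gamma> 0 $ i) (\<xi>$j) + mink (\<xi>$i) (\<gamma> 0 $ j)) (at 0)"
      by (rule bounded_bilinear.has_vector_derivative[OF bounded_bilinear_mink nth nth])
    then have "((\<lambda>s. - mink (\<gamma> s $ i) (\<gamma> s $ j)) has_real_derivative - (mink (\<gamma> 0 $ i) (\<xi>$j) + mink (\<xi>$i) (\<gamma> 0 $ j))) (at 0)"
      by (intro DERIV_minus) (simp add: has_real_derivative_iff_has_vector_derivative)
    from DERIV_chain2[where f = hyp_grav and g = "\<lambda>s. - mink (\<gamma> s $ i) (\<gamma> s $ j)", OF DERIV_hyp_grav[OF z] this]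
    have "((\<lambda>s. m i * m j * hyp_grav (- mink (\<gamma> s $ i) (\<gamma> s $ j))) has_real_derivative
      m i * m j * (- (3 * - mink (\<gamma> 0 $ i) (\<gamma> 0 $ j) / sqrt ((- mink (\<gamma> 0 $ i) (\<gamma> 0 $ j))\<^sup>2 - 1) ^ 5) *
      - (mink (\<gamma> 0 $ i) (\<xi>$j) + mink (\<xi>$i) (\<gamma> 0 $ j)))) (at 0)"
      by (rule DERIV_cmult)
    then have "((\<lambda>s. m i * m j * hyp_grav (- mink (\<gamma> s $ i) (\<gamma> s $ j))) has_real_derivative
      weight_slope m (\<gamma> 0) i j * (mink (\<gamma> 0 $ i) (\<xi>$j) + mink (\<xi>$i) (\<gamma> 0 $ j))) (at 0)"
      by (rule DERIV_cong) (simp only: weight_slope_def False if_False mult_minus_left mult_minus_right minus_minus mult.assoc)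
    then show ?thesis using False by (simp add: pair_weight_def)
  qed (simp add: pair_weight_def weight_slope_def)
  have "((\<lambda>s. \<Sum>j\<in>UNIV. pair_weight m (\<gamma> s) i j *\<^sub>R \<gamma> s $ j) has_vector_derivative
      (\<Sum>j\<in>UNIV. pair_weight m (\<gamma> 0) i j *\<^sub>R \<xi>$j
        + (weight_slope m (\<gamma> 0) i j * (mink (\<gamma> 0 $ i) (\<xi>$j) + mink (\<xi>$i) (\<gamma> 0 $ j))) *\<^sub>R \<gamma> 0 $ j)) (at 0)"
    by (intro has_vector_derivative_sum has_vector_derivative_scaleR w nth)
  moreover have "((\<lambda>s. (2 * \<mu> * m i) *\<^sub>R planar (\<gamma> s $ i)) has_vector_derivative (2 * \<mu> * m i) *\<^sub>R planar (\<xi>$i)) (at 0)"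
    by (intro bounded_linear.has_vector_derivative[OF bounded_linear_scaleR_right]
        bounded_linear.has_vector_derivative[OF bounded_linear_planar] nth)
  moreover have "((\<lambda>s. (2 * \<sigma> i) *\<^sub>R \<gamma> s $ i) has_vector_derivative (2 * \<sigma> i) *\<^sub>R \<xi>$i) (at 0)"
    by (intro bounded_linear.has_vector_derivative[OF bounded_linear_scaleR_right] nth)
  ultimately show ?thesis
    unfolding lagrange_residual_def residual_deriv_def force_def
    by (intro has_vector_derivative_diff)
qed

text \<open>At a zero of one factor, the product rule only needs continuity of the other one.\<close>

lemma DERIV_mult_vanishing:
  fixes f g :: "real \<Rightarrow> real"
  assumes f: "isCont f 0" and g: "(g has_real_derivative g') (at 0)" and g0: "g 0 = 0"
  shows "((\<lambda>s. f s * g s) has_real_derivative f 0 * g') (at 0)"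
proof -
  have "((\<lambda>h. g h / h) \<longlongrightarrow> g') (at 0)"
    using g g0 by (simp add: has_field_derivative_iff)
  then have "((\<lambda>h. f h * (g h / h)) \<longlongrightarrow> f 0 * g') (at 0)"
    using f by (intro tendsto_mult) (auto simp: isCont_def)
  then show ?thesis by (simp add: has_field_derivative_iff g0)
qed

lemma DERIV_mink_vanishing:
  fixes f g :: "real \<Rightarrow> real^3"
  assumes f: "isCont f 0" and g: "(g has_vector_derivative g') (at 0)" and g0: "g 0 = 0"
  shows "((\<lambda>s. mink (f s) (g s)) has_real_derivative mink (f 0) g') (at 0)"
proof -
  have "((\<lambda>s. f s $ k * g s $ k) has_real_derivative f 0 $ k * g' $ k) (at 0)" for k
  proof (rule DERIV_mult_vanishing)
    show "isCont (\<lambda>s. f s $ k) 0" using f by (intro continuous_intros)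
    show "((\<lambda>s. g s $ k) has_real_derivative g' $ k) (at 0)"
      using bounded_linear.has_vector_derivative[OF bounded_linear_vec_nth g, of k]
      by (simp add: has_real_derivative_iff_has_vector_derivative)
  qed (simp add: g0)
  then show ?thesis unfolding mink_def by (intro DERIV_diff DERIV_add)
qed

lemma eventually_line_mem:
  fixes u :: "'a::real_normed_vector"
  assumes V: "open V" "u \<in> V" and E: "subspace E" "u \<in> E" "v \<in> E"
  shows "\<forall>\<^sub>F s in nhds (0::real). u + s *\<^sub>R v \<in> V \<inter> E"
proof -
  have "isCont (\<lambda>s. u + s *\<^sub>R v) 0" by (intro continuous_intros)
  then have "((\<lambda>s. u + s *\<^sub>R v) \<longlongrightarrow> u + 0 *\<^sub>R v) (nhds 0)"
    unfolding isCont_def by (rule tendsto_at_iff_tendsto_nhds[THEN iffD1])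
  then have "\<forall>\<^sub>F s in nhds 0. u + s *\<^sub>R v \<in> V"
    by (rule topological_tendstoD) (use V in auto)
  then show ?thesis
    by (rule eventually_mono) (use E in \<open>auto intro: subspace_add subspace_scale\<close>)
qed

lemma has_vector_derivative_along_line:
  assumes "(\<phi> has_derivative A) (at u)"
  shows "((\<lambda>s. \<phi> (u + s *\<^sub>R v)) has_vector_derivative A v) (at (0::real))"
proof -
  have "((\<lambda>s. u + s *\<^sub>R v) has_derivative (\<lambda>h. h *\<^sub>R v)) (at 0)"
    by (auto intro!: derivative_eq_intros)
  from has_derivative_compose[OF this, of \<phi> A] assms
  have "((\<lambda>s. \<phi> (u + s *\<^sub>R v)) has_derivative (\<lambda>h. A (h *\<^sub>R v))) (at 0)" by simp
  then show ?thesis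
    unfolding has_vector_derivative_def
    by (simp add: linear_cmul[OF has_derivative_linear[OF assms]])
qed

text \<open>On the range of the parametrization the potential and the Lagrangian differ by the constant
  \<open>\<mu> * c\<close>. The first derivative of the Lagrangian pairs \<open>A x w\<close> with the residual. The residual
  vanishes at \<open>\<phi> u\<close>, so in the second derivative the factor \<open>A x w\<close> need not be differentiated.\<close>

lemma hessian_form_lagrange:
  fixes \<phi> :: "'n::{finite,linorder} config \<Rightarrow> 'n config"
  assumes E: "subspace E" and V: "open V" and u: "u \<in> V \<inter> E" and vw: "v \<in> E" "w \<in> E"
    and A: "\<And>x. x \<in> V \<Longrightarrow> (\<phi> has_derivative A x) (at x)"
    and Ac: "\<And>w. continuous_on V (\<lambda>x. A x w)"
    and lev: "\<phi> ` (V \<inter> E) \<subseteq> level_set m c"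
    and res: "\<And>i. lagrange_residual m \<mu> \<sigma> (\<phi> u) i = 0"
  shows "hessian_form (\<lambda>x. induced_fun (potential m) (orbit (\<phi> x))) u v w
       = lagrange_form m \<mu> \<sigma> (\<phi> u) (A u v) (A u w)"
proof -
  define L where "L x = lagrangian m \<mu> \<sigma> (\<phi> x) + \<mu> * c" for x
  define h where "h x = (\<Sum>i\<in>UNIV. mink (A x w $ i) (lagrange_residual m \<mu> \<sigma> (\<phi> x) i))" for x
  have cs: "\<phi> x \<in> config_space" if "x \<in> V \<inter> E" for x using lev that by (auto simp: level_set_def)
  have gL: "potential m (\<phi> x) = L x" if "x \<in> V \<inter> E" for x
    using lev that lagrangian_on_config_space[OF cs[OF that], of m \<mu> \<sigma>] by (auto simp: L_def level_set_def)
  have inner: "deriv (\<lambda>t. potential m (\<phi> (x + t *\<^sub>R w))) 0 = h x" if x: "x \<in> V \<inter> E" for x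
  proof -
    have xV: "x \<in> V" "x \<in> E" using x by auto
    have "((\<lambda>t. \<phi> (x + t *\<^sub>R w)) has_derivative (\<lambda>h. h *\<^sub>R A x w)) (at 0)"
      using has_vector_derivative_along_line[OF A[OF xV(1)]] by (simp add: has_vector_derivative_def)
    moreover have "(lagrangian m \<mu> \<sigma> has_derivative
        (\<lambda>\<xi>. \<Sum>i\<in>UNIV. mink (\<xi>$i) (lagrange_residual m \<mu> \<sigma> (\<phi> x) i))) (at (\<phi> (x + 0 *\<^sub>R w)))"
      using has_derivative_lagrangian[OF separated_config_space[OF cs[OF x]]] by simp
    ultimately have "((\<lambda>t. lagrangian m \<mu> \<sigma> (\<phi> (x + t *\<^sub>R w))) has_derivative
        (\<lambda>h. \<Sum>i\<in>UNIV. mink ((h *\<^sub>R A x w)$i) (lagrange_residual m \<mu> \<sigma> (\<phi> x) i))) (at 0)"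
      by (rule has_derivative_compose)
    then have "((\<lambda>t. lagrangian m \<mu> \<sigma> (\<phi> (x + t *\<^sub>R w))) has_real_derivative h x) (at 0)"
      unfolding has_field_derivative_def h_def
      by (rule has_derivative_eq_rhs) (simp add: fun_eq_iff mink_scale_left sum_distrib_left mult.commute)
    from DERIV_add[OF this DERIV_const[of "\<mu> * c"]]
    have "((\<lambda>t. L (x + t *\<^sub>R w)) has_real_derivative h x) (at 0)" by (simp add: L_def)
    then have "deriv (\<lambda>t. L (x + t *\<^sub>R w)) 0 = h x" by (rule DERIV_imp_deriv)
    moreover have "\<forall>\<^sub>F t in nhds 0. potential m (\<phi> (x + t *\<^sub>R w)) = L (x + t *\<^sub>R w)"
      using eventually_line_mem[OF V xV(1) E xV(2) vw(2)] by (rule eventually_mono) (rule gL)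
    then have "deriv (\<lambda>t. potential m (\<phi> (x + t *\<^sub>R w))) 0 = deriv (\<lambda>t. L (x + t *\<^sub>R w)) 0"
      by (rule deriv_cong_ev) simp
    ultimately show ?thesis by simp
  qed
  have uV: "u \<in> V" "u \<in> E" using u by auto
  have \<gamma>': "((\<lambda>s. \<phi> (u + s *\<^sub>R v)) has_vector_derivative A u v) (at 0)"
    by (rule has_vector_derivative_along_line[OF A[OF uV(1)]])
  have sep: "separated (\<phi> (u + 0 *\<^sub>R v))" using separated_config_space[OF cs[OF u]] by simp
  have cont: "isCont (\<lambda>s. A (u + s *\<^sub>R v) w $ i) 0" for i
  proof -
    have "isCont (\<lambda>x. A x w) (u + 0 *\<^sub>R v)"
      using Ac[of w] V uV(1) by (simp add: continuous_on_eq_continuous_at)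
    moreover have "isCont (\<lambda>s. u + s *\<^sub>R v) 0" by (intro continuous_intros)
    ultimately have "isCont (\<lambda>s. A (u + s *\<^sub>R v) w) 0" by (rule isCont_o2[rotated])
    then show ?thesis by (intro continuous_intros)
  qed
  have "((\<lambda>s. mink (A (u + s *\<^sub>R v) w $ i) (lagrange_residual m \<mu> \<sigma> (\<phi> (u + s *\<^sub>R v)) i))
      has_real_derivative mink (A (u + 0 *\<^sub>R v) w $ i) (residual_deriv m \<mu> \<sigma> (\<phi> (u + 0 *\<^sub>R v)) (A u v) i)) (at 0)" for i
    by (rule DERIV_mink_vanishing[OF cont residual_along_curve[OF \<gamma>' sep]]) (simp add: res)
  then have "((\<lambda>s. h (u + s *\<^sub>R v)) has_real_derivative
      (\<Sum>i\<in>UNIV. mink (A (u + 0 *\<^sub>R v) w $ i) (residual_deriv m \<mu> \<sigma> (\<phi> (u + 0 *\<^sub>R v)) (A u v) i))) (at 0)"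
    unfolding h_def by (intro DERIV_sum)
  then have "deriv (\<lambda>s. h (u + s *\<^sub>R v)) 0 = lagrange_form m \<mu> \<sigma> (\<phi> u) (A u v) (A u w)"
    by (simp add: DERIV_imp_deriv lagrange_form_def)
  moreover have "\<forall>\<^sub>F s in nhds 0. deriv (\<lambda>t. potential m (\<phi> (u + s *\<^sub>R v + t *\<^sub>R w))) 0 = h (u + s *\<^sub>R v)"
    using eventually_line_mem[OF V uV(1) E uV(2) vw(1)] by (rule eventually_mono) (rule inner)
  then have "deriv (\<lambda>s. deriv (\<lambda>t. potential m (\<phi> (u + s *\<^sub>R v + t *\<^sub>R w))) 0) 0 = deriv (\<lambda>s. h (u + s *\<^sub>R v)) 0"
    by (rule deriv_cong_ev) simp
  ultimately show ?thesis by (simp add: hessian_form_def induced_potential)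
qed

lemma tangent_to_level_set:
  fixes \<phi> :: "'n::{finite,linorder} config \<Rightarrow> 'n config"
  assumes E: "subspace E" and V: "open V" and u: "u \<in> V \<inter> E" and v: "v \<in> E"
    and A: "(\<phi> has_derivative A) (at u)"
    and lev: "\<phi> ` (V \<inter> E) \<subseteq> level_set m c"
  shows "mink (\<phi> u $ i) (A v $ i) = 0"
    and "(\<Sum>i\<in>UNIV. m i * mink (A v $ i) (planar (\<phi> u $ i))) = 0"
proof -
  have uV: "u \<in> V" "u \<in> E" using u by auto
  let ?\<gamma> = "\<lambda>s. \<phi> (u + s *\<^sub>R v)"
  have \<gamma>: "(?\<gamma> has_vector_derivative A v) (at (0::real))" by (rule has_vector_derivative_along_line[OF A])
  have ev: "\<forall>\<^sub>F s in nhds (0::real). ?\<gamma> s \<in> level_set m c"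
    using eventually_line_mem[OF V uV(1) E uV(2) v] by (rule eventually_mono) (use lev in auto)
  have *: "D (A v) = 0"
    if F: "\<And>q. q \<in> level_set m c \<Longrightarrow> F q = k" and D: "(F has_derivative D) (at (\<phi> u))" for F :: "'n config \<Rightarrow> real" and k D
  proof (rule zero_derivative_along_curve[OF _ _ \<gamma> ev])
    have "\<phi> u \<in> level_set m c" using lev u by auto
    then have "((\<lambda>_. k) has_derivative (\<lambda>_. 0)) (at (\<phi> u) within level_set m c) \<Longrightarrow>
      (F has_derivative (\<lambda>_. 0)) (at (\<phi> u) within level_set m c)"
      by (rule has_derivative_transform) (rule F)
    then show "(F has_derivative (\<lambda>_. 0)) (at (\<phi> (u + 0 *\<^sub>R v)) within level_set m c)" by simp
    show "(F has_derivative D) (at (\<phi> (u + 0 *\<^sub>R v)))" using D by simp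
  qed
  have "mink (\<phi> u $ i) (A v $ i) + mink (A v $ i) (\<phi> u $ i) = 0"
    by (rule *[where k = "- 1", OF _ has_derivative_mink_config]) (auto simp: level_set_def config_space_iff hyp2_def)
  then show "mink (\<phi> u $ i) (A v $ i) = 0" by (simp add: mink_sym)
  have "(\<Sum>i\<in>UNIV. mink (A v $ i) ((2 * m i) *\<^sub>R planar (\<phi> u $ i))) = 0"
    by (rule *[where k = c, OF _ has_derivative_inertia_moment]) (auto simp: level_set_def)
  then have "2 * (\<Sum>i\<in>UNIV. m i * mink (A v $ i) (planar (\<phi> u $ i))) = 0"
    by (simp add: mink_simps sum_distrib_left mult.assoc)
  then show "(\<Sum>i\<in>UNIV. m i * mink (A v $ i) (planar (\<phi> u $ i))) = 0" by simp
qed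

section \<open>The second variation at a configuration on the line\<close>

text \<open>The tangent vectors at a configuration on the line, split into displacements \<open>a\<close> along the line and
  \<open>b\<close> across it.\<close>

definition line_tangent :: "('n::finite \<Rightarrow> real) \<Rightarrow> (real,'n) vec \<times> (real,'n) vec \<Rightarrow> 'n config" where
  "line_tangent \<theta> = (\<lambda>(a,b). \<chi> i. vector [a$i * cosh (\<theta> i), b$i, a$i * sinh (\<theta> i)])"

lemma line_tangent_nth [simp]:
  "line_tangent \<theta> (a,b) $ i $ 1 = a$i * cosh (\<theta> i)"
  "line_tangent \<theta> (a,b) $ i $ 2 = b$i"
  "line_tangent \<theta> (a,b) $ i $ 3 = a$i * sinh (\<theta> i)"
  by (simp_all add: line_tangent_def)

lemma config_eq_iff: "(p :: 'n::finite config) = q \<longleftrightarrow> (\<forall>i. p$i$1 = q$i$1 \<and> p$i$2 = q$i$2 \<and> p$i$3 = q$i$3)"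
  by (simp add: vec_eq_iff forall_3)

lemma linear_line_tangent: "linear (line_tangent \<theta>)"
proof (rule linearI)
  show "line_tangent \<theta> (x + y) = line_tangent \<theta> x + line_tangent \<theta> y" for x y
    by (cases x; cases y) (simp add: config_eq_iff algebra_simps)
  show "line_tangent \<theta> (r *\<^sub>R x) = r *\<^sub>R line_tangent \<theta> x" for r x
    by (cases x) (simp add: config_eq_iff)
qed

lemma inj_line_tangent: "inj (line_tangent \<theta>)"
proof (rule injI)
  fix x y assume *: "line_tangent \<theta> x = line_tangent \<theta> y"
  obtain a b a' b' where xy: "x = (a,b)" "y = (a',b')" by (cases x; cases y)
  have "a$i * cosh (\<theta> i) = a'$i * cosh (\<theta> i)" "b$i = b'$i" for i
    using * unfolding xy config_eq_iff by auto
  then have "a = a'" "b = b'" by (simp_all add: vec_eq_iff)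
  then show "x = y" by (simp add: xy)
qed

text \<open>The normal component \<open>2 * \<sigma> i\<close> of the force has two expressions, by pairing the force equation with
  the position and by reading off its third component. The first one is used in the terms in \<open>a\<close>,
  where it makes all coefficients nonnegative, since \<open>\<mu>\<close> is negative for central configurations. The
  second one turns the terms in \<open>b\<close> into a Dirichlet form for \<open>\<beta>\<close>.\<close>

lemma lagrange_form_line:
  fixes \<theta> :: "'n::{finite,linorder} \<Rightarrow> real"
  assumes res: "\<And>i. lagrange_residual m \<mu> \<sigma> (line_config \<theta>) i = 0" and inj: "inj \<theta>"
  defines "k \<equiv> pair_weight m (line_config \<theta>)"
  defines "\<beta> \<equiv> \<lambda>b i. b$i / cosh (\<theta> i)"
  shows "lagrange_form m \<mu> \<sigma> (line_config \<theta>) (line_tangent \<theta> (a,b)) (line_tangent \<theta> (a,b))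
    = (\<Sum>i\<in>UNIV. \<Sum>j\<in>UNIV. k i j * cosh (\<theta> i - \<theta> j) * (a$i - a$j)\<^sup>2)
      - 2 * \<mu> * (\<Sum>i\<in>UNIV. m i * ((cosh (\<theta> i))\<^sup>2 + (sinh (\<theta> i))\<^sup>2) * (a$i)\<^sup>2)
      + (\<Sum>i\<in>UNIV. \<beta> b i * ((- 2 * \<mu>) * (m i * (cosh (\<theta> i))\<^sup>2) * \<beta> b i
           - (\<Sum>j\<in>UNIV. k i j * cosh (\<theta> i) * cosh (\<theta> j) * (\<beta> b i - \<beta> b j))))"
proof -
  let ?q = "line_config \<theta>" and ?\<xi> = "line_tangent \<theta> (a,b)"
  define C where "C i j = cosh (\<theta> i - \<theta> j)" for i j
  define S where "S i j = sinh (\<theta> i - \<theta> j)" for i j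
  define c where "c i = cosh (\<theta> i)" for i
  define s where "s i = sinh (\<theta> i)" for i
  define k' where "k' = weight_slope m ?q"
  have cpos: "c i > 0" for i by (simp add: c_def)
  have CS: "C i j = c i * c j - s i * s j" "S i j = s i * c j - c i * s j" for i j
    by (simp_all add: C_def S_def c_def s_def cosh_diff sinh_diff)
  have c2: "c i * c i = s i * s i + 1" for i
    using cosh_square_eq[of "\<theta> i"] by (simp add: c_def s_def power2_eq_square)
  have M1: "mink (?\<xi>$i) (?\<xi>$j) = a$i * a$j * C i j + b$i * b$j" for i j
    unfolding CS by (simp add: mink_def c_def s_def algebra_simps)
  have M2: "mink (?q$i) (?\<xi>$j) = a$j * S i j" for i j
    unfolding CS by (simp add: mink_def c_def s_def algebra_simps)
  have M3: "mink (?\<xi>$i) (?q$j) = - (a$i * S i j)" for i j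
    unfolding CS by (simp add: mink_def c_def s_def algebra_simps)
  have M4: "mink (?\<xi>$i) (planar (?\<xi>$i)) = (a$i)\<^sup>2 * (c i)\<^sup>2 + (b$i)\<^sup>2" for i
    by (simp add: mink_planar c_def power2_eq_square)
  have Cii: "C i i = 1" for i by (simp add: C_def)
  have slope: "k' i j * (S i j)\<^sup>2 = 3 * C i j * k i j" for i j
  proof (cases "i = j")
    case False
    then have "\<theta> i \<noteq> \<theta> j" using inj by (simp add: inj_eq)
    then have S0: "\<bar>S i j\<bar> > 0" by (simp add: S_def)
    have 1: "k' i j = m i * m j * (3 * C i j / \<bar>S i j\<bar> ^ 5)"
      using False by (simp add: k'_def weight_slope_def mink_line sqrt_cosh_square C_def S_def)
    have 2: "k i j = m i * m j * (1 / \<bar>S i j\<bar> ^ 3)"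
      using False by (simp add: k_def pair_weight_line hyp_grav_cosh S_def)
    have 3: "1 / \<bar>S i j\<bar> ^ 5 * (S i j)\<^sup>2 = 1 / \<bar>S i j\<bar> ^ 3"
    proof -
      have "\<bar>S i j\<bar> ^ 5 = \<bar>S i j\<bar> ^ 3 * (S i j)\<^sup>2"
        using power_add[of "\<bar>S i j\<bar>" 3 2] by simp
      then show ?thesis using S0 by simp
    qed
    have "k' i j * (S i j)\<^sup>2 = m i * m j * (3 * C i j) * (1 / \<bar>S i j\<bar> ^ 5 * (S i j)\<^sup>2)"
      unfolding 1 by simp
    then show ?thesis unfolding 3 2 by simp
  qed (simp add: k'_def k_def weight_slope_def pair_weight_def)
  have F: "force m ?q i = (2 * \<mu> * m i) *\<^sub>R planar (?q$i) + (2 * \<sigma> i) *\<^sub>R ?q$i" for i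
    using res[of i] unfolding lagrange_residual_def diff_diff_eq right_minus_eq by blast
  have R1: "2 * \<sigma> i = (\<Sum>j\<in>UNIV. k i j * C i j) + 2 * \<mu> * m i * (s i)\<^sup>2" for i
  proof -
    have "mink (?q$i) (force m ?q i) = - (\<Sum>j\<in>UNIV. k i j * C i j)"
      by (simp add: force_def mink_simps mink_line k_def C_def sum_negf)
    moreover have "mink (?q$i) (planar (?q$i)) = (s i)\<^sup>2" by (simp add: mink_planar s_def power2_eq_square)
    ultimately show ?thesis unfolding F by (simp add: mink_simps mink_line)
  qed
  have R2: "2 * \<sigma> i * c i = (\<Sum>j\<in>UNIV. k i j * c j)" for i
  proof -
    have "force m ?q i $ 3 = (\<Sum>j\<in>UNIV. k i j * c j)" by (simp add: force_def k_def c_def)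
    then show ?thesis unfolding F by (simp add: c_def)
  qed
  have row: "mink (?\<xi>$i) (residual_deriv m \<mu> \<sigma> ?q ?\<xi> i)
      = 2 * (\<Sum>j\<in>UNIV. k i j * C i j * (a$i - a$j) * a$i) - 2 * \<mu> * (m i * ((c i)\<^sup>2 + (s i)\<^sup>2) * (a$i)\<^sup>2)
        + \<beta> b i * ((- 2 * \<mu>) * (m i * (c i)\<^sup>2) * \<beta> b i
           - (\<Sum>j\<in>UNIV. k i j * c i * c j * (\<beta> b i - \<beta> b j)))" for i
  proof -
    have b: "b$i = c i * \<beta> b i" for i using cpos[of i] by (simp add: \<beta>_def c_def)
    have "mink (?\<xi>$i) (residual_deriv m \<mu> \<sigma> ?q ?\<xi> i)
      = (\<Sum>j\<in>UNIV. k i j * (a$i * a$j * C i j + b$i * b$j) + k' i j * (a$j * S i j - a$i * S i j) * (- (a$i * S i j)))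
        - 2 * \<mu> * m i * ((a$i)\<^sup>2 * (c i)\<^sup>2 + (b$i)\<^sup>2) - 2 * \<sigma> i * ((a$i)\<^sup>2 + (b$i)\<^sup>2)"
      unfolding residual_deriv_def k_def[symmetric] k'_def[symmetric]
      by (simp only: mink_simps M1 M2 M3 M4) (simp only: diff_conv_add_uminus Cii mult_1_right power2_eq_square)
    also have "(\<Sum>j\<in>UNIV. k i j * (a$i * a$j * C i j + b$i * b$j) + k' i j * (a$j * S i j - a$i * S i j) * (- (a$i * S i j)))
      = (\<Sum>j\<in>UNIV. 2 * (k i j * C i j * (a$i - a$j) * a$i) + k i j * C i j * (a$i)\<^sup>2 + k i j * b$i * b$j)"
    proof (rule sum.cong[OF refl])
      fix j
      have "k' i j * (a$j * S i j - a$i * S i j) * (- (a$i * S i j)) = (k' i j * (S i j)\<^sup>2) * (a$i - a$j) * a$i"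
        by (simp add: power2_eq_square algebra_simps)
      then show "k i j * (a$i * a$j * C i j + b$i * b$j) + k' i j * (a$j * S i j - a$i * S i j) * (- (a$i * S i j))
        = 2 * (k i j * C i j * (a$i - a$j) * a$i) + k i j * C i j * (a$i)\<^sup>2 + k i j * b$i * b$j"
        unfolding slope by (simp add: power2_eq_square algebra_simps)
    qed
    also have "\<dots> = 2 * (\<Sum>j\<in>UNIV. k i j * C i j * (a$i - a$j) * a$i)
        + (\<Sum>j\<in>UNIV. k i j * C i j) * (a$i)\<^sup>2 + (\<Sum>j\<in>UNIV. k i j * b$i * b$j)"
      by (simp add: sum.distrib sum_distrib_left sum_distrib_right)
    also have "(\<Sum>j\<in>UNIV. k i j * C i j) = 2 * \<sigma> i - 2 * \<mu> * m i * (s i)\<^sup>2" unfolding R1 by simp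
    also have "(\<Sum>j\<in>UNIV. k i j * b$i * b$j)
        = (\<Sum>j\<in>UNIV. k i j * c j) * (c i * (\<beta> b i)\<^sup>2) - \<beta> b i * (\<Sum>j\<in>UNIV. k i j * c i * c j * (\<beta> b i - \<beta> b j))"
      unfolding b sum_distrib_left sum_distrib_right sum_subtractf[symmetric]
      by (rule sum.cong) (auto simp: power2_eq_square algebra_simps)
    also have "(\<Sum>j\<in>UNIV. k i j * c j) = 2 * \<sigma> i * c i" unfolding R2 ..
    finally show ?thesis unfolding b by (simp add: power2_eq_square algebra_simps)
  qed
  have anti: "2 * (\<Sum>i\<in>UNIV. \<Sum>j\<in>UNIV. k i j * C i j * (a$i - a$j) * a$i)
      = (\<Sum>i\<in>UNIV. \<Sum>j\<in>UNIV. k i j * C i j * (a$i - a$j) * (a$i - a$j))"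
  proof (rule sum_antisymmetric[symmetric])
    have "C j i = C i j" for i j unfolding CS by (simp add: mult.commute)
    then show "k j i * C j i * (a$j - a$i) = - (k i j * C i j * (a$i - a$j))" for i j
      unfolding k_def by (simp add: pair_weight_sym[of m ?q j i] algebra_simps)
  qed
  show ?thesis
    unfolding lagrange_form_def row sum.distrib sum_subtractf sum_distrib_left[symmetric] anti
    unfolding C_def c_def s_def power2_eq_square by (simp add: mult.assoc)
qed

text \<open>The product \<open>cosh t * sinh (z - t)\<close> equals \<open>(sinh z + sinh (z - 2 * t)) / 2\<close> and decreases in \<open>t\<close>;
  so do the remaining two factors \<open>sinh (z - t)\<close>.\<close>

lemma cosh_sinh_cube_decreasing:
  fixes x y z :: real
  assumes "x < y" "y < z"
  shows "cosh y * \<bar>sinh (y - z)\<bar> ^ 3 < cosh x * \<bar>sinh (x - z)\<bar> ^ 3"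
proof -
  define P R where "P = sinh (z - y)" and "R = sinh (z - x)"
  have P: "P > 0" "P < R" using assms by (simp_all add: P_def R_def)
  have half: "2 * (cosh t * sinh (z - t)) = sinh z + sinh (z - 2 * t)" for t
    using sinh_add[of "z - t" t] sinh_diff[of "z - t" t] by (simp add: algebra_simps)
  have "sinh (z - 2 * y) < sinh (z - 2 * x)" using assms by simp
  then have 1: "cosh y * P < cosh x * R" using half[of x] half[of y] unfolding P_def R_def by linarith
  have "P\<^sup>2 < R\<^sup>2" using P by (simp add: power_strict_mono)
  from 1 this have "cosh y * P * P\<^sup>2 < cosh x * R * R\<^sup>2"
    by (rule mult_strict_mono) (use P \<open>P\<^sup>2 < R\<^sup>2\<close> in auto)
  moreover have "\<bar>sinh (y - z)\<bar> = P" "\<bar>sinh (x - z)\<bar> = R"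
    using P sinh_minus[of "z - y"] sinh_minus[of "z - x"] by (simp_all add: P_def R_def)
  ultimately show ?thesis by (simp add: power3_eq_cube power2_eq_square mult.assoc)
qed

text \<open>These are the equations of central configurations again, in the variables in which the second
  variation across the line is a Dirichlet form. They say that the rotation is a null direction.\<close>

lemma line_kernel_tanh:
  assumes cc: "cc_equations m \<mu> (line_config \<theta>)"
  shows "(\<Sum>l\<in>UNIV. pair_weight m (line_config \<theta>) i l * cosh (\<theta> i) * cosh (\<theta> l) * (tanh (\<theta> i) - tanh (\<theta> l)))
      = (- 2 * \<mu>) * (m i * (cosh (\<theta> i))\<^sup>2) * tanh (\<theta> i)"
proof -
  have "pair_weight m (line_config \<theta>) i l * cosh (\<theta> i) * cosh (\<theta> l) * (tanh (\<theta> i) - tanh (\<theta> l))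
      = - (pair_weight m (line_config \<theta>) i l * sinh (\<theta> l - \<theta> i))" for l
    unfolding tanh_def sinh_diff by (simp add: field_simps)
  then have "(\<Sum>l\<in>UNIV. pair_weight m (line_config \<theta>) i l * cosh (\<theta> i) * cosh (\<theta> l) * (tanh (\<theta> i) - tanh (\<theta> l)))
      = - (2 * \<mu> * m i * sinh (\<theta> i) * cosh (\<theta> i))"
    by (simp add: sum_negf cc_equations_line[OF cc])
  then show ?thesis by (simp add: tanh_def power2_eq_square)
qed

text \<open>The rates \<open>m l * cosh (\<theta> l) / (cosh (\<theta> i) * \<bar>sinh (\<theta> i - \<theta> l)\<bar> ^ 3)\<close> decrease when \<open>i\<close> moves away
  from \<open>l\<close>. On the left of \<open>l\<close> this is the previous monotonicity, on the right its mirror image.\<close>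

lemma line_spectral_gap:
  fixes \<theta> :: "'n::{finite,linorder} \<Rightarrow> real"
  assumes cc: "cc_equations m \<mu> (line_config \<theta>)" and \<mu>: "\<mu> < 0" and inj: "inj \<theta>"
    and m: "\<And>i. m i > 0" and n: "CARD('n) \<ge> 2"
    and orth: "(\<Sum>i\<in>UNIV. m i * (cosh (\<theta> i))\<^sup>2 * \<beta> i) = 0"
  defines "K \<equiv> \<lambda>i j. pair_weight m (line_config \<theta>) i j * cosh (\<theta> i) * cosh (\<theta> j)"
  defines "Q \<equiv> \<Sum>i\<in>UNIV. \<beta> i * ((- 2 * \<mu>) * (m i * (cosh (\<theta> i))\<^sup>2) * \<beta> i - (\<Sum>j\<in>UNIV. K i j * (\<beta> i - \<beta> j)))"
  shows "Q \<le> 0 \<and> (Q = 0 \<longrightarrow> (\<exists>r. \<forall>i. \<beta> i = r * tanh (\<theta> i)))"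
  unfolding Q_def
proof (rule spectral_gap)
  have K: "K i l / (m i * (cosh (\<theta> i))\<^sup>2) = m l * cosh (\<theta> l) / (cosh (\<theta> i) * \<bar>sinh (\<theta> i - \<theta> l)\<bar> ^ 3)"
    if "i \<noteq> l" for i l
    using that m[of i] by (simp add: K_def pair_weight_line hyp_grav_cosh power2_eq_square)
  have less: "m l * cosh (\<theta> l) / A < m l * cosh (\<theta> l) / B" if "B < A" "B > 0" for l A B
    using that m[of l] by (intro divide_strict_left_mono mult_pos_pos) auto
  have pos: "cosh (\<theta> i) * \<bar>sinh (\<theta> i - \<theta> l)\<bar> ^ 3 > 0" if "i \<noteq> l" for i l
    using that inj by (simp add: inj_eq)
  show "K i l / (m i * (cosh (\<theta> i))\<^sup>2) < K j l / (m j * (cosh (\<theta> j))\<^sup>2)"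
    if "tanh (\<theta> i) < tanh (\<theta> j)" "tanh (\<theta> j) < tanh (\<theta> l)" for i j l
  proof -
    have lt: "\<theta> i < \<theta> j" "\<theta> j < \<theta> l" using that by simp_all
    then have ne: "i \<noteq> l" "j \<noteq> l" by auto
    show ?thesis unfolding K[OF ne(1)] K[OF ne(2)]
      by (rule less[OF cosh_sinh_cube_decreasing[OF lt] pos[OF ne(2)]])
  qed
  show "K j l / (m j * (cosh (\<theta> j))\<^sup>2) < K i l / (m i * (cosh (\<theta> i))\<^sup>2)"
    if "tanh (\<theta> l) < tanh (\<theta> i)" "tanh (\<theta> i) < tanh (\<theta> j)" for i j l
  proof -
    have lt: "- \<theta> j < - \<theta> i" "- \<theta> i < - \<theta> l" using that by simp_all
    then have ne: "i \<noteq> l" "j \<noteq> l" by auto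
    have flip: "\<bar>sinh (- x - - y)\<bar> = \<bar>sinh (x - y)\<bar>" for x y :: real
      using sinh_minus[of "x - y"] by (simp add: algebra_simps)
    show ?thesis unfolding K[OF ne(1)] K[OF ne(2)]
      by (rule less[OF cosh_sinh_cube_decreasing[OF lt, unfolded flip cosh_minus] pos[OF ne(1)]])
  qed
  show "inj (\<lambda>i. tanh (\<theta> i))" using inj by (simp add: inj_def)
  show "m i * (cosh (\<theta> i))\<^sup>2 > 0" for i using m by simp
  show "K i j = K j i" for i j by (simp add: K_def pair_weight_sym[of m _ i j])
  show "0 < - 2 * \<mu>" using \<mu> by simp
  show "(\<Sum>l\<in>UNIV. K i l * (tanh (\<theta> i) - tanh (\<theta> l))) = (- 2 * \<mu>) * (m i * (cosh (\<theta> i))\<^sup>2) * tanh (\<theta> i)" for i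
    unfolding K_def by (rule line_kernel_tanh[OF cc])
qed (use n orth in \<open>simp_all add: mult.assoc\<close>)

lemma quotient_param_derivative:
  assumes "quotient_param m c E V \<phi>"
  obtains A where "\<And>x. x \<in> V \<Longrightarrow> (\<phi> has_derivative A x) (at x)" "\<And>w. continuous_on V (\<lambda>x. A x w)"
proof -
  have "Ck_on (Suc 0) \<phi> V" using assms by (simp only: quotient_param_def smooth_on_def)
  then show ?thesis using that by auto
qed

lemma orbit_direction:
  "vector_derivative (\<lambda>\<theta>. rotate_config \<theta> q) (at 0) = (\<chi> i. vector [- q$i$2, q$i$1, 0])"
proof (rule vector_derivative_at, rule has_vector_derivative_config)
  fix i and k :: 3
  have "((\<lambda>t. cos t * q$i$1 - sin t * q$i$2) has_real_derivative - q$i$2) (at 0)"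
    "((\<lambda>t. sin t * q$i$1 + cos t * q$i$2) has_real_derivative q$i$1) (at 0)"
    by (auto intro!: derivative_eq_intros)
  then show "((\<lambda>t. rotate_config t q $ i $ k) has_real_derivative (\<chi> i. vector [- q$i$2, q$i$1, 0]) $ i $ k) (at 0)"
    using exhaust_3[of k] by (auto simp: rotate_config_nth)
qed

lemma dim_weighted_hyperplane:
  fixes h :: "'n::finite \<Rightarrow> real"
  assumes "h i \<noteq> 0"
  shows "subspace {x :: real^'n. (\<Sum>i\<in>UNIV. h i * x$i) = 0}
    \<and> dim {x :: real^'n. (\<Sum>i\<in>UNIV. h i * x$i) = 0} = CARD('n) - 1"
proof -
  have eq: "{x :: real^'n. (\<Sum>i\<in>UNIV. h i * x$i) = 0} = {x. (\<chi> i. h i) \<bullet> x = 0}"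
    by (simp add: inner_vec_def)
  have "(\<chi> i. h i) \<noteq> (0 :: real^'n)" using assms by (auto simp: vec_eq_iff)
  then show ?thesis unfolding eq using dim_hyperplane subspace_hyperplane by force
qed

text \<open>The tangent space of the level set is the image of \<open>H \<times> UNIV\<close> under \<open>line_tangent\<close>, where \<open>H\<close> is the
  hyperplane of infinitesimal motions along the line that keep the inertia moment. The form is
  positive semidefinite on \<open>H\<close> together with the span of \<open>cosh \<theta>\<close> and \<open>sinh \<theta>\<close> across the line, of
  dimension \<open>n + 1\<close>. It is negative semidefinite on the displacements across the line that are
  orthogonal to \<open>cosh \<theta>\<close> for the masses, of dimension \<open>n - 1\<close>. The null vectors of both are the
  multiples of \<open>sinh \<theta>\<close> across the line, the direction of the rotation.\<close>

lemma inertia_at_line_cc: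
  fixes \<phi> :: "'n::{finite,linorder} config \<Rightarrow> 'n config"
  assumes param: "quotient_param m c E V \<phi>" and u: "u \<in> V \<inter> E" and \<phi>u: "\<phi> u = line_config \<theta>"
    and cc: "cc_equations m \<mu> (line_config \<theta>)" and inj: "inj \<theta>"
    and m: "\<And>i. m i > 0" and n: "CARD('n) \<ge> 2"
  shows "inertia E (hessian_form (\<lambda>x. induced_fun (potential m) (orbit (\<phi> x))) u)
    = (0, CARD('n), CARD('n) - 2)"
proof -
  let ?q = "line_config \<theta>" and ?\<Psi> = "line_tangent \<theta>"
  have E: "subspace E" and dimE: "dim E = 2 * CARD('n) - 2" and V: "open V"
    and lev: "\<phi> ` (V \<inter> E) \<subseteq> level_set m c"
    and transv: "\<And>v. v \<in> E \<Longrightarrow> frechet_derivative \<phi> (at u) v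
          \<in> span {vector_derivative (\<lambda>\<theta>. rotate_config \<theta> (\<phi> u)) (at 0)} \<Longrightarrow> v = 0"
    using param u unfolding quotient_param_def by blast+
  obtain A where A: "\<And>x. x \<in> V \<Longrightarrow> (\<phi> has_derivative A x) (at x)" and Ac: "\<And>w. continuous_on V (\<lambda>x. A x w)"
    using quotient_param_derivative[OF param] by blast
  have uV: "u \<in> V" using u by simp
  have frechet: "frechet_derivative \<phi> (at u) = A u" using frechet_derivative_at[OF A[OF uV]] by simp
  have q: "?q \<in> config_space" using inj by (simp add: line_config_space)
  have \<mu>: "\<mu> < 0" by (rule cc_multiplier_negative[OF q cc m n])
  obtain \<sigma> where res: "\<And>i. lagrange_residual m \<mu> \<sigma> ?q i = 0"
    using cc_equations_multiplier[OF cc] by blast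
  define B where "B = lagrange_form m \<mu> \<sigma> ?q"
  define H where "H = {a :: (real,'n) vec. (\<Sum>i\<in>UNIV. (m i * sinh (\<theta> i) * cosh (\<theta> i)) * a$i) = 0}"
  define N where "N = {b :: (real,'n) vec. (\<Sum>i\<in>UNIV. (m i * cosh (\<theta> i)) * b$i) = 0}"
  define ch :: "(real,'n) vec" where "ch = (\<chi> i. cosh (\<theta> i))"
  define sh :: "(real,'n) vec" where "sh = (\<chi> i. sinh (\<theta> i))"
  define R where "R = range (\<lambda>\<delta>. ?\<Psi> (0, \<delta> *\<^sub>R sh))"
  define Q where "Q \<beta> = (\<Sum>i\<in>UNIV. \<beta> i * ((- 2 * \<mu>) * (m i * (cosh (\<theta> i))\<^sup>2) * \<beta> i
      - (\<Sum>j\<in>UNIV. pair_weight m ?q i j * cosh (\<theta> i) * cosh (\<theta> j) * (\<beta> i - \<beta> j))))" for \<beta>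
  obtain i j :: 'n where ij: "i \<noteq> j" by (rule exists_distinct[OF n])
  then have \<theta>ij: "\<theta> i \<noteq> \<theta> j" using inj by (simp add: inj_eq)
  have "\<exists>i0. \<theta> i0 \<noteq> 0" using \<theta>ij by metis
  then obtain i0 where i0: "m i0 * sinh (\<theta> i0) * cosh (\<theta> i0) \<noteq> 0" using m by (metis less_irrefl mult_eq_0_iff sinh_real_zero_iff cosh_real_nonzero)
  have H: "subspace H" "dim H = CARD('n) - 1"
    unfolding H_def using dim_weighted_hyperplane[where h = "\<lambda>i. m i * sinh (\<theta> i) * cosh (\<theta> i)", OF i0] by auto
  have "m i * cosh (\<theta> i) \<noteq> 0" using m[of i] by simp
  then have N: "subspace N" "dim N = CARD('n) - 1"
    unfolding N_def using dim_weighted_hyperplane[where h = "\<lambda>i. m i * cosh (\<theta> i)"] by auto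
  have dim2: "dim {ch, sh} = 2"
  proof -
    have ch0: "ch \<noteq> 0" by (simp add: ch_def vec_eq_iff)
    have "sh \<notin> span {ch}"
    proof
      assume "sh \<in> span {ch}"
      then obtain r where "sh = r *\<^sub>R ch" by (auto simp: span_singleton)
      then have "sinh (\<theta> i) = r * cosh (\<theta> i)" "sinh (\<theta> j) = r * cosh (\<theta> j)" by (simp_all add: sh_def ch_def vec_eq_iff)
      then have "tanh (\<theta> i) = r" "tanh (\<theta> j) = r" by (simp_all add: tanh_def)
      then show False using \<theta>ij by (metis tanh_real_eq_iff)
    qed
    then have "independent {sh, ch}" "sh \<noteq> ch"
      using ch0 span_base[of ch "{ch}"] by (auto simp: independent_insert)
    then show ?thesis by (metis dim_eq_card_independent card_2_iff insert_commute)
  qed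
  have dim_\<Psi>: "dim (?\<Psi> ` S) = dim S" for S
    by (rule dim_image_eq[OF linear_line_tangent]) (rule inj_on_subset[OF inj_line_tangent subset_UNIV])
  have form: "B (?\<Psi> (a,b)) (?\<Psi> (a,b))
      = (\<Sum>i\<in>UNIV. \<Sum>j\<in>UNIV. pair_weight m ?q i j * cosh (\<theta> i - \<theta> j) * (a$i - a$j)\<^sup>2)
      + (- 2 * \<mu>) * (\<Sum>i\<in>UNIV. m i * ((cosh (\<theta> i))\<^sup>2 + (sinh (\<theta> i))\<^sup>2) * (a$i)\<^sup>2)
      + Q (\<lambda>i. b$i / cosh (\<theta> i))" for a b
    unfolding B_def Q_def lagrange_form_line[OF res inj] by simp
  have a_part: "B (?\<Psi> (a,b)) (?\<Psi> (a,b)) \<ge> Q (\<lambda>i. b$i / cosh (\<theta> i))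
      \<and> (B (?\<Psi> (a,b)) (?\<Psi> (a,b)) = Q (\<lambda>i. b$i / cosh (\<theta> i)) \<longrightarrow> a = 0)" for a b
  proof -
    let ?T = "\<lambda>i. m i * ((cosh (\<theta> i))\<^sup>2 + (sinh (\<theta> i))\<^sup>2) * (a$i)\<^sup>2"
    have "pair_weight m ?q i j \<ge> 0" for i j
    proof (cases "i = j")
      case False
      show ?thesis by (rule less_imp_le[OF pair_weight_pos[OF q _ False]]) (rule m)
    qed (simp add: pair_weight_def)
    then have 1: "(\<Sum>i\<in>UNIV. \<Sum>j\<in>UNIV. pair_weight m ?q i j * cosh (\<theta> i - \<theta> j) * (a$i - a$j)\<^sup>2) \<ge> 0"
      by (intro sum_nonneg mult_nonneg_nonneg) auto
    have T0: "?T i \<ge> 0" for i using m[of i] by simp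
    then have "(\<Sum>i\<in>UNIV. ?T i) \<ge> 0" by (simp add: sum_nonneg)
    then have 2: "(- 2 * \<mu>) * (\<Sum>i\<in>UNIV. ?T i) \<ge> 0" by (rule mult_nonneg_nonneg[rotated]) (use \<mu> in simp)
    have "a = 0" if "B (?\<Psi> (a,b)) (?\<Psi> (a,b)) = Q (\<lambda>i. b$i / cosh (\<theta> i))"
    proof -
      have "(- 2 * \<mu>) * (\<Sum>i\<in>UNIV. ?T i) = 0" using that form[of a b] 1 2 by linarith
      then have "(\<Sum>i\<in>UNIV. ?T i) = 0" using \<mu> by simp
      then have T: "?T i = 0" for i using T0 by (subst (asm) sum_nonneg_eq_0_iff) auto
      have "(cosh (\<theta> i))\<^sup>2 + (sinh (\<theta> i))\<^sup>2 > 0" for i by (simp add: add_pos_nonneg)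
      then have "a$i = 0" for i using T[of i] m[of i] by (metis less_irrefl mult_eq_0_iff power_eq_0_iff)
      then show ?thesis by (simp add: vec_eq_iff)
    qed
    then show ?thesis using form[of a b] 1 2 by linarith
  qed
  have B0: "B (?\<Psi> (0,b)) (?\<Psi> (0,b)) = Q (\<lambda>i. b$i / cosh (\<theta> i))" for b
    unfolding form by simp
  have ker: "(\<Sum>l\<in>UNIV. pair_weight m ?q i l * cosh (\<theta> i) * cosh (\<theta> l) * (tanh (\<theta> i) - tanh (\<theta> l)))
      = (- 2 * \<mu>) * (m i * (cosh (\<theta> i))\<^sup>2) * tanh (\<theta> i)" for i
    by (rule line_kernel_tanh[OF cc])
  have Q_affine: "Q (\<lambda>i. \<alpha> + \<delta> * tanh (\<theta> i)) = (- 2 * \<mu>) * \<alpha>\<^sup>2 * (\<Sum>i\<in>UNIV. m i * (cosh (\<theta> i))\<^sup>2)" for \<alpha> \<delta>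
  proof -
    have mean: "(\<Sum>i\<in>UNIV. m i * (cosh (\<theta> i))\<^sup>2 * tanh (\<theta> i)) = 0"
    proof -
      have "(\<Sum>i\<in>UNIV. \<Sum>l\<in>UNIV. pair_weight m ?q i l * cosh (\<theta> i) * cosh (\<theta> l) * (tanh (\<theta> i) - tanh (\<theta> l))) = 0"
        using sum_antisymmetric[of "\<lambda>i l. pair_weight m ?q i l * cosh (\<theta> i) * cosh (\<theta> l) * (tanh (\<theta> i) - tanh (\<theta> l))" "\<lambda>_. 1"]
        by (simp add: pair_weight_sym[of m ?q] algebra_simps)
      then have "(- 2 * \<mu>) * (\<Sum>i\<in>UNIV. m i * (cosh (\<theta> i))\<^sup>2 * tanh (\<theta> i)) = 0"
        unfolding ker sum_distrib_left by (simp only: mult.assoc)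
      then show ?thesis using \<mu> by simp
    qed
    have "(\<Sum>j\<in>UNIV. pair_weight m ?q i j * cosh (\<theta> i) * cosh (\<theta> j) * ((\<alpha> + \<delta> * tanh (\<theta> i)) - (\<alpha> + \<delta> * tanh (\<theta> j))))
        = \<delta> * ((- 2 * \<mu>) * (m i * (cosh (\<theta> i))\<^sup>2) * tanh (\<theta> i))" for i
      unfolding ker[symmetric] sum_distrib_left by (rule sum.cong) (auto simp: algebra_simps)
    then have "Q (\<lambda>i. \<alpha> + \<delta> * tanh (\<theta> i))
        = (\<Sum>i\<in>UNIV. (- 2 * \<mu>) * \<alpha>\<^sup>2 * (m i * (cosh (\<theta> i))\<^sup>2)
            + (- 2 * \<mu> * \<alpha> * \<delta>) * (m i * (cosh (\<theta> i))\<^sup>2 * tanh (\<theta> i)))"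
      unfolding Q_def by (intro sum.cong refl) (simp only:, simp add: power2_eq_square algebra_simps)
    also have "\<dots> = (- 2 * \<mu>) * \<alpha>\<^sup>2 * (\<Sum>i\<in>UNIV. m i * (cosh (\<theta> i))\<^sup>2)
        + (- 2 * \<mu> * \<alpha> * \<delta>) * (\<Sum>i\<in>UNIV. m i * (cosh (\<theta> i))\<^sup>2 * tanh (\<theta> i))"
      unfolding sum.distrib sum_distrib_left ..
    finally show ?thesis unfolding mean by simp
  qed
  show ?thesis
  proof (rule inertia_of_transversal[where A = "A u" and B = B and T = "?\<Psi> ` (H \<times> UNIV)" and R = R
        and P = "?\<Psi> ` (H \<times> span {ch, sh})" and N = "?\<Psi> ` ({0} \<times> N)"])
    show "subspace E" by (rule E)
    show "linear (A u)" using A[OF uV] by (rule has_derivative_linear)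
    show "bilinear B" unfolding B_def by (rule bilinear_lagrange_form)
    show "B x y = B y x" for x y unfolding B_def by (rule lagrange_form_sym)
    show "hessian_form (\<lambda>x. induced_fun (potential m) (orbit (\<phi> x))) u v w = B (A u v) (A u w)"
      if "v \<in> E" "w \<in> E" for v w
      unfolding B_def \<phi>u[symmetric]
      by (rule hessian_form_lagrange[OF E V u that A Ac lev]) (simp_all add: \<phi>u res)
    have sub: "subspace (H \<times> UNIV)" "subspace (H \<times> span {ch, sh})" "subspace ({0 :: (real,'n) vec} \<times> N)"
      using H(1) N(1) by (auto intro!: subspace_Times)
    show "subspace (?\<Psi> ` (H \<times> UNIV))" "subspace (?\<Psi> ` (H \<times> span {ch, sh}))" "subspace (?\<Psi> ` ({0} \<times> N))"
      using sub linear_subspace_image[OF linear_line_tangent] by blast+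
    have "dim (H \<times> (UNIV :: (real,'n) vec set)) = dim H + CARD('n)"
      by (simp add: dim_Times[OF H(1) subspace_UNIV])
    then show "dim (?\<Psi> ` (H \<times> UNIV)) \<le> dim E + 1" using H dimE n unfolding dim_\<Psi> by linarith
    have "dim (H \<times> span {ch, sh}) = dim H + 2"
      using dim_Times[OF H(1) subspace_span[of "{ch, sh}"]] dim2 by simp
    then show "CARD('n) + 1 \<le> dim (?\<Psi> ` (H \<times> span {ch, sh}))" using H n unfolding dim_\<Psi> by linarith
    have "dim ({0 :: (real,'n) vec} \<times> N) = dim N"
      by (simp add: dim_Times[OF subspace_single_0 N(1)])
    then show "CARD('n) - 2 + 1 \<le> dim (?\<Psi> ` ({0} \<times> N))" using N n unfolding dim_\<Psi> by linarith
    show "dim E = CARD('n) + (CARD('n) - 2)" using dimE n by linarith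
    show "?\<Psi> ` (H \<times> span {ch, sh}) \<subseteq> ?\<Psi> ` (H \<times> UNIV)" by auto
    have "0 \<in> H" using H(1) by (rule subspace_0)
    then show "?\<Psi> ` ({0} \<times> N) \<subseteq> ?\<Psi> ` (H \<times> UNIV)" by auto
    have \<Psi>0: "?\<Psi> (0, 0) = 0" by (simp add: config_eq_iff)
    show "0 \<in> R" unfolding R_def by (rule image_eqI[of _ _ 0]) (simp_all add: \<Psi>0)
    show "v = 0" if vE: "v \<in> E" and vR: "A u v \<in> R" for v
    proof (rule transv[OF vE])
      have dir: "vector_derivative (\<lambda>\<theta>. rotate_config \<theta> (\<phi> u)) (at 0) = ?\<Psi> (0, sh)"
        unfolding orbit_direction \<phi>u by (simp add: config_eq_iff sh_def)
      obtain \<delta> where "A u v = ?\<Psi> (0, \<delta> *\<^sub>R sh)" using vR by (auto simp: R_def)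
      also have "\<dots> = \<delta> *\<^sub>R ?\<Psi> (0, sh)" by (simp add: config_eq_iff)
      finally show "frechet_derivative \<phi> (at u) v \<in> span {vector_derivative (\<lambda>\<theta>. rotate_config \<theta> (\<phi> u)) (at 0)}"
        unfolding frechet dir by (simp add: span_base span_scale)
    qed
    show "A u ` E \<subseteq> ?\<Psi> ` (H \<times> UNIV)"
    proof
      fix \<xi> assume "\<xi> \<in> A u ` E"
      then obtain v where v: "v \<in> E" "\<xi> = A u v" by blast
      have t1: "mink (?q$i) (\<xi>$i) = 0" for i
        using tangent_to_level_set(1)[OF E V u v(1) A[OF uV] lev] by (simp add: v(2) \<phi>u)
      have t2: "(\<Sum>i\<in>UNIV. m i * mink (\<xi>$i) (planar (?q$i))) = 0"
        using tangent_to_level_set(2)[OF E V u v(1) A[OF uV] lev] by (simp add: v(2) \<phi>u)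
      define a :: "(real,'n) vec" where "a = (\<chi> i. cosh (\<theta> i) * \<xi>$i$1 - sinh (\<theta> i) * \<xi>$i$3)"
      have t1': "sinh (\<theta> i) * \<xi>$i$1 = cosh (\<theta> i) * \<xi>$i$3" for i using t1[of i] by (simp add: mink_def)
      have cs: "cosh (\<theta> i) * cosh (\<theta> i) = sinh (\<theta> i) * sinh (\<theta> i) + 1" for i
        using cosh_square_eq[of "\<theta> i"] by (simp add: power2_eq_square)
      have ac: "a$i * cosh (\<theta> i) = \<xi>$i$1" for i
      proof -
        have "a$i * cosh (\<theta> i) = (cosh (\<theta> i) * cosh (\<theta> i)) * \<xi>$i$1 - sinh (\<theta> i) * (cosh (\<theta> i) * \<xi>$i$3)"
          by (simp add: a_def algebra_simps)
        then show ?thesis unfolding cs t1'[symmetric] by (simp add: algebra_simps)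
      qed
      have as: "a$i * sinh (\<theta> i) = \<xi>$i$3" for i
      proof -
        have "a$i * sinh (\<theta> i) = cosh (\<theta> i) * (sinh (\<theta> i) * \<xi>$i$1) - (sinh (\<theta> i) * sinh (\<theta> i)) * \<xi>$i$3"
          by (simp add: a_def algebra_simps)
        also have "\<dots> = (cosh (\<theta> i) * cosh (\<theta> i)) * \<xi>$i$3 - (sinh (\<theta> i) * sinh (\<theta> i)) * \<xi>$i$3"
          unfolding t1' by (simp add: algebra_simps)
        finally show ?thesis unfolding cs by (simp add: algebra_simps)
      qed
      have "\<xi> = ?\<Psi> (a, \<chi> i. \<xi>$i$2)" by (simp add: config_eq_iff ac as)
      moreover have "a \<in> H"
      proof -
        have "(m i * sinh (\<theta> i) * cosh (\<theta> i)) * a$i = m i * mink (\<xi>$i) (planar (?q$i))" for i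
          using ac[of i] by (simp add: mink_planar mult_ac)
        then show ?thesis unfolding H_def using t2 by (simp only: mem_Collect_eq)
      qed
      ultimately show "\<xi> \<in> ?\<Psi> ` (H \<times> UNIV)" by blast
    qed
    show "B x x \<ge> 0 \<and> (B x x = 0 \<longrightarrow> x \<in> R)" if xP: "x \<in> ?\<Psi> ` (H \<times> span {ch, sh})" for x
    proof -
      obtain a b where x: "x = ?\<Psi> (a, b)" "b \<in> span {ch, sh}" using xP by blast
      obtain \<alpha> \<delta> where b: "b = \<alpha> *\<^sub>R ch + \<delta> *\<^sub>R sh"
      proof -
        obtain k where "b - k *\<^sub>R ch \<in> span {sh}" using x(2) span_breakdown_eq by blast
        then obtain l where "b - k *\<^sub>R ch = l *\<^sub>R sh" by (auto simp: span_singleton)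
        then have "b = k *\<^sub>R ch + l *\<^sub>R sh" by (simp add: algebra_simps)
        then show ?thesis by (rule that)
      qed
      have "(\<lambda>i. b$i / cosh (\<theta> i)) = (\<lambda>i. \<alpha> + \<delta> * tanh (\<theta> i))"
        by (simp add: b ch_def sh_def tanh_def fun_eq_iff add_divide_distrib)
      then have Qb: "Q (\<lambda>i. b$i / cosh (\<theta> i)) = (- 2 * \<mu>) * \<alpha>\<^sup>2 * (\<Sum>i\<in>UNIV. m i * (cosh (\<theta> i))\<^sup>2)"
        using Q_affine by simp
      have S: "(\<Sum>i\<in>UNIV. m i * (cosh (\<theta> i))\<^sup>2) > 0" by (intro sum_pos) (auto simp: m)
      have Q0: "Q (\<lambda>i. b$i / cosh (\<theta> i)) \<ge> 0"
        unfolding Qb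
        by (rule mult_nonneg_nonneg[OF mult_nonneg_nonneg[OF _ zero_le_power2] less_imp_le[OF S]]) (use \<mu> in simp)
      have "x \<in> R" if "B x x = 0"
      proof -
        have "Q (\<lambda>i. b$i / cosh (\<theta> i)) = 0" "a = 0" using a_part[where a = a and b = b] Q0 that x(1) by auto
        then have "\<alpha> = 0" unfolding Qb using S \<mu> by simp
        then show ?thesis using b x(1) \<open>a = 0\<close> by (auto simp: R_def)
      qed
      then show ?thesis using a_part[where a = a and b = b] Q0 x(1) by auto
    qed
    show "B x x \<le> 0 \<and> (B x x = 0 \<longrightarrow> x \<in> R)" if xN: "x \<in> ?\<Psi> ` ({0} \<times> N)" for x
    proof -
      obtain b where x: "x = ?\<Psi> (0, b)" "b \<in> N" using xN by blast
      define \<beta> where "\<beta> i = b$i / cosh (\<theta> i)" for i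
      have "m i * (cosh (\<theta> i))\<^sup>2 * \<beta> i = (m i * cosh (\<theta> i)) * b$i" for i
        by (simp add: \<beta>_def power2_eq_square)
      then have orth: "(\<Sum>i\<in>UNIV. m i * (cosh (\<theta> i))\<^sup>2 * \<beta> i) = 0" using x(2) unfolding N_def by (simp only: mem_Collect_eq)
      have gap: "Q \<beta> \<le> 0 \<and> (Q \<beta> = 0 \<longrightarrow> (\<exists>r. \<forall>i. \<beta> i = r * tanh (\<theta> i)))"
        unfolding Q_def by (rule line_spectral_gap[OF cc \<mu> inj m n orth])
      have "x \<in> R" if "\<forall>i. \<beta> i = r * tanh (\<theta> i)" for r
      proof -
        have "b$i = r * sinh (\<theta> i)" for i
          using that[rule_format, of i] by (simp add: \<beta>_def tanh_def field_simps)
        then have "b = r *\<^sub>R sh" by (simp add: vec_eq_iff sh_def)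
        then show ?thesis using x(1) by (auto simp: R_def)
      qed
      then show ?thesis using gap B0[of b] unfolding x(1) \<beta>_def[abs_def] by auto
    qed
  qed
qed

section \<open>Coordinates on the quotient\<close>

lemma Ck_on_vec:
  fixes f :: "'a::real_normed_vector \<Rightarrow> 'b::euclidean_space^'n"
  assumes "\<And>i. Ck_on k (\<lambda>x. f x $ i) S"
  shows "Ck_on k f S"
proof -
  have lin: "bounded_linear (axis i :: 'b \<Rightarrow> 'b^'n)" for i
    by (rule linear_conv_bounded_linear[THEN iffD1], rule linearI) (auto simp: vec_eq_iff axis_def)
  have "f x = (\<Sum>i\<in>UNIV. axis i (f x $ i))" for x
  proof -
    have "(\<Sum>i\<in>UNIV. axis i (f x $ i)) $ j = (\<Sum>i\<in>UNIV. if j = i then f x $ i else 0)" for j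
      by (simp add: axis_def)
    then show ?thesis by (simp add: vec_eq_iff)
  qed
  then have eq: "f = (\<lambda>x. \<Sum>i\<in>UNIV. axis i (f x $ i))" by blast
  show ?thesis by (subst eq) (intro Ck_on_sum Ck_on_compose_linear[OF lin] assms finite)
qed

lemma Ck_on_lift:
  fixes X Y :: "'a::real_normed_vector \<Rightarrow> real"
  assumes "Ck_on k X S" "Ck_on k Y S"
  shows "Ck_on k (\<lambda>u. lift (X u) (Y u)) S"
proof -
  have pos: "1 + a * a + b * b > 0" for a b :: real by (simp add: add_pos_nonneg)
  have "Ck_on k (\<lambda>u. sqrt (1 + X u * X u + Y u * Y u)) S"
    by (intro Ck_on_sqrt pos Ck_on_add Ck_on_const Ck_on_mult assms)
  then show ?thesis unfolding lift_axis power2_eq_square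
    by (intro Ck_on_add Ck_on_compose_linear[OF bounded_linear_scaleR_left] assms)
qed

text \<open>Coordinates for the quotient are modelled on displacements in the plane; the third coordinate is
  a placeholder.\<close>

definition slice_config :: "(real,'n) vec \<times> (real,'n) vec \<Rightarrow> 'n::finite config" where
  "slice_config = (\<lambda>(a,b). \<chi> i. vector [a$i, b$i, 0])"

text \<open>In the planar coordinates the level set is an ellipsoid. The slice \<open>E\<close> is the orthogonal complement,
  for the inner product given by the masses, of the configuration \<open>x\<close> and of its quarter turn. The
  map \<open>\<phi>\<close> adds the displacement, rescales to the ellipsoid by \<open>s\<close>, and lifts to the hyperboloid.
  Pairing with \<open>x\<close> and with the quarter turn recovers the scale and the angle of a rotation from
  the rotated configuration, so a rotation between two values of \<open>\<phi>\<close> is trivial, and the same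
  computation with derivatives gives transversality to the orbits.\<close>

lemma exists_quotient_param:
  fixes \<theta> :: "'n::{finite,linorder} \<Rightarrow> real"
  assumes inj: "inj \<theta>" and m: "\<And>i. m i > 0" and n: "CARD('n) \<ge> 2"
    and I: "inertia_moment m (line_config \<theta>) = c"
  shows "\<exists>E V \<phi>. quotient_param m c E V \<phi> \<and> (\<exists>u\<in>V \<inter> E. \<phi> u = line_config \<theta>)"
proof -
  define x where "x i = sinh (\<theta> i)" for i
  define H where "H = {a :: (real,'n) vec. (\<Sum>i\<in>UNIV. (m i * x i) * a$i) = 0}"
  define E :: "'n config set" where "E = slice_config ` (H \<times> H)"
  define P :: "'n config" where "P = (\<chi> i. vector [x i, 0, 0])"
  define V where "V = (\<lambda>u. P + u) -` {q :: 'n config. \<forall>i j. i \<noteq> j \<longrightarrow> q$i \<noteq> q$j}"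
  define N :: "'n config \<Rightarrow> real" where
    "N u = (\<Sum>i\<in>UNIV. m i * (u$i$1 * u$i$1 + u$i$2 * u$i$2))" for u
  define s where "s u = sqrt (c * inverse (c + N u))" for u
  define \<phi> :: "'n config \<Rightarrow> 'n config" where
    "\<phi> u = (\<chi> i. lift (s u * (x i + u$i$1)) (s u * u$i$2))" for u
  obtain i j :: 'n where ij: "i \<noteq> j" by (rule exists_distinct[OF n])
  then have "\<theta> i \<noteq> \<theta> j" using inj by (simp add: inj_eq)
  then have "\<exists>i0. \<theta> i0 \<noteq> 0" by metis
  then obtain i0 where "x i0 \<noteq> 0" by (auto simp: x_def)
  then have i0: "m i0 * x i0 \<noteq> 0" "m i0 * (x i0)\<^sup>2 > 0" using m[of i0] by auto
  have c_eq: "(\<Sum>i\<in>UNIV. m i * (x i)\<^sup>2) = c" using I by (simp add: inertia_moment_def x_def)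
  have "m i0 * (x i0)\<^sup>2 \<le> (\<Sum>i\<in>UNIV. m i * (x i)\<^sup>2)"
    by (rule member_le_sum) (use m in \<open>auto simp: less_imp_le\<close>)
  then have c: "c > 0" using i0(2) c_eq by linarith
  have H: "subspace H" "dim H = CARD('n) - 1"
    unfolding H_def using dim_weighted_hyperplane[where h = "\<lambda>i. m i * x i", OF i0(1)] by auto
  have E_iff: "u \<in> E \<longleftrightarrow> (\<forall>i. u$i$3 = 0) \<and> (\<Sum>i\<in>UNIV. m i * x i * u$i$1) = 0
      \<and> (\<Sum>i\<in>UNIV. m i * x i * u$i$2) = 0" for u
  proof
    assume "u \<in> E" then show "(\<forall>i. u$i$3 = 0) \<and> (\<Sum>i\<in>UNIV. m i * x i * u$i$1) = 0 \<and> (\<Sum>i\<in>UNIV. m i * x i * u$i$2) = 0"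
      by (auto simp: E_def slice_config_def H_def)
  next
    assume *: "(\<forall>i. u$i$3 = 0) \<and> (\<Sum>i\<in>UNIV. m i * x i * u$i$1) = 0 \<and> (\<Sum>i\<in>UNIV. m i * x i * u$i$2) = 0"
    then have "u = slice_config ((\<chi> i. u$i$1), (\<chi> i. u$i$2))" by (simp add: slice_config_def config_eq_iff)
    moreover have "(\<chi> i. u$i$1) \<in> H" "(\<chi> i. u$i$2) \<in> H" using * by (auto simp: H_def)
    ultimately show "u \<in> E" unfolding E_def by blast
  qed
  have lin: "linear (slice_config :: _ \<Rightarrow> 'n config)"
    by (rule linearI) (auto simp: slice_config_def config_eq_iff)
  have inj_slice: "inj (slice_config :: _ \<Rightarrow> 'n config)"
    by (rule injI) (auto simp: slice_config_def config_eq_iff vec_eq_iff[where 'a = real])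
  have subE: "subspace E" unfolding E_def
    by (rule linear_subspace_image[OF lin subspace_Times[OF H(1) H(1)]])
  have "dim E = dim (H \<times> H)" unfolding E_def
    by (rule dim_image_eq[OF lin]) (rule inj_on_subset[OF inj_slice subset_UNIV])
  then have dimE: "dim E = 2 * CARD('n) - 2"
    using dim_Times[OF H(1) H(1)] H(2) n by simp
  have openV: "open V" unfolding V_def
    by (intro open_vimage open_noncollision continuous_intros)
  have N0: "N u \<ge> 0" for u unfolding N_def
    by (intro sum_nonneg mult_nonneg_nonneg[OF less_imp_le[OF m]] add_nonneg_nonneg zero_le_square)
  have cN: "c + N u > 0" for u using N0[of u] c by linarith
  have s_pos: "s u > 0" and s_sq: "(s u)\<^sup>2 * (c + N u) = c" for u
    using cN[of u] c by (auto simp: s_def)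
  have nth: "Ck_on k (\<lambda>u::'n config. u$i$l) S" for k i l S
    by (rule Ck_on_linear[OF bounded_linear_compose[OF bounded_linear_vec_nth bounded_linear_vec_nth]])
  have s_smooth: "Ck_on k s S" for k S
    unfolding s_def[abs_def] N_def
    by (intro Ck_on_sqrt Ck_on_mult Ck_on_inverse Ck_on_add Ck_on_sum Ck_on_const nth finite)
      (use cN c in \<open>auto simp: N_def[symmetric] less_imp_neq[symmetric]\<close>)
  have smooth: "smooth_on \<phi> V" unfolding smooth_on_def
  proof
    show "Ck_on k \<phi> V" for k
    proof (rule Ck_on_vec)
      show "Ck_on k (\<lambda>u. \<phi> u $ i) V" for i unfolding \<phi>_def vec_lambda_beta
        by (intro Ck_on_lift Ck_on_mult Ck_on_add Ck_on_const s_smooth nth)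
    qed
  qed
  have \<phi>_nth: "\<phi> u $ i $ 1 = s u * (x i + u$i$1)" "\<phi> u $ i $ 2 = s u * u$i$2" for u i
    by (simp_all add: \<phi>_def)
  have hyp: "\<phi> u $ i \<in> hyp2" for u i by (simp add: \<phi>_def lift_hyp2)
  have level: "\<phi> u \<in> level_set m c" if u: "u \<in> V \<inter> E" for u
  proof -
    have uE: "u \<in> E" using u by simp
    have "\<phi> u $ i \<noteq> \<phi> u $ j" if "i \<noteq> j" for i j
    proof
      assume "\<phi> u $ i = \<phi> u $ j"
      then have "s u * (x i + u$i$1) = s u * (x j + u$j$1)" "s u * u$i$2 = s u * u$j$2"
        by (metis \<phi>_nth)+
      then have "x i + u$i$1 = x j + u$j$1" "u$i$2 = u$j$2" using s_pos[of u] by auto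
      then have "(P + u)$i = (P + u)$j" using uE by (simp add: vec_eq_iff[where 'b = 3] forall_3 P_def E_iff)
      then show False using u that by (simp add: V_def)
    qed
    then have "\<phi> u \<in> config_space" by (simp add: config_space_iff hyp)
    moreover have "inertia_moment m (\<phi> u) = c"
    proof -
      have "inertia_moment m (\<phi> u)
          = (s u)\<^sup>2 * ((\<Sum>i\<in>UNIV. m i * (x i)\<^sup>2) + 2 * (\<Sum>i\<in>UNIV. m i * x i * u$i$1) + N u)"
        unfolding inertia_moment_def N_def \<phi>_nth sum_distrib_left sum.distrib[symmetric]
        by (rule sum.cong) (auto simp: power2_eq_square algebra_simps)
      then show ?thesis using uE s_sq[of u] by (simp add: c_eq E_iff)
    qed
    ultimately show ?thesis by (simp add: level_set_def)
  qed
  have mean1: "(\<Sum>i\<in>UNIV. m i * x i * (a * (x i + u$i$1))) = a * c" if "u \<in> E" for u a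
  proof -
    have "(\<Sum>i\<in>UNIV. m i * x i * (a * (x i + u$i$1)))
        = a * ((\<Sum>i\<in>UNIV. m i * (x i)\<^sup>2) + (\<Sum>i\<in>UNIV. m i * x i * u$i$1))"
      unfolding sum_distrib_left sum.distrib[symmetric]
      by (rule sum.cong) (auto simp: power2_eq_square algebra_simps)
    then show ?thesis using that by (simp add: E_iff c_eq)
  qed
  have mean2: "(\<Sum>i\<in>UNIV. m i * x i * (a * u$i$2)) = 0" and mean3: "(\<Sum>i\<in>UNIV. m i * x i * (a * u$i$1)) = 0"
    if "u \<in> E" for u a
  proof -
    have "(\<Sum>i\<in>UNIV. m i * x i * (a * u$i$2)) = a * (\<Sum>i\<in>UNIV. m i * x i * u$i$2)"
      "(\<Sum>i\<in>UNIV. m i * x i * (a * u$i$1)) = a * (\<Sum>i\<in>UNIV. m i * x i * u$i$1)"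
      unfolding sum_distrib_left by (rule sum.cong; simp add: mult_ac)+
    then show "(\<Sum>i\<in>UNIV. m i * x i * (a * u$i$2)) = 0" "(\<Sum>i\<in>UNIV. m i * x i * (a * u$i$1)) = 0"
      using that by (auto simp: E_iff)
  qed
  have injo: "inj_on (\<lambda>u. orbit (\<phi> u)) (V \<inter> E)"
  proof (rule inj_onI)
    fix u v assume uv: "u \<in> V \<inter> E" "v \<in> V \<inter> E" "orbit (\<phi> u) = orbit (\<phi> v)"
    then have uE: "u \<in> E" "v \<in> E" by auto
    obtain \<alpha> where \<alpha>: "\<phi> u = rotate_config \<alpha> (\<phi> v)" using uv(3) orbit_eq_iff by blast
    have 1: "s u * (x i + u$i$1) = cos \<alpha> * s v * (x i + v$i$1) - sin \<alpha> * s v * v$i$2" for i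
      using arg_cong[OF \<alpha>, of "\<lambda>q. q$i$1"] by (simp add: rotate_config_nth \<phi>_nth)
    have 2: "s u * u$i$2 = sin \<alpha> * s v * (x i + v$i$1) + cos \<alpha> * s v * v$i$2" for i
      using arg_cong[OF \<alpha>, of "\<lambda>q. q$i$2"] by (simp add: rotate_config_nth \<phi>_nth)
    have "s u * c = (\<Sum>i\<in>UNIV. m i * x i * (cos \<alpha> * s v * (x i + v$i$1))) - (\<Sum>i\<in>UNIV. m i * x i * (sin \<alpha> * s v * v$i$2))"
      unfolding mean1[OF uE(1), symmetric] 1 by (simp add: right_diff_distrib sum_subtractf)
    then have s1: "s u = cos \<alpha> * s v" using mean1[OF uE(2)] mean2[OF uE(2)] c by simp
    have "0 = (\<Sum>i\<in>UNIV. m i * x i * (sin \<alpha> * s v * (x i + v$i$1))) + (\<Sum>i\<in>UNIV. m i * x i * (cos \<alpha> * s v * v$i$2))"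
      unfolding mean2[OF uE(1), of "s u", symmetric] 2 by (simp add: distrib_left sum.distrib)
    then have "sin \<alpha> = 0" using mean1[OF uE(2)] mean2[OF uE(2)] c s_pos[of v] by simp
    moreover have "cos \<alpha> > 0" using s1 s_pos[of u] s_pos[of v] by (simp add: zero_less_mult_iff)
    ultimately have cs: "sin \<alpha> = 0" "cos \<alpha> = 1" using sin_zero_abs_cos_one[of \<alpha>] by auto
    then have "s u = s v" using s1 by simp
    then have "u$i$1 = v$i$1" "u$i$2 = v$i$2" for i
      using 1[of i] 2[of i] cs s_pos[of v] by auto
    then show "u = v" using uE by (simp add: config_eq_iff E_iff)
  qed
  have immersion: "v = 0"
    if u: "u \<in> V \<inter> E" and v: "v \<in> E"
      and span: "frechet_derivative \<phi> (at u) v \<in> span {vector_derivative (\<lambda>\<theta>. rotate_config \<theta> (\<phi> u)) (at 0)}" for u v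
  proof -
    have uE: "u \<in> E" using u by simp
    have "Ck_on (Suc 0) \<phi> V" using smooth unfolding smooth_on_def by blast
    then obtain A where A: "(\<phi> has_derivative A) (at u)" using u by auto
    then have fA: "frechet_derivative \<phi> (at u) = A" using frechet_derivative_at by metis
    obtain s' where s': "(s has_derivative s') (at u)" using s_smooth[of "Suc 0" UNIV] by auto
    have nth': "((\<lambda>u::'n config. u$i$l) has_derivative (\<lambda>v. v$i$l)) (at u)" for i l
      by (intro bounded_linear_imp_has_derivative bounded_linear_compose[OF bounded_linear_vec_nth bounded_linear_vec_nth])
    have A_nth: "((\<lambda>u. \<phi> u $ i $ l) has_derivative (\<lambda>v. A v $ i $ l)) (at u)" for i l
      by (intro bounded_linear.has_derivative[OF bounded_linear_vec_nth] A)
    have D1: "((\<lambda>u. s u * (x i + u$i$1)) has_derivative (\<lambda>v. s u * (0 + v$i$1) + s' v * (x i + u$i$1))) (at u)" for i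
      by (intro has_derivative_mult s' has_derivative_add has_derivative_const nth')
    have A1: "A v $ i $ 1 = s u * v$i$1 + s' v * (x i + u$i$1)" for i
      using fun_cong[OF has_derivative_unique[OF A_nth[of i 1, unfolded \<phi>_nth] D1], of v] by simp
    have D2: "((\<lambda>u. s u * u$i$2) has_derivative (\<lambda>v. s u * v$i$2 + s' v * u$i$2)) (at u)" for i
      by (intro has_derivative_mult s' nth')
    have A2: "A v $ i $ 2 = s u * v$i$2 + s' v * u$i$2" for i
      using fun_cong[OF has_derivative_unique[OF A_nth[of i 2, unfolded \<phi>_nth] D2], of v] by simp
    obtain \<kappa> where \<kappa>: "A v = \<kappa> *\<^sub>R (\<chi> i. vector [- \<phi> u $ i $ 2, \<phi> u $ i $ 1, 0])"
      using span unfolding fA orbit_direction by (auto simp: span_singleton)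
    have 1: "s u * v$i$1 + s' v * (x i + u$i$1) = - (\<kappa> * s u * u$i$2)" for i
      using A1[of i] arg_cong[OF \<kappa>, of "\<lambda>q. q$i$1"] by (simp add: \<phi>_nth)
    have 2: "s u * v$i$2 + s' v * u$i$2 = \<kappa> * s u * (x i + u$i$1)" for i
      using A2[of i] arg_cong[OF \<kappa>, of "\<lambda>q. q$i$2"] by (simp add: \<phi>_nth)
    have "(\<Sum>i\<in>UNIV. m i * x i * (s u * v$i$1)) + (\<Sum>i\<in>UNIV. m i * x i * (s' v * (x i + u$i$1)))
        = - (\<Sum>i\<in>UNIV. m i * x i * (\<kappa> * s u * u$i$2))"
      unfolding sum.distrib[symmetric] distrib_left[symmetric] 1 by (simp add: sum_negf)
    then have s'0: "s' v = 0" using mean1[OF uE] mean2[OF uE] mean3[OF v] c by simp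
    have "(\<Sum>i\<in>UNIV. m i * x i * (s u * v$i$2)) + (\<Sum>i\<in>UNIV. m i * x i * (s' v * u$i$2))
        = (\<Sum>i\<in>UNIV. m i * x i * (\<kappa> * s u * (x i + u$i$1)))"
      unfolding sum.distrib[symmetric] distrib_left[symmetric] 2 ..
    then have "\<kappa> = 0" using mean1[OF uE] mean2[OF uE] mean2[OF v] c s_pos[of u] by simp
    then have "v$i$1 = 0" "v$i$2 = 0" for i using 1[of i] 2[of i] s'0 s_pos[of u] by auto
    then show ?thesis using v by (simp add: config_eq_iff E_iff)
  qed
  have "quotient_param m c E V \<phi>"
    unfolding quotient_param_def
  proof (intro conjI subE dimE openV smooth injo)
    show "\<phi> ` (V \<inter> E) \<subseteq> level_set m c" using level by blast
    show "\<forall>u\<in>V \<inter> E. \<forall>v\<in>E. frechet_derivative \<phi> (at u) v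
        \<in> span {vector_derivative (\<lambda>\<theta>. rotate_config \<theta> (\<phi> u)) (at 0)} \<longrightarrow> v = 0"
      using immersion by blast
  qed
  moreover have "0 \<in> V \<inter> E"
  proof -
    have "P $ i \<noteq> P $ j" if "i \<noteq> j" for i j
      using inj that by (auto simp: P_def x_def vec_eq_iff[where 'b = 3] forall_3 inj_eq)
    then show ?thesis using subspace_0[OF subE] by (simp add: V_def)
  qed
  moreover have "\<phi> 0 = line_config \<theta>"
    using c by (simp add: \<phi>_def line_config_def s_def N_def x_def)
  ultimately show ?thesis by blast
qed

section \<open>Counting the classes\<close>

lemma rotate_config_linear: "bounded_linear (rotate_config \<theta> :: 'n::finite config \<Rightarrow> 'n config)"
  by (rule linear_conv_bounded_linear[THEN iffD1], rule linearI)
    (auto simp: config_eq_iff rotate_config_nth algebra_simps)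

lemma quotient_param_rotate:
  assumes param: "quotient_param m c E V \<phi>"
  shows "quotient_param m c E V (\<lambda>u. rotate_config \<alpha> (\<phi> u))"
  unfolding quotient_param_def
proof (intro conjI ballI impI)
  let ?R = "rotate_config \<alpha> :: 'a config \<Rightarrow> 'a config"
  show "subspace E" "dim E = 2 * CARD('a) - 2" "open V" using param by (auto simp: quotient_param_def)
  show "smooth_on (\<lambda>u. ?R (\<phi> u)) V"
    unfolding smooth_on_def
  proof
    have "\<forall>k. Ck_on k \<phi> V" using param by (simp add: quotient_param_def smooth_on_def)
    then show "Ck_on k (\<lambda>u. ?R (\<phi> u)) V" for k
      by (intro Ck_on_compose_linear[OF rotate_config_linear]) blast
  qed
  show "(\<lambda>u. ?R (\<phi> u)) ` (V \<inter> E) \<subseteq> level_set m c"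
    using param by (auto simp: quotient_param_def rotate_level_set)
  show "inj_on (\<lambda>u. orbit (?R (\<phi> u))) (V \<inter> E)"
    using param by (simp add: quotient_param_def orbit_rotate)
  fix u v assume u: "u \<in> V \<inter> E" and v: "v \<in> E"
    and span: "frechet_derivative (\<lambda>u. ?R (\<phi> u)) (at u) v
      \<in> span {vector_derivative (\<lambda>\<theta>. rotate_config \<theta> (?R (\<phi> u))) (at 0)}"
  obtain A where A: "(\<phi> has_derivative A) (at u)"
    using quotient_param_derivative[OF param] u by blast
  have "((\<lambda>u. ?R (\<phi> u)) has_derivative (\<lambda>v. ?R (A v))) (at u)"
    by (rule bounded_linear.has_derivative[OF rotate_config_linear A])
  then have "frechet_derivative (\<lambda>u. ?R (\<phi> u)) (at u) = (\<lambda>v. ?R (A v))"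
    by (rule frechet_derivative_at[symmetric])
  then have "?R (A v) \<in> span {vector_derivative (\<lambda>\<theta>. rotate_config \<theta> (?R (\<phi> u))) (at 0)}" using span by simp
  then obtain k where k: "?R (A v) = k *\<^sub>R (\<chi> i. vector [- ?R (\<phi> u) $ i $ 2, ?R (\<phi> u) $ i $ 1, 0])"
    unfolding orbit_direction by (auto simp: span_singleton)
  also have "\<dots> = ?R (k *\<^sub>R (\<chi> i. vector [- \<phi> u $ i $ 2, \<phi> u $ i $ 1, 0]))"
    by (simp add: config_eq_iff rotate_config_nth algebra_simps)
  finally have "rotate_config (- \<alpha>) (?R (A v)) = rotate_config (- \<alpha>) (?R (k *\<^sub>R (\<chi> i. vector [- \<phi> u $ i $ 2, \<phi> u $ i $ 1, 0])))"
    by simp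
  then have "A v = k *\<^sub>R vector_derivative (\<lambda>\<theta>. rotate_config \<theta> (\<phi> u)) (at 0)"
    unfolding rotate_inverse orbit_direction .
  moreover have "frechet_derivative \<phi> (at u) = A" using frechet_derivative_at[OF A] by simp
  ultimately have "frechet_derivative \<phi> (at u) v \<in> span {vector_derivative (\<lambda>\<theta>. rotate_config \<theta> (\<phi> u)) (at 0)}"
    by (simp add: span_base span_scale)
  then show "v = 0" using param u v unfolding quotient_param_def by blast
qed

lemma hyp1_ccs_line:
  assumes "q \<in> hyp1_ccs m c"
  obtains \<theta> \<mu> where "q = line_config \<theta>" "inj \<theta>" "cc_equations m \<mu> (line_config \<theta>)" "inertia_moment m (line_config \<theta>) = c"
proof -
  have "q = line_config (\<lambda>i. arsinh (q$i$1))" using assms by (intro hyp1_line) (simp add: hyp1_ccs_def)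
  then obtain \<theta> where q: "q = line_config \<theta>" by blast
  then have "inj \<theta>" using assms by (simp add: hyp1_ccs_def level_set_def line_config_space[symmetric])
  moreover obtain \<mu> where "cc_equations m \<mu> (line_config \<theta>)" using assms q by (auto simp: hyp1_ccs_def)
  moreover have "inertia_moment m (line_config \<theta>) = c" using assms q by (simp add: hyp1_ccs_def level_set_def)
  ultimately show ?thesis using q that by blast
qed

text \<open>A parametrization may reach the class at a rotated representative. Rotating the parametrization
  instead brings the representative to the line and does not change the induced function.\<close>

lemma hessian_inertia_hyp1_cc:
  fixes m :: "'n::{finite,linorder} \<Rightarrow> real"
  assumes m: "\<And>i. m i > 0" and n: "CARD('n) \<ge> 2" and q: "q \<in> hyp1_ccs m c"
  shows "quotient_hessian_inertia m c (induced_fun (potential m)) (orbit q) (0, CARD('n), CARD('n) - 2)"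
  unfolding quotient_hessian_inertia_def
proof (intro conjI allI ballI impI)
  obtain \<theta> \<mu> where q\<theta>: "q = line_config \<theta>" and inj: "inj \<theta>" and cc: "cc_equations m \<mu> (line_config \<theta>)"
    and I: "inertia_moment m (line_config \<theta>) = c"
    using hyp1_ccs_line[OF q] by blast
  show "\<exists>E V \<phi>. quotient_param m c E V \<phi> \<and> (\<exists>u\<in>V \<inter> E. orbit (\<phi> u) = orbit q)"
    using exists_quotient_param[OF inj m n I] unfolding q\<theta> by metis
  fix E V \<phi> u
  assume u: "u \<in> V \<inter> E" and param: "quotient_param m c E V \<phi>" and orb: "orbit (\<phi> u) = orbit q"
  obtain \<alpha> where "q = rotate_config \<alpha> (\<phi> u)" using orb orbit_eq_iff by metis
  then have \<phi>u: "rotate_config \<alpha> (\<phi> u) = line_config \<theta>" using q\<theta> by simp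
  have "inertia E (hessian_form (\<lambda>x. induced_fun (potential m) (orbit (rotate_config \<alpha> (\<phi> x)))) u)
      = (0, CARD('n), CARD('n) - 2)"
    by (rule inertia_at_line_cc[OF quotient_param_rotate[OF param] u \<phi>u cc inj m n])
  then show "inertia E (hessian_form (\<lambda>x. induced_fun (potential m) (orbit (\<phi> x))) u) = (0, CARD('n), CARD('n) - 2)"
    by (simp add: orbit_rotate)
qed

lemma ordered_on_hyp1_iff:
  "ordered_on_hyp1 \<sigma> q \<longleftrightarrow> (\<forall>i. q$i \<in> hyp1) \<and> sorted_wrt (<) (map (\<lambda>i. q$i$1) \<sigma>)"
  by (simp add: ordered_on_hyp1_def sorted_wrt_map)

lemma ordered_on_hyp1_rotate_pi:
  assumes "ordered_on_hyp1 \<sigma> q"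
  shows "ordered_on_hyp1 (rev \<sigma>) (rotate_config pi q)"
proof -
  have q: "q$i \<in> hyp2" "q$i$2 = 0" for i using assms by (auto simp: ordered_on_hyp1_def hyp1_def)
  then have "rotate_config pi q $ i \<in> hyp1" for i
    using rotate_hyp2[of pi q] by (simp add: hyp1_def rotate_config_nth)
  moreover have "sorted_wrt (\<lambda>i j. q$j$1 < q$i$1) (rev \<sigma>)"
    using assms by (simp add: ordered_on_hyp1_def sorted_wrt_rev)
  ultimately show ?thesis by (simp add: ordered_on_hyp1_def rotate_config_nth)
qed

lemma ordered_list_unique:
  assumes "ordered_on_hyp1 \<sigma> q" "ordered_on_hyp1 \<tau> q" "set \<sigma> = set \<tau>"
    and inj: "inj (\<lambda>i. q$i$1)"
  shows "\<sigma> = \<tau>"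
proof -
  have "map (\<lambda>i. q$i$1) \<sigma> = map (\<lambda>i. q$i$1) \<tau>"
  proof (rule strict_sorted_equal)
    show "sorted_wrt (<) (map (\<lambda>i. q$i$1) \<sigma>)" "sorted_wrt (<) (map (\<lambda>i. q$i$1) \<tau>)"
      using assms(1,2) by (simp_all add: ordered_on_hyp1_iff)
    show "set (map (\<lambda>i. q$i$1) \<sigma>) = set (map (\<lambda>i. q$i$1) \<tau>)" using assms(3) by simp
  qed
  then show ?thesis using inj by (simp add: inj_map_eq_map)
qed

lemma ordered_same_order:
  assumes \<sigma>: "set \<sigma> = UNIV" "ordered_on_hyp1 \<sigma> q" "ordered_on_hyp1 \<sigma> p"
    and less: "q$i$1 < q$j$1"
  shows "p$i$1 < p$j$1"
proof -
  obtain a b where ab: "a < length \<sigma>" "b < length \<sigma>" "\<sigma> ! a = i" "\<sigma> ! b = j"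
    using \<sigma>(1) by (metis UNIV_I in_set_conv_nth)
  have *: "r $ (\<sigma> ! a) $ 1 < r $ (\<sigma> ! b) $ 1" if "a < b" "b < length \<sigma>" "ordered_on_hyp1 \<sigma> r" for r a b
    using that by (auto simp: ordered_on_hyp1_def sorted_wrt_iff_nth_less)
  have "a < b"
  proof (rule ccontr)
    assume "\<not> a < b"
    then have "a = b \<or> b < a" by auto
    then show False using *[of b a q] ab \<sigma>(2) less by auto
  qed
  then show ?thesis using *[of a b p] ab \<sigma>(3) by auto
qed

text \<open>The rank of an index is its position in the list.\<close>

lemma hyp1_cc_of_ordering:
  fixes m :: "'n::{finite,linorder} \<Rightarrow> real"
  assumes m: "\<And>i. m i > 0" and n: "CARD('n) \<ge> 2" and c: "c > 0" and \<sigma>: "\<sigma> \<in> permutations_of_set UNIV"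
  shows "\<exists>!q. q \<in> hyp1_ccs m c \<and> ordered_on_hyp1 \<sigma> q"
proof -
  have \<sigma>': "set \<sigma> = UNIV" "distinct \<sigma>" using \<sigma> by (auto simp: permutations_of_set_def)
  define \<rho> where "\<rho> i = (THE a. a < length \<sigma> \<and> \<sigma> ! a = i)" for i
  have \<rho>_nth: "\<rho> (\<sigma> ! a) = a" if "a < length \<sigma>" for a
    unfolding \<rho>_def using that \<sigma>'(2) by (intro the_equality) (auto simp: nth_eq_iff_index_eq)
  have "inj \<rho>"
  proof (rule injI)
    fix i j assume "\<rho> i = \<rho> j"
    moreover obtain a b where "a < length \<sigma>" "\<sigma> ! a = i" "b < length \<sigma>" "\<sigma> ! b = j"
      using \<sigma>'(1) by (metis UNIV_I in_set_conv_nth)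
    ultimately show "i = j" using \<rho>_nth by metis
  qed
  then obtain q where q: "q \<in> hyp1_ccs m c" "\<forall>i j. \<rho> i < \<rho> j \<longrightarrow> q$i$1 < q$j$1"
    using exists_hyp1_cc[of m c \<rho>, OF m c] by blast
  have "ordered_on_hyp1 \<sigma> q"
    using q \<rho>_nth unfolding ordered_on_hyp1_def sorted_wrt_iff_nth_less hyp1_ccs_def by auto
  then show ?thesis
  proof (intro ex1I[of _ q] conjI)
    fix p assume p: "p \<in> hyp1_ccs m c \<and> ordered_on_hyp1 \<sigma> p"
    show "p = q"
    proof (rule hyp1_cc_unique[OF m n])
      show "p \<in> hyp1_ccs m c" "q \<in> hyp1_ccs m c" using p q by auto
      show "p$i$1 < p$j$1 \<longleftrightarrow> q$i$1 < q$j$1" for i j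
        using ordered_same_order[OF \<sigma>'(1)] p \<open>ordered_on_hyp1 \<sigma> q\<close> by blast
    qed
  qed (use q in auto)
qed

lemma orbit_orderings:
  fixes m :: "'n::{finite,linorder} \<Rightarrow> real"
  assumes n: "CARD('n) \<ge> 2" and q: "q \<in> hyp1_ccs m c"
  obtains \<sigma> where "\<sigma> \<in> permutations_of_set UNIV"
    "{\<tau> \<in> permutations_of_set UNIV. has_ordering (orbit q) \<tau>} = {\<sigma>, rev \<sigma>}"
proof -
  obtain \<theta> where q\<theta>: "q = line_config \<theta>" "inj \<theta>" using hyp1_ccs_line[OF q] by metis
  have inj: "inj (\<lambda>i. q$i$1)" using q\<theta> by (simp add: inj_def)
  have h1: "q$i \<in> hyp1" for i using q by (simp add: hyp1_ccs_def)
  have cs: "q \<in> config_space" using q by (simp add: hyp1_ccs_def level_set_def)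
  define \<sigma> where "\<sigma> = map (inv (\<lambda>i. q$i$1)) (sorted_list_of_set (range (\<lambda>i. q$i$1)))"
  have map: "map (\<lambda>i. q$i$1) \<sigma> = sorted_list_of_set (range (\<lambda>i. q$i$1))"
    unfolding \<sigma>_def map_map by (rule map_idI) (auto simp: inv_f_f[OF inj])
  have ord: "ordered_on_hyp1 \<sigma> q"
    unfolding ordered_on_hyp1_iff map using h1 by simp
  have "set (map (\<lambda>i. q$i$1) \<sigma>) = range (\<lambda>i. q$i$1)" unfolding map by simp
  then have set: "set \<sigma> = UNIV" using inj by (simp add: inj_image_eq_iff)
  have "distinct (map (\<lambda>i. q$i$1) \<sigma>)" unfolding map by simp
  then have "distinct \<sigma>" by (simp add: distinct_map)
  then have \<sigma>: "\<sigma> \<in> permutations_of_set UNIV" using set by (simp add: permutations_of_set_def)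
  moreover have "{\<tau> \<in> permutations_of_set UNIV. has_ordering (orbit q) \<tau>} = {\<sigma>, rev \<sigma>}"
  proof
    show "{\<sigma>, rev \<sigma>} \<subseteq> {\<tau> \<in> permutations_of_set UNIV. has_ordering (orbit q) \<tau>}"
    proof -
      have "has_ordering (orbit q) \<sigma>" using ord self_mem_orbit has_ordering_def by blast
      moreover have "has_ordering (orbit q) (rev \<sigma>)"
        unfolding has_ordering_def using ordered_on_hyp1_rotate_pi[OF ord] mem_orbit by blast
      moreover have "rev \<sigma> \<in> permutations_of_set UNIV" using \<sigma> by (simp add: permutations_of_set_def)
      ultimately show ?thesis using \<sigma> by auto
    qed
    show "{\<tau> \<in> permutations_of_set UNIV. has_ordering (orbit q) \<tau>} \<subseteq> {\<sigma>, rev \<sigma>}"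
    proof
      fix \<tau> assume "\<tau> \<in> {\<tau> \<in> permutations_of_set UNIV. has_ordering (orbit q) \<tau>}"
      then obtain p where \<tau>: "set \<tau> = UNIV" and p: "p \<in> orbit q" "ordered_on_hyp1 \<tau> p"
        by (auto simp: has_ordering_def permutations_of_set_def)
      obtain \<alpha> where p\<alpha>: "p = rotate_config \<alpha> q" using p(1) mem_orbit by blast
      have "p = q \<or> p = rotate_config pi q"
        unfolding p\<alpha> by (rule hyp1_orbit[OF cs h1 _ n]) (use p(2) p\<alpha> in \<open>simp add: ordered_on_hyp1_def\<close>)
      then show "\<tau> \<in> {\<sigma>, rev \<sigma>}"
      proof
        assume "p = q"
        then have "\<tau> = \<sigma>" using ordered_list_unique[OF _ ord _ inj] p(2) \<tau> set by simp
        then show ?thesis by simp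
      next
        assume pr: "p = rotate_config pi q"
        have "inj (\<lambda>i. p$i$1)" unfolding pr using inj q\<theta> by (simp add: rotate_config_nth inj_def)
        moreover have "ordered_on_hyp1 (rev \<sigma>) p" unfolding pr by (rule ordered_on_hyp1_rotate_pi[OF ord])
        ultimately have "\<tau> = rev \<sigma>" using ordered_list_unique[OF p(2)] \<tau> set by simp
        then show ?thesis by simp
      qed
    qed
  qed
  ultimately show ?thesis by (rule that)
qed

lemma class_of_ordering:
  fixes m :: "'n::{finite,linorder} \<Rightarrow> real"
  assumes m: "\<And>i. m i > 0" and n: "CARD('n) \<ge> 2" and c: "c > 0" and \<sigma>: "\<sigma> \<in> permutations_of_set UNIV"
  shows "\<exists>!C. C \<in> geodesic_cc_classes m c \<and> has_ordering C \<sigma>"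
proof -
  obtain q where q: "q \<in> hyp1_ccs m c" "ordered_on_hyp1 \<sigma> q"
    and uniq: "\<And>p. p \<in> hyp1_ccs m c \<Longrightarrow> ordered_on_hyp1 \<sigma> p \<Longrightarrow> p = q"
    using hyp1_cc_of_ordering[of m c \<sigma>, OF m n c \<sigma>] unfolding Ex1_def by blast
  show ?thesis
  proof (intro ex1I[of _ "orbit q"] conjI)
    show "orbit q \<in> geodesic_cc_classes m c" using q(1) geodesic_cc_classes_eq[of m c, OF m n] by blast
    show "has_ordering (orbit q) \<sigma>" using q(2) self_mem_orbit has_ordering_def by blast
    fix C assume C: "C \<in> geodesic_cc_classes m c \<and> has_ordering C \<sigma>"
    then obtain p where p: "p \<in> hyp1_ccs m c" "C = orbit p" using geodesic_cc_classes_eq[of m c, OF m n] by blast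
    obtain \<alpha> where \<alpha>: "ordered_on_hyp1 \<sigma> (rotate_config \<alpha> p)"
      using C p(2) by (auto simp: has_ordering_def mem_orbit)
    have "rotate_config \<alpha> p \<in> hyp1_ccs m c"
      using p(1) \<alpha> cc_equations_rotate by (fastforce simp: hyp1_ccs_def rotate_level_set ordered_on_hyp1_def)
    then have "rotate_config \<alpha> p = q" using uniq \<alpha> by blast
    then show "C = orbit q" using p(2) orbit_rotate by metis
  qed
qed

lemma card_two_to_one:
  assumes fin: "finite A" and f: "f ` A = B" and fib: "\<And>b. b \<in> B \<Longrightarrow> card {a\<in>A. f a = b} = 2"
  shows "card A = 2 * card B"
proof -
  have "card A = (\<Sum>b\<in>B. card {a\<in>A. f a = b})"
    using sum.image_gen[OF fin, of "\<lambda>_. 1::nat" f] f by simp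
  also have "\<dots> = 2 * card B" using fib by simp
  finally show ?thesis .
qed

theorem theorem12:
  fixes m :: "'n::{finite,linorder} \<Rightarrow> real" and c :: real
  assumes "CARD('n) \<ge> 2" and "\<And>i. m i > 0" and "c > 0"
  shows "card (geodesic_cc_classes m c) = fact CARD('n) div 2 \<and>
    (\<forall>\<sigma>\<in>permutations_of_set UNIV. \<exists>!C. C \<in> geodesic_cc_classes m c \<and> has_ordering C \<sigma>) \<and>
    (\<forall>C\<in>geodesic_cc_classes m c. \<exists>\<sigma>\<in>permutations_of_set UNIV.
        {\<tau> \<in> permutations_of_set UNIV. has_ordering C \<tau>} = {\<sigma>, rev \<sigma>}) \<and>
    (\<forall>\<sigma>\<in>permutations_of_set UNIV. \<forall>q::'n config.
        ordered_on_hyp1 \<sigma> q \<longrightarrow> ordered_on_hyp1 (rev \<sigma>) (rotate_config pi q)) \<and>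
    (\<forall>C\<in>geodesic_cc_classes m c.
        quotient_hessian_inertia m c (induced_fun (potential m)) C
          (0, CARD('n), CARD('n) - 2))"
proof (intro conjI ballI allI impI)
  note n = assms(1) and m = assms(2) and c = assms(3)
  have classes: "geodesic_cc_classes m c = orbit ` hyp1_ccs m c" by (rule geodesic_cc_classes_eq[of m c, OF m n])
  have uniq: "\<exists>!C. C \<in> geodesic_cc_classes m c \<and> has_ordering C \<sigma>"
    if "\<sigma> \<in> permutations_of_set UNIV" for \<sigma> by (rule class_of_ordering[OF m n c that])
  have two: "\<exists>\<sigma>\<in>permutations_of_set UNIV. {\<tau> \<in> permutations_of_set UNIV. has_ordering C \<tau>} = {\<sigma>, rev \<sigma>}"
    if C: "C \<in> geodesic_cc_classes m c" for C
  proof -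
    obtain q where q: "C = orbit q" "q \<in> hyp1_ccs m c" using C classes by blast
    show ?thesis unfolding q(1) by (rule orbit_orderings[OF n q(2)]) (rule bexI)
  qed
  show "\<exists>!C. C \<in> geodesic_cc_classes m c \<and> has_ordering C \<sigma>"
    if "\<sigma> \<in> permutations_of_set UNIV" for \<sigma> by (rule uniq[OF that])
  show "\<exists>\<sigma>\<in>permutations_of_set UNIV. {\<tau> \<in> permutations_of_set UNIV. has_ordering C \<tau>} = {\<sigma>, rev \<sigma>}"
    if "C \<in> geodesic_cc_classes m c" for C by (rule two[OF that])
  show "ordered_on_hyp1 (rev \<sigma>) (rotate_config pi q)"
    if "ordered_on_hyp1 \<sigma> q" for \<sigma> and q :: "'n config" by (rule ordered_on_hyp1_rotate_pi[OF that])
  show "quotient_hessian_inertia m c (induced_fun (potential m)) C (0, CARD('n), CARD('n) - 2)"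
    if C: "C \<in> geodesic_cc_classes m c" for C
  proof -
    obtain q where q: "C = orbit q" "q \<in> hyp1_ccs m c" using C classes by blast
    show ?thesis unfolding q(1) by (rule hessian_inertia_hyp1_cc[OF m n q(2)])
  qed
  define f where "f \<sigma> = (THE C. C \<in> geodesic_cc_classes m c \<and> has_ordering C \<sigma>)" for \<sigma>
  have f: "f \<sigma> \<in> geodesic_cc_classes m c \<and> has_ordering (f \<sigma>) \<sigma>" if "\<sigma> \<in> permutations_of_set UNIV" for \<sigma>
    unfolding f_def by (rule theI'[OF uniq[OF that]])
  have f_eq: "f \<sigma> = C \<longleftrightarrow> has_ordering C \<sigma>" if "\<sigma> \<in> permutations_of_set UNIV" "C \<in> geodesic_cc_classes m c" for \<sigma> C
    using f[OF that(1)] uniq[OF that(1)] that(2) by blast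
  have "card (permutations_of_set (UNIV :: 'n set)) = 2 * card (geodesic_cc_classes m c)"
  proof (rule card_two_to_one[where f = f])
    show "f ` permutations_of_set UNIV = geodesic_cc_classes m c"
    proof
      show "f ` permutations_of_set UNIV \<subseteq> geodesic_cc_classes m c" using f by blast
      show "geodesic_cc_classes m c \<subseteq> f ` permutations_of_set UNIV"
      proof
        fix C assume C: "C \<in> geodesic_cc_classes m c"
        obtain \<sigma> where "\<sigma> \<in> permutations_of_set UNIV" "has_ordering C \<sigma>" using two[OF C] by blast
        then show "C \<in> f ` permutations_of_set UNIV" using f_eq C by blast
      qed
    qed
    fix C assume C: "C \<in> geodesic_cc_classes m c"
    obtain \<sigma> where \<sigma>: "\<sigma> \<in> permutations_of_set UNIV"
      "{\<tau> \<in> permutations_of_set UNIV. has_ordering C \<tau>} = {\<sigma>, rev \<sigma>}" using two[OF C] by blast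
    have "{\<tau> \<in> permutations_of_set UNIV. f \<tau> = C} = {\<sigma>, rev \<sigma>}"
      using \<sigma>(2) f_eq C by blast
    moreover have "\<sigma> \<noteq> rev \<sigma>"
    proof
      assume eq: "\<sigma> = rev \<sigma>"
      have d: "distinct \<sigma>" "length \<sigma> = CARD('n)"
        using \<sigma>(1) by (auto simp: permutations_of_set_def distinct_card[symmetric])
      have "\<sigma> ! 0 = \<sigma> ! (length \<sigma> - 1)" using arg_cong[OF eq, of "\<lambda>l. l ! 0"] d(2) n by (simp add: rev_nth)
      then show False using d n by (subst (asm) nth_eq_iff_index_eq) auto
    qed
    ultimately show "card {\<tau> \<in> permutations_of_set UNIV. f \<tau> = C} = 2" by simp
  qed simp
  then show "card (geodesic_cc_classes m c) = fact CARD('n) div 2"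
    by (simp add: card_permutations_of_set)
qed

end
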